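(* A bounded operator $T$ on $H^2(\mathbb G)$ is an asymptotic Toeplitz operator if and only if $T$ is the sum of a compact operator and a Toeplitz operator.
   Context: $\mathbb D$ is the open unit disc, $\mathbb T$ the unit circle, $m$ the product of normalized arc length measures on $\mathbb T^2=\mathbb T\times\mathbb T$. Let $\pi(z_1,z_2)=(z_1+z_2,z_1z_2)$, $J(z_1,z_2)=z_1-z_2$, $\|J\|^2=\int_{\mathbb T^2}|J|^2dm=2$, $\mathbb G=\pi(\mathbb D^2)$ and $b\Gamma=\pi(\mathbb T^2)$, with coordinates denoted $(s,p)$. Let $\nu$ be the Borel measure on $b\Gamma$ given by $\nu(E)=\int_{\pi^{-1}(E)}|J|^2dm$. $L^2(b\Gamma)$ is the Hilbert space of ($\nu$-a.e. classes of) functions on $b\Gamma$ with $\int|f|^2d\nu<\infty$, with norm $\|f\|^2=\|J\|^{-2}\int_{b\Gamma}|f|^2d\nu$; $L^\infty(b\Gamma)$ is the space of essentially bounded functions. $L^2_{\rm anti}(\mathbb T^2)=\{f\in L^2(\mathbb T^2):f(\zeta_1,\zeta_2)=-f(\zeta_2,\zeta_1)\text{ a.e.}\}$, and $U:L^2(b\Gamma)\to L^2_{\rm anti}(\mathbb T^2)$ is the unitary $Uf=\frac1{\|J\|}J\,(f\circ\pi)$. $H^2(\mathbb G)$ is the Hilbert space of holomorphic $f$ on $\mathbb G$ with $\|f\|=\|J\|^{-1}\{\sup_{0<r<1}\int_{\mathbb T^2}|f\circ\pi(r\zeta)|^2|J(r\zeta)|^2dm(\zeta)\}^{1/2}<\infty$;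 via boundary values it is identified with the closed subspace of those $f\in L^2(b\Gamma)$ for which $Uf$ has Fourier coefficients supported on $\{(i,j):i,j\ge0\}$. $U$ maps $H^2(\mathbb G)$ unitarily onto $H^2_{\rm anti}(\mathbb D^2)$, the antisymmetric functions ($f(z_1,z_2)=-f(z_2,z_1)$) in the Hardy space of the bidisc. $Pr$ is the orthogonal projection of $L^2(b\Gamma)$ onto $H^2(\mathbb G)$. For $\varphi\in L^\infty(b\Gamma)$, $M_\varphi$ is multiplication by $\varphi$ on $L^2(b\Gamma)$ and the Toeplitz operator $T_\varphi$ on $H^2(\mathbb G)$ is $T_\varphi f=Pr\,M_\varphi f$. $T_s$ and $T_p$ are the Toeplitz operators with the coordinate functions $s$ and $p$ as symbols. $X$ is the bounded operator on $H^2_{\rm anti}(\mathbb D^2)$ determined on the orthogonal basis $\{(z_1z_2)^i(z_1^j-z_2^j):i\ge0,j\ge1\}$ by $X(z_1z_2)^i(z_1^j-z_2^j)=(z_1z_2)^i(z_1^{j+1}-z_2^{j+1})$, and $Y=U^*XU$ on $H^2(\mathbb G)$. For $n\ge1$, $\eta_n:\mathcal B(H^2(\mathbb G))\to\mathcal B(H^2(\mathbb G)\oplus H^2(\mathbb G))$ is $$\eta_n(T)=\begin{pmatrix} Y^{*n} \\ T_p^{*n} \end{pmatrix}T\begin{pmatrix}Y^n&T_p^n\end{pmatrix}.$$ With $[T,T_s]=TT_s-T_sT$, a bounded operator $T$ on $H^2(\mathbb G)$ is called an asymptotic Toeplitz operator if there is a bounded operator $B$ on $H^2(\mathbb G)$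 such that, as $n\to\infty$, $T_p^{*n}[T,T_s]T_p^n\to0$ weakly, $T_p^{*n}TT_p^n\to B$ weakly, and $\eta_n(T-B)\to0$ in norm. *)

theory Defs
  imports "HOL-Analysis.Analysis"
begin

text \<open>
  Elements of an \<open>L\<^sup>2\<close> space are represented by square-integrable functions, with a.e. equality
  in place of equality. A space is given by a measure \<open>M\<close> and a set \<open>H\<close> of representatives, and an
  operator is a map on representatives; its values outside \<open>H\<close> are irrelevant, and every notion
  below depends on the operator only up to a.e. equality of its values on \<open>H\<close>.
\<close>

definition l2 :: "'a measure \<Rightarrow> ('a \<Rightarrow> complex) set" where
  "l2 M = {f \<in> borel_measurable M. integrable M (\<lambda>x. (cmod (f x))\<^sup>2)}"

definition l2_inner :: "'a measure \<Rightarrow> ('a \<Rightarrow> complex) \<Rightarrow> ('a \<Rightarrow> complex) \<Rightarrow> complex" where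
  "l2_inner M f g = (\<integral>x. f x * cnj (g x) \<partial>M)"

definition l2_norm :: "'a measure \<Rightarrow> ('a \<Rightarrow> complex) \<Rightarrow> real" where
  "l2_norm M f = sqrt (\<integral>x. (cmod (f x))\<^sup>2 \<partial>M)"

definition bounded_op ::
    "'a measure \<Rightarrow> ('a \<Rightarrow> complex) set \<Rightarrow> (('a \<Rightarrow> complex) \<Rightarrow> 'a \<Rightarrow> complex) \<Rightarrow> bool" where
  "bounded_op M H T \<longleftrightarrow>
     (\<forall>f\<in>H. T f \<in> H) \<and>
     (\<forall>f\<in>H. \<forall>g\<in>H. (AE x in M. f x = g x) \<longrightarrow> (AE x in M. T f x = T g x)) \<and>
     (\<forall>f\<in>H. \<forall>g\<in>H. AE x in M. T (\<lambda>y. f y + g y) x = T f x + T g x) \<and>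
     (\<forall>c. \<forall>f\<in>H. AE x in M. T (\<lambda>y. c * f y) x = c * T f x) \<and>
     (\<exists>C. \<forall>f\<in>H. l2_norm M (T f) \<le> C * l2_norm M f)"

definition compact_op ::
    "'a measure \<Rightarrow> ('a \<Rightarrow> complex) set \<Rightarrow> (('a \<Rightarrow> complex) \<Rightarrow> 'a \<Rightarrow> complex) \<Rightarrow> bool" where
  "compact_op M H K \<longleftrightarrow> bounded_op M H K \<and>
     (\<forall>f :: nat \<Rightarrow> 'a \<Rightarrow> complex.
        (\<forall>n. f n \<in> H) \<and> (\<exists>C. \<forall>n. l2_norm M (f n) \<le> C) \<longrightarrow>
        (\<exists>r g. strict_mono r \<and> g \<in> H \<and>
           (\<lambda>n. l2_norm M (\<lambda>x. K (f (r n)) x - g x)) \<longlonglongrightarrow> 0))"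

definition weakly_tendsto ::
    "'a measure \<Rightarrow> ('a \<Rightarrow> complex) set \<Rightarrow> (nat \<Rightarrow> ('a \<Rightarrow> complex) \<Rightarrow> 'a \<Rightarrow> complex) \<Rightarrow>
     (('a \<Rightarrow> complex) \<Rightarrow> 'a \<Rightarrow> complex) \<Rightarrow> bool" where
  "weakly_tendsto M H A B \<longleftrightarrow>
     (\<forall>f\<in>H. \<forall>g\<in>H. (\<lambda>n. l2_inner M (A n f) g) \<longlonglongrightarrow> l2_inner M (B f) g)"

text \<open>The adjoint of an operator from \<open>H \<subseteq> L\<^sup>2(M)\<close> to a subspace of \<open>L\<^sup>2(N)\<close>; the chosen
  representative is unique up to a.e. equality.\<close>

definition l2_adjoint ::
    "'a measure \<Rightarrow> ('a \<Rightarrow> complex) set \<Rightarrow> 'b measure \<Rightarrow>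
     (('a \<Rightarrow> complex) \<Rightarrow> 'b \<Rightarrow> complex) \<Rightarrow> ('b \<Rightarrow> complex) \<Rightarrow> 'a \<Rightarrow> complex" where
  "l2_adjoint M H N T g = (SOME h. h \<in> H \<and> (\<forall>f\<in>H. l2_inner M f h = l2_inner N (T f) g))"

definition l2_proj ::
    "'a measure \<Rightarrow> ('a \<Rightarrow> complex) set \<Rightarrow> ('a \<Rightarrow> complex) \<Rightarrow> 'a \<Rightarrow> complex" where
  "l2_proj M H g = (SOME h. h \<in> H \<and> (\<forall>f\<in>H. l2_inner M (\<lambda>x. g x - h x) f = 0))"

definition dsum_norm :: "'a measure \<Rightarrow> ('a \<Rightarrow> complex) \<times> ('a \<Rightarrow> complex) \<Rightarrow> real" where
  "dsum_norm M u = sqrt ((l2_norm M (fst u))\<^sup>2 + (l2_norm M (snd u))\<^sup>2)"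

definition dsum_opnorm ::
    "'a measure \<Rightarrow> ('a \<Rightarrow> complex) set \<Rightarrow>
     (('a \<Rightarrow> complex) \<times> ('a \<Rightarrow> complex) \<Rightarrow> ('a \<Rightarrow> complex) \<times> ('a \<Rightarrow> complex)) \<Rightarrow> real" where
  "dsum_opnorm M H A = (SUP u \<in> {u \<in> H \<times> H. dsum_norm M u \<le> 1}. dsum_norm M (A u))"


text \<open>The measures below live on all of \<open>\<complex>\<close> or \<open>\<complex>\<^sup>2\<close> but are concentrated on the circle, the torus
  and \<open>b\<Gamma>\<close>, so only the values of functions there matter.\<close>

definition circle_measure :: "complex measure" where
  "circle_measure = distr (uniform_measure lborel {0..2 * pi}) borel cis"

definition torus_measure :: "(complex \<times> complex) measure" where
  "torus_measure = circle_measure \<Otimes>\<^sub>M circle_measure"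

definition sym_map :: "complex \<times> complex \<Rightarrow> complex \<times> complex" where
  "sym_map z = (fst z + snd z, fst z * snd z)"

definition Jac :: "complex \<times> complex \<Rightarrow> complex" where
  "Jac z = fst z - snd z"

definition Jac_norm :: real where
  "Jac_norm = l2_norm torus_measure Jac"

definition nu :: "(complex \<times> complex) measure" where
  "nu = distr (density torus_measure (\<lambda>z. ennreal ((cmod (Jac z))\<^sup>2))) borel sym_map"

text \<open>Scaling by \<open>\<parallel>J\<parallel>\<^sup>-\<^sup>2\<close> makes \<open>l2_norm\<close> the normalised norm of \<open>L\<^sup>2(b\<Gamma>)\<close>.\<close>

definition bG :: "(complex \<times> complex) measure" where
  "bG = scale_measure (ennreal (1 / Jac_norm\<^sup>2)) nu"

definition Linfty_bG :: "(complex \<times> complex \<Rightarrow> complex) set" where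
  "Linfty_bG = {\<phi> \<in> borel_measurable nu. \<exists>C. AE x in nu. cmod (\<phi> x) \<le> C}"

definition L2_anti :: "(complex \<times> complex \<Rightarrow> complex) set" where
  "L2_anti = {f \<in> l2 torus_measure. AE z in torus_measure. f z = - f (prod.swap z)}"

definition fourier_coeff :: "(complex \<times> complex \<Rightarrow> complex) \<Rightarrow> int \<Rightarrow> int \<Rightarrow> complex" where
  "fourier_coeff f i j = l2_inner torus_measure f (\<lambda>z. fst z powi i * snd z powi j)"

definition U :: "(complex \<times> complex \<Rightarrow> complex) \<Rightarrow> complex \<times> complex \<Rightarrow> complex" where
  "U f z = complex_of_real (1 / Jac_norm) * Jac z * f (sym_map z)"

definition U_adj :: "(complex \<times> complex \<Rightarrow> complex) \<Rightarrow> complex \<times> complex \<Rightarrow> complex" where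
  "U_adj = l2_adjoint bG (l2 bG) torus_measure U"

text \<open>The Hardy spaces are taken as spaces of boundary values.\<close>

definition H2_anti :: "(complex \<times> complex \<Rightarrow> complex) set" where
  "H2_anti = {f \<in> L2_anti. \<forall>i j. i < 0 \<or> j < 0 \<longrightarrow> fourier_coeff f i j = 0}"

definition H2_G :: "(complex \<times> complex \<Rightarrow> complex) set" where
  "H2_G = {f \<in> l2 bG. \<forall>i j. i < 0 \<or> j < 0 \<longrightarrow> fourier_coeff (U f) i j = 0}"

definition toeplitz ::
    "(complex \<times> complex \<Rightarrow> complex) \<Rightarrow> (complex \<times> complex \<Rightarrow> complex) \<Rightarrow> complex \<times> complex \<Rightarrow> complex"
  where "toeplitz \<phi> f = l2_proj bG H2_G (\<lambda>x. \<phi> x * f x)"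

definition T_s :: "(complex \<times> complex \<Rightarrow> complex) \<Rightarrow> complex \<times> complex \<Rightarrow> complex" where
  "T_s = toeplitz fst"

definition T_p :: "(complex \<times> complex \<Rightarrow> complex) \<Rightarrow> complex \<times> complex \<Rightarrow> complex" where
  "T_p = toeplitz snd"

definition anti_basis :: "nat \<Rightarrow> nat \<Rightarrow> complex \<times> complex \<Rightarrow> complex" where
  "anti_basis i j z = (fst z * snd z) ^ i * (fst z ^ j - snd z ^ j)"

definition X :: "(complex \<times> complex \<Rightarrow> complex) \<Rightarrow> complex \<times> complex \<Rightarrow> complex" where
  "X = (SOME A. bounded_op torus_measure H2_anti A \<and>
     (\<forall>i. \<forall>j\<ge>1. AE z in torus_measure. A (anti_basis i j) z = anti_basis i (j + 1) z))"

definition Y :: "(complex \<times> complex \<Rightarrow> complex) \<Rightarrow> complex \<times> complex \<Rightarrow> complex" where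
  "Y f = U_adj (X (U f))"

definition Y_adj :: "(complex \<times> complex \<Rightarrow> complex) \<Rightarrow> complex \<times> complex \<Rightarrow> complex" where
  "Y_adj = l2_adjoint bG H2_G bG Y"

definition T_p_adj :: "(complex \<times> complex \<Rightarrow> complex) \<Rightarrow> complex \<times> complex \<Rightarrow> complex" where
  "T_p_adj = l2_adjoint bG H2_G bG T_p"

definition eta ::
    "nat \<Rightarrow> ((complex \<times> complex \<Rightarrow> complex) \<Rightarrow> complex \<times> complex \<Rightarrow> complex) \<Rightarrow>
     (complex \<times> complex \<Rightarrow> complex) \<times> (complex \<times> complex \<Rightarrow> complex) \<Rightarrow>
     (complex \<times> complex \<Rightarrow> complex) \<times> (complex \<times> complex \<Rightarrow> complex)" where
  "eta n T u = (let h = T (\<lambda>x. (Y ^^ n) (fst u) x + (T_p ^^ n) (snd u) x)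
                in ((Y_adj ^^ n) h, (T_p_adj ^^ n) h))"

definition asymptotic_toeplitz ::
    "((complex \<times> complex \<Rightarrow> complex) \<Rightarrow> complex \<times> complex \<Rightarrow> complex) \<Rightarrow> bool" where
  "asymptotic_toeplitz T \<longleftrightarrow> bounded_op bG H2_G T \<and>
     (\<exists>B. bounded_op bG H2_G B \<and>
        weakly_tendsto bG H2_G
          (\<lambda>n f. (T_p_adj ^^ n)
             (\<lambda>x. T (T_s ((T_p ^^ n) f)) x - T_s (T ((T_p ^^ n) f)) x)) (\<lambda>f x. 0) \<and>
        weakly_tendsto bG H2_G (\<lambda>n f. (T_p_adj ^^ n) (T ((T_p ^^ n) f))) B \<and>
        (\<lambda>n. dsum_opnorm bG H2_G (eta n (\<lambda>f x. T f x - B f x))) \<longlonglongrightarrow> 0)"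

definition is_toeplitz ::
    "((complex \<times> complex \<Rightarrow> complex) \<Rightarrow> complex \<times> complex \<Rightarrow> complex) \<Rightarrow> bool" where
  "is_toeplitz S \<longleftrightarrow> bounded_op bG H2_G S \<and>
     (\<exists>\<phi>\<in>Linfty_bG. \<forall>f\<in>H2_G. AE x in bG. S f x = toeplitz \<phi> f x)"

end

theory Submission
  imports Defs "HOL-Library.Diagonal_Subsequence"
begin

text \<open>
  With \<open>h\<^sub>j\<close> the complete homogeneous symmetric polynomials, the functions \<open>p\<^sup>i h\<^sub>j(s, p)\<close> form an
  orthonormal basis of \<open>L\<^sup>2(b\<Gamma>)\<close> for integer \<open>i\<close>, and of \<open>H\<^sup>2(G)\<close> for \<open>i \<ge> 0\<close>. In this basis
  \<open>T\<^sub>p\<close> shifts \<open>i\<close> and \<open>Y\<close> shifts \<open>j\<close>.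

  If \<open>T\<close> is compact plus Toeplitz, compression by \<open>T\<^sub>p\<^sup>n\<close> leaves the Toeplitz part unchanged, while the
  adjoints of \<open>Y\<^sup>n\<close> and \<open>T\<^sub>p\<^sup>n\<close> tend to zero strongly, hence in norm after a compact operator.
  Conversely, the weak limit \<open>B\<close> satisfies \<open>\<langle>B p f, p g\<rangle> = \<langle>B f, g\<rangle>\<close>, and since \<open>cnj s * p = s\<close> on
  \<open>b\<Gamma>\<close> the commutator condition says \<open>\<langle>B s f, g\<rangle> = \<langle>B p f, s g\<rangle>\<close>. These two relations force \<open>B\<close> to be
  the compression of multiplication by the weak limit of \<open>p\<^sup>-\<^sup>n B p\<^sup>n\<close>. The ranges of \<open>Y\<^sup>n\<close> and
  \<open>T\<^sub>p\<^sup>n\<close> together have finite codimension, so the norm condition makes \<open>T - B\<close> a norm limit of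
  finite-rank operators.
\<close>

section \<open>Square-integrable functions\<close>

text \<open>\<open>X\<close>, \<open>Y\<close> and the adjoints are arbitrary choices of
  representatives, so they are handled through Fourier coefficients: each shifts the basis along an
  injection of the index set, or undoes such a shift. The normalisation of the basis comes from
  \<open>U\<close>, which sends p^i h_j to (z1^(i+j+1) z2^i - z1^i z2^(i+j+1)) / sqrt 2, a
  difference of two orthonormal monomials. The relation with p alone fixes B on the powers of p; the
  relation with s climbs from there along the recurrence h_(j+2) = s h_(j+1) - p h_j. The symbol
  found in this way is at first only square integrable. It is bounded because |p| = 1 on the
  boundary: a high power of p makes any finite sum of basis functions analytic without changing its
  norm, so the bound of B on the Hardy space becomes a bound for multiplication on all of L^2. In
  the compactness argument the ranges of the n-th powers of \<open>Y\<close> and \<open>T_p\<close>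
  overlap. The norm condition is therefore applied to a pair whose second entry is taken from what
  the first leaves over, so that the pair stays in the unit ball.\<close>

lemma borel_measurable_cnj [measurable]: "cnj \<in> borel_measurable borel"
  by (intro borel_measurable_continuous_onI continuous_intros)

lemma l2D: "f \<in> l2 M \<Longrightarrow> f \<in> borel_measurable M" "f \<in> l2 M \<Longrightarrow> integrable M (\<lambda>x. (cmod (f x))\<^sup>2)"
  by (simp_all add: l2_def)

lemma l2_zero: "(\<lambda>x. 0) \<in> l2 M"
  by (simp add: l2_def)

lemma l2_integrable_mult:
  assumes "f \<in> l2 M" "g \<in> l2 M"
  shows "integrable M (\<lambda>x. f x * cnj (g x))"
proof (rule Bochner_Integration.integrable_bound)
  have [measurable]: "f \<in> borel_measurable M" "g \<in> borel_measurable M"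
    using assms by (auto dest: l2D)
  show "(\<lambda>x. f x * cnj (g x)) \<in> borel_measurable M"
    by measurable
  show "integrable M (\<lambda>x. (cmod (f x))\<^sup>2 + (cmod (g x))\<^sup>2)"
    using assms by (auto dest: l2D)
  show "AE x in M. norm (f x * cnj (g x)) \<le> norm ((cmod (f x))\<^sup>2 + (cmod (g x))\<^sup>2)"
  proof (intro always_eventually allI)
    fix x
    have "2 * (cmod (f x) * cmod (g x)) \<le> (cmod (f x))\<^sup>2 + (cmod (g x))\<^sup>2"
      using sum_squares_bound[of "cmod (f x)" "cmod (g x)"] by simp
    moreover have "0 \<le> cmod (f x) * cmod (g x)"
      by simp
    ultimately have "cmod (f x) * cmod (g x) \<le> (cmod (f x))\<^sup>2 + (cmod (g x))\<^sup>2"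
      by linarith
    then show "norm (f x * cnj (g x)) \<le> norm ((cmod (f x))\<^sup>2 + (cmod (g x))\<^sup>2)"
      by (simp add: norm_mult)
  qed
qed

lemma l2_scale: "f \<in> l2 M \<Longrightarrow> (\<lambda>x. c * f x) \<in> l2 M"
  by (auto simp: l2_def norm_mult power_mult_distrib)

lemma cmod_add_sq_le: "(cmod (a + b))\<^sup>2 \<le> 2 * (cmod a)\<^sup>2 + 2 * (cmod b)\<^sup>2"
proof -
  have "(cmod (a + b))\<^sup>2 \<le> (cmod a + cmod b)\<^sup>2"
    by (intro power_mono norm_triangle_ineq) simp
  also have "\<dots> \<le> 2 * (cmod a)\<^sup>2 + 2 * (cmod b)\<^sup>2"
    using sum_squares_bound[of "cmod a" "cmod b"] by (simp add: power2_sum)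
  finally show ?thesis .
qed

lemma l2_add:
  assumes "f \<in> l2 M" "g \<in> l2 M"
  shows "(\<lambda>x. f x + g x) \<in> l2 M"
proof -
  have [measurable]: "f \<in> borel_measurable M" "g \<in> borel_measurable M"
    using assms by (auto dest: l2D)
  have "integrable M (\<lambda>x. (cmod (f x + g x))\<^sup>2)"
  proof (rule Bochner_Integration.integrable_bound)
    show "integrable M (\<lambda>x. 2 * (cmod (f x))\<^sup>2 + 2 * (cmod (g x))\<^sup>2)"
      using assms by (intro Bochner_Integration.integrable_add integrable_mult_right l2D)
  qed (use cmod_add_sq_le in auto)
  then show ?thesis
    by (simp add: l2_def)
qed

lemma l2_diff: "f \<in> l2 M \<Longrightarrow> g \<in> l2 M \<Longrightarrow> (\<lambda>x. f x - g x) \<in> l2 M"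
  using l2_add[of f M "\<lambda>x. -1 * g x"] l2_scale[of g M "-1"] by simp

lemma l2_sum: "(\<And>i. i \<in> F \<Longrightarrow> f i \<in> l2 M) \<Longrightarrow> (\<lambda>x. \<Sum>i\<in>F. f i x) \<in> l2 M"
  by (induction F rule: infinite_finite_induct) (auto intro: l2_zero l2_add)

lemma l2_mult_bounded:
  assumes "f \<in> l2 M" "h \<in> borel_measurable M" "AE x in M. cmod (h x) \<le> C"
  shows "(\<lambda>x. h x * f x) \<in> l2 M"
proof -
  have [measurable]: "f \<in> borel_measurable M" "h \<in> borel_measurable M"
    using assms by (auto dest: l2D)
  have "integrable M (\<lambda>x. (cmod (h x * f x))\<^sup>2)"
  proof (rule Bochner_Integration.integrable_bound)
    show "integrable M (\<lambda>x. C\<^sup>2 * (cmod (f x))\<^sup>2)"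
      using assms by (auto dest: l2D)
    show "AE x in M. norm ((cmod (h x * f x))\<^sup>2) \<le> norm (C\<^sup>2 * (cmod (f x))\<^sup>2)"
      using assms(3) by eventually_elim
        (auto simp: norm_mult power_mult_distrib intro!: mult_right_mono power_mono)
  qed simp
  then show ?thesis
    by (simp add: l2_def)
qed

lemma (in finite_measure) l2_bounded:
  assumes "h \<in> borel_measurable M" "AE x in M. cmod (h x) \<le> C"
  shows "h \<in> l2 M"
  using l2_mult_bounded[of "\<lambda>x. 1" M h C] assms by (simp add: l2_def)

lemma (in finite_measure) l2_integrable:
  assumes "f \<in> l2 M" shows "integrable M f"
  using l2_integrable_mult[OF assms l2_bounded[of "\<lambda>x. 1" 1]] by simp

lemma l2_inner_add_left: "f \<in> l2 M \<Longrightarrow> g \<in> l2 M \<Longrightarrow> h \<in> l2 M \<Longrightarrow>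
    l2_inner M (\<lambda>x. f x + g x) h = l2_inner M f h + l2_inner M g h"
  unfolding l2_inner_def distrib_right by (intro Bochner_Integration.integral_add l2_integrable_mult)

lemma l2_inner_diff_left: "f \<in> l2 M \<Longrightarrow> g \<in> l2 M \<Longrightarrow> h \<in> l2 M \<Longrightarrow>
    l2_inner M (\<lambda>x. f x - g x) h = l2_inner M f h - l2_inner M g h"
  unfolding l2_inner_def left_diff_distrib by (intro Bochner_Integration.integral_diff l2_integrable_mult)

lemma l2_inner_scale_left: "l2_inner M (\<lambda>x. c * f x) h = c * l2_inner M f h"
  unfolding l2_inner_def mult.assoc by (rule integral_mult_right_zero)

lemma l2_inner_zero_left: "l2_inner M (\<lambda>x. 0) h = 0"
  by (simp add: l2_inner_def)

lemma l2_inner_sum_left: "(\<And>i. i \<in> F \<Longrightarrow> f i \<in> l2 M) \<Longrightarrow> h \<in> l2 M \<Longrightarrow>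
    l2_inner M (\<lambda>x. \<Sum>i\<in>F. f i x) h = (\<Sum>i\<in>F. l2_inner M (f i) h)"
  unfolding l2_inner_def sum_distrib_right by (intro Bochner_Integration.integral_sum l2_integrable_mult)

lemma l2_inner_commute: "l2_inner M g f = cnj (l2_inner M f g)"
  unfolding l2_inner_def Bochner_Integration.integral_cnj[symmetric] by (simp add: mult.commute)

lemma l2_inner_add_right: "f \<in> l2 M \<Longrightarrow> g \<in> l2 M \<Longrightarrow> h \<in> l2 M \<Longrightarrow>
    l2_inner M h (\<lambda>x. f x + g x) = l2_inner M h f + l2_inner M h g"
  by (simp add: l2_inner_commute[of M h] l2_inner_add_left)

lemma l2_inner_diff_right: "f \<in> l2 M \<Longrightarrow> g \<in> l2 M \<Longrightarrow> h \<in> l2 M \<Longrightarrow>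
    l2_inner M h (\<lambda>x. f x - g x) = l2_inner M h f - l2_inner M h g"
  by (simp add: l2_inner_commute[of M h] l2_inner_diff_left)

lemma l2_inner_scale_right: "l2_inner M h (\<lambda>x. c * f x) = cnj c * l2_inner M h f"
  by (simp add: l2_inner_commute[of M h] l2_inner_scale_left)

lemma l2_inner_sum_right: "(\<And>i. i \<in> F \<Longrightarrow> f i \<in> l2 M) \<Longrightarrow> h \<in> l2 M \<Longrightarrow>
    l2_inner M h (\<lambda>x. \<Sum>i\<in>F. f i x) = (\<Sum>i\<in>F. l2_inner M h (f i))"
  unfolding l2_inner_def sum_distrib_left cnj_sum
  by (intro Bochner_Integration.integral_sum l2_integrable_mult)

lemma l2_inner_cong_AE:
  assumes "f \<in> l2 M" "f' \<in> l2 M" "g \<in> l2 M" "g' \<in> l2 M"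
    and "AE x in M. f x = f' x" "AE x in M. g x = g' x"
  shows "l2_inner M f g = l2_inner M f' g'"
  unfolding l2_inner_def
proof (rule integral_cong_AE)
  show "(\<lambda>x. f x * cnj (g x)) \<in> borel_measurable M" "(\<lambda>x. f' x * cnj (g' x)) \<in> borel_measurable M"
    using assms by (auto intro!: borel_measurable_integrable l2_integrable_mult)
  show "AE x in M. f x * cnj (g x) = f' x * cnj (g' x)"
    using assms(5,6) by eventually_elim simp
qed

lemma l2_norm_nonneg [simp]: "0 \<le> l2_norm M f"
  by (simp add: l2_norm_def)

lemma l2_norm_sq: "(l2_norm M f)\<^sup>2 = (\<integral>x. (cmod (f x))\<^sup>2 \<partial>M)"
  by (simp add: l2_norm_def)

lemma l2_norm_zero [simp]: "l2_norm M (\<lambda>x. 0) = 0"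
  by (simp add: l2_norm_def)

lemma l2_inner_self: "l2_inner M f f = of_real ((l2_norm M f)\<^sup>2)"
  unfolding l2_inner_def l2_norm_sq integral_complex_of_real[symmetric]
  by (simp add: complex_norm_square del: of_real_power)

lemma l2_norm_scale: "l2_norm M (\<lambda>x. c * f x) = cmod c * l2_norm M f"
  by (simp add: l2_norm_def norm_mult power_mult_distrib real_sqrt_mult)

lemma l2_norm_cong_AE:
  assumes "f \<in> l2 M" "g \<in> l2 M" "AE x in M. f x = g x"
  shows "l2_norm M f = l2_norm M g"
proof -
  have "(l2_norm M f)\<^sup>2 = (l2_norm M g)\<^sup>2"
    using l2_inner_cong_AE[OF assms(1,2,1,2,3,3)] by (simp only: l2_inner_self of_real_eq_iff)
  then show ?thesis
    by simp
qed

lemma l2_norm_eq_0_iff: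
  assumes "f \<in> l2 M"
  shows "l2_norm M f = 0 \<longleftrightarrow> (AE x in M. f x = 0)"
  using integral_nonneg_eq_0_iff_AE[OF l2D(2)[OF assms]] by (simp add: l2_norm_def)

lemma l2_inner_AE_0:
  assumes "f \<in> l2 M" "g \<in> l2 M" "AE x in M. f x = 0"
  shows "l2_inner M f g = 0"
  using l2_inner_cong_AE[OF assms(1) l2_zero assms(2) assms(2) assms(3)] by (simp add: l2_inner_zero_left)

lemma l2_norm_diff_sq:
  assumes "f \<in> l2 M" "g \<in> l2 M"
  shows "(l2_norm M (\<lambda>x. f x - g x))\<^sup>2 = (l2_norm M f)\<^sup>2 + (l2_norm M g)\<^sup>2 - 2 * Re (l2_inner M f g)"
proof -
  have "complex_of_real ((l2_norm M (\<lambda>x. f x - g x))\<^sup>2) =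
      of_real ((l2_norm M f)\<^sup>2) + of_real ((l2_norm M g)\<^sup>2) - (l2_inner M f g + cnj (l2_inner M f g))"
    unfolding l2_inner_self[symmetric] l2_inner_commute[of M g f, symmetric]
    using assms by (simp add: l2_inner_diff_left l2_inner_diff_right l2_diff)
  then have "Re (complex_of_real ((l2_norm M (\<lambda>x. f x - g x))\<^sup>2)) =
      Re (of_real ((l2_norm M f)\<^sup>2) + of_real ((l2_norm M g)\<^sup>2) - (l2_inner M f g + cnj (l2_inner M f g)))"
    by (rule arg_cong)
  then show ?thesis
    by (simp del: of_real_power)
qed

lemma l2_Cauchy_Schwarz:
  assumes "f \<in> l2 M" "g \<in> l2 M"
  shows "cmod (l2_inner M f g) \<le> l2_norm M f * l2_norm M g"
proof (cases "l2_norm M g = 0")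
  case True
  then have "AE x in M. g x = 0"
    using assms l2_norm_eq_0_iff by blast
  then have "l2_inner M f g = 0"
    using l2_inner_AE_0[OF assms(2,1)] l2_inner_commute[of M f g] by simp
  then show ?thesis
    by simp
next
  case False
  define a where "a = l2_inner M f g"
  define N where "N = (l2_norm M g)\<^sup>2"
  have N: "N > 0"
    using False by (simp add: N_def)
  \<comment> \<open>This is \<open>N\<close> times the component of \<open>f\<close> orthogonal to
    \<open>g\<close>; the factor \<open>N\<close> avoids a division.\<close>
  have "0 \<le> (l2_norm M (\<lambda>x. of_real N * f x - a * g x))\<^sup>2"
    by simp
  also have "\<dots> = N\<^sup>2 * (l2_norm M f)\<^sup>2 + (cmod a)\<^sup>2 * N - 2 * Re (of_real N * (cnj a * a))"
    using assms by (simp add: l2_norm_diff_sq l2_scale l2_norm_scale l2_inner_scale_left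
        l2_inner_scale_right power_mult_distrib a_def N_def del: of_real_power)
  also have "cnj a * a = of_real ((cmod a)\<^sup>2)"
    by (metis complex_norm_square mult.commute of_real_power)
  also have "N\<^sup>2 * (l2_norm M f)\<^sup>2 + (cmod a)\<^sup>2 * N - 2 * Re (of_real N * of_real ((cmod a)\<^sup>2)) =
      N * ((l2_norm M f * l2_norm M g)\<^sup>2 - (cmod a)\<^sup>2)"
    by (simp add: N_def power2_eq_square algebra_simps)
  finally have "(cmod a)\<^sup>2 \<le> (l2_norm M f * l2_norm M g)\<^sup>2"
    using N by (simp add: zero_le_mult_iff)
  then show ?thesis
    unfolding a_def by (rule power2_le_imp_le) simp
qed

lemma l2_norm_triangle_diff:
  assumes "f \<in> l2 M" "g \<in> l2 M"
  shows "l2_norm M (\<lambda>x. f x - g x) \<le> l2_norm M f + l2_norm M g"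
proof (rule power2_le_imp_le)
  have "- Re (l2_inner M f g) \<le> cmod (l2_inner M f g)"
    using abs_Re_le_cmod[of "l2_inner M f g"] by linarith
  then show "(l2_norm M (\<lambda>x. f x - g x))\<^sup>2 \<le> (l2_norm M f + l2_norm M g)\<^sup>2"
    using l2_Cauchy_Schwarz[OF assms] by (simp add: l2_norm_diff_sq[OF assms] power2_sum)
qed simp

lemma l2_norm_triangle:
  assumes "f \<in> l2 M" "g \<in> l2 M"
  shows "l2_norm M (\<lambda>x. f x + g x) \<le> l2_norm M f + l2_norm M g"
  using l2_norm_triangle_diff[OF assms(1) l2_scale[OF assms(2), of "-1"]] l2_norm_scale[of M "-1" g]
  by simp

lemma l2_norm_le_diff:
  assumes "f \<in> l2 M" "g \<in> l2 M"
  shows "l2_norm M f \<le> l2_norm M (\<lambda>x. f x - g x) + l2_norm M g"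
  using l2_norm_triangle[OF l2_diff[OF assms] assms(2)] by simp

lemma l2_inner_tendsto:
  assumes "\<And>n. u n \<in> l2 M" "f \<in> l2 M" "g \<in> l2 M"
    and "((\<lambda>n. l2_norm M (\<lambda>x. u n x - f x)) \<longlongrightarrow> 0) F"
  shows "((\<lambda>n. l2_inner M (u n) g) \<longlongrightarrow> l2_inner M f g) F"
proof -
  have "((\<lambda>n. l2_inner M (u n) g - l2_inner M f g) \<longlongrightarrow> 0) F"
  proof (rule Lim_null_comparison)
    show "((\<lambda>n. l2_norm M (\<lambda>x. u n x - f x) * l2_norm M g) \<longlongrightarrow> 0) F"
      using tendsto_mult_left_zero[OF assms(4)] .
    show "\<forall>\<^sub>F n in F. norm (l2_inner M (u n) g - l2_inner M f g)
        \<le> l2_norm M (\<lambda>x. u n x - f x) * l2_norm M g"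
      using l2_Cauchy_Schwarz[OF l2_diff[OF assms(1,2)] assms(3)]
      by (simp add: l2_inner_diff_left[OF assms(1,2,3)])
  qed
  then show ?thesis
    by (simp add: Lim_null[symmetric])
qed

lemma l2_norm_tendsto:
  assumes "\<And>n. u n \<in> l2 M" "f \<in> l2 M"
    and "((\<lambda>n. l2_norm M (\<lambda>x. u n x - f x)) \<longlongrightarrow> 0) F"
  shows "((\<lambda>n. l2_norm M (u n)) \<longlongrightarrow> l2_norm M f) F"
proof -
  have "((\<lambda>n. l2_norm M (u n) - l2_norm M f) \<longlongrightarrow> 0) F"
  proof (rule Lim_null_comparison[OF _ assms(3)], intro always_eventually allI)
    fix n
    have "l2_norm M (\<lambda>x. f x - u n x) = l2_norm M (\<lambda>x. u n x - f x)"
      using l2_norm_scale[of M "-1" "\<lambda>x. u n x - f x"] by simp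
    then show "norm (l2_norm M (u n) - l2_norm M f) \<le> l2_norm M (\<lambda>x. u n x - f x)"
      using l2_norm_le_diff[OF assms(1)[of n] assms(2)] l2_norm_le_diff[OF assms(2) assms(1)[of n]]
      by (simp add: abs_le_iff)
  qed
  then show ?thesis
    by (simp add: Lim_null[symmetric])
qed

section \<open>Completeness of L^2 over a finite measure\<close>

lemma l2_nn_integral:
  "f \<in> l2 M \<Longrightarrow> (\<integral>\<^sup>+x. ennreal ((cmod (f x))\<^sup>2) \<partial>M) = ennreal ((l2_norm M f)\<^sup>2)"
  by (simp add: l2_norm_sq nn_integral_eq_integral l2D)

text \<open>Square integrability read off a nonnegative integral, the form in which Fatou's lemma
  delivers its bound.\<close>

lemma l2_of_nn_integral_le:
  assumes [measurable]: "f \<in> borel_measurable M" and "0 \<le> c"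
    and le: "(\<integral>\<^sup>+x. ennreal ((cmod (f x))\<^sup>2) \<partial>M) \<le> ennreal (c\<^sup>2)"
  shows "f \<in> l2 M" "l2_norm M f \<le> c"
proof -
  have "integrable M (\<lambda>x. (cmod (f x))\<^sup>2)"
    using le by (intro integrableI_nonneg) (auto simp: top_unique less_top[symmetric])
  then show f: "f \<in> l2 M"
    by (simp add: l2_def)
  have "(l2_norm M f)\<^sup>2 \<le> c\<^sup>2"
    using le by (simp add: l2_nn_integral[OF f])
  then show "l2_norm M f \<le> c"
    using \<open>0 \<le> c\<close> by (rule power2_le_imp_le)
qed

lemma (in finite_measure) L1_le_l2_norm:
  assumes "f \<in> l2 M"
  shows "(\<integral>\<^sup>+x. ennreal (cmod (f x)) \<partial>M) \<le> ennreal (l2_norm M f * l2_norm M (\<lambda>x. 1))"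
proof -
  have [measurable]: "f \<in> borel_measurable M"
    using assms by (rule l2D)
  have f: "(\<lambda>x. complex_of_real (cmod (f x))) \<in> l2 M"
    using l2D(2)[OF assms] by (simp add: l2_def)
  have one: "(\<lambda>x. 1) \<in> l2 M"
    by (rule l2_bounded[where C=1]) auto
  have "l2_inner M (\<lambda>x. complex_of_real (cmod (f x))) (\<lambda>x. 1) = of_real (\<integral>x. cmod (f x) \<partial>M)"
    by (simp add: l2_inner_def)
  moreover have "l2_norm M (\<lambda>x. complex_of_real (cmod (f x))) = l2_norm M f"
    by (simp add: l2_norm_def)
  ultimately have "(\<integral>x. cmod (f x) \<partial>M) \<le> l2_norm M f * l2_norm M (\<lambda>x. 1)"
    using l2_Cauchy_Schwarz[OF f one] by simp
  then show ?thesis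
    using l2_integrable[OF assms] by (simp add: nn_integral_eq_integral ennreal_leI)
qed

text \<open>With geometric steps the telescoping series converges absolutely in L^1, because the
  measure is finite, hence pointwise a.e.; Fatou's lemma then upgrades the pointwise limit to a
  limit in L^2. The caller chooses partial sums with this rate.\<close>

lemma (in finite_measure) l2_rapidly_Cauchy_converges:
  assumes u: "\<And>n. u n \<in> l2 M"
    and d: "\<And>n. l2_norm M (\<lambda>x. u (Suc n) x - u n x) \<le> (1/2) ^ n"
  obtains f where "f \<in> l2 M" "(\<lambda>n. l2_norm M (\<lambda>x. u n x - f x)) \<longlonglongrightarrow> 0"
proof -
  have [measurable]: "u n \<in> borel_measurable M" for n
    using u by (rule l2D)
  define f where "f x = lim (\<lambda>n. u n x)" for x
  have [measurable]: "f \<in> borel_measurable M"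
    unfolding f_def by measurable
  define c where "c = l2_norm M (\<lambda>x. 1)"
  have "(\<integral>\<^sup>+x. (\<Sum>n. ennreal (cmod (u (Suc n) x - u n x))) \<partial>M)
      = (\<Sum>n. \<integral>\<^sup>+x. ennreal (cmod (u (Suc n) x - u n x)) \<partial>M)"
    by (rule nn_integral_suminf) measurable
  also have "\<dots> \<le> (\<Sum>n. ennreal ((1/2) ^ n * c))"
  proof (intro suminf_le allI summableI)
    fix n
    have "(\<integral>\<^sup>+x. ennreal (cmod (u (Suc n) x - u n x)) \<partial>M)
        \<le> ennreal (l2_norm M (\<lambda>x. u (Suc n) x - u n x) * c)"
      unfolding c_def using u by (intro L1_le_l2_norm l2_diff)
    also have "\<dots> \<le> ennreal ((1/2) ^ n * c)"
      by (intro ennreal_leI mult_right_mono d) (simp add: c_def)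
    finally show "(\<integral>\<^sup>+x. ennreal (cmod (u (Suc n) x - u n x)) \<partial>M) \<le> ennreal ((1/2) ^ n * c)" .
  qed
  also have "\<dots> < \<infinity>"
    by (subst suminf_ennreal2) (auto simp: c_def intro!: summable_mult2 summable_geometric)
  finally have "AE x in M. (\<Sum>n. ennreal (cmod (u (Suc n) x - u n x))) \<noteq> \<infinity>"
    by (intro nn_integral_PInf_AE) auto
  then have conv: "AE x in M. (\<lambda>n. u n x) \<longlonglongrightarrow> f x"
  proof eventually_elim
    fix x assume "(\<Sum>n. ennreal (cmod (u (Suc n) x - u n x))) \<noteq> \<infinity>"
    then have "summable (\<lambda>n. cmod (u (Suc n) x - u n x))"
      by (intro summable_suminf_not_top) auto
    then have "summable (\<lambda>n. u (Suc n) x - u n x)"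
      by (rule summable_norm_cancel)
    then have "(\<lambda>n. \<Sum>k<n. u (Suc k) x - u k x) \<longlonglongrightarrow> (\<Sum>n. u (Suc n) x - u n x)"
      by (rule summable_LIMSEQ)
    then have "(\<lambda>n. u n x - u 0 x) \<longlonglongrightarrow> (\<Sum>n. u (Suc n) x - u n x)"
      using sum_lessThan_telescope[of "\<lambda>n. u n x"] by simp
    then have "(\<lambda>n. (u n x - u 0 x) + u 0 x) \<longlonglongrightarrow> (\<Sum>n. u (Suc n) x - u n x) + u 0 x"
      by (intro tendsto_intros)
    then have "convergent (\<lambda>n. u n x)"
      by (auto simp: convergent_def)
    then show "(\<lambda>n. u n x) \<longlonglongrightarrow> f x"
      by (simp add: f_def convergent_LIMSEQ_iff)
  qed
  \<comment> \<open>The subtracted term makes the bound the exact value of the geometric sum, so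
    that the induction closes.\<close>
  have cauchy: "l2_norm M (\<lambda>x. u (n + k) x - u n x) \<le> 2 * (1/2) ^ n - 2 * (1/2) ^ (n + k)" for n k
  proof (induction k)
    case (Suc k)
    have "l2_norm M (\<lambda>x. u (n + Suc k) x - u n x)
        \<le> l2_norm M (\<lambda>x. u (Suc (n + k)) x - u (n + k) x) + l2_norm M (\<lambda>x. u (n + k) x - u n x)"
      using l2_norm_triangle[OF l2_diff[OF u[of "Suc (n + k)"] u[of "n + k"]] l2_diff[OF u[of "n + k"] u[of n]]]
      by simp
    also have "\<dots> \<le> (1/2) ^ (n + k) + (2 * (1/2) ^ n - 2 * (1/2) ^ (n + k))"
      by (intro add_mono d Suc.IH)
    finally show ?case
      by simp
  qed simp
  have diff: "(\<lambda>x. u n x - f x) \<in> l2 M \<and> l2_norm M (\<lambda>x. u n x - f x) \<le> 2 * (1/2) ^ n" for n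
  proof -
    have "(\<integral>\<^sup>+x. ennreal ((cmod (u n x - f x))\<^sup>2) \<partial>M)
        = (\<integral>\<^sup>+x. liminf (\<lambda>m. ennreal ((cmod (u n x - u m x))\<^sup>2)) \<partial>M)"
    proof (rule nn_integral_cong_AE)
      show "AE x in M. ennreal ((cmod (u n x - f x))\<^sup>2) = liminf (\<lambda>m. ennreal ((cmod (u n x - u m x))\<^sup>2))"
        using conv
      proof eventually_elim
        fix x assume "(\<lambda>n. u n x) \<longlonglongrightarrow> f x"
        then have "(\<lambda>m. ennreal ((cmod (u n x - u m x))\<^sup>2)) \<longlonglongrightarrow> ennreal ((cmod (u n x - f x))\<^sup>2)"
          by (intro tendsto_intros tendsto_ennrealI)
        then show "ennreal ((cmod (u n x - f x))\<^sup>2) = liminf (\<lambda>m. ennreal ((cmod (u n x - u m x))\<^sup>2))"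
          by (rule lim_imp_Liminf[OF trivial_limit_sequentially, symmetric])
      qed
    qed
    also have "\<dots> \<le> liminf (\<lambda>m. \<integral>\<^sup>+x. ennreal ((cmod (u n x - u m x))\<^sup>2) \<partial>M)"
      by (rule nn_integral_liminf) measurable
    also have "\<dots> \<le> ennreal ((2 * (1/2) ^ n)\<^sup>2)"
    proof (rule Liminf_le)
      show "\<forall>\<^sub>F m in sequentially. (\<integral>\<^sup>+x. ennreal ((cmod (u n x - u m x))\<^sup>2) \<partial>M) \<le> ennreal ((2 * (1/2) ^ n)\<^sup>2)"
        using eventually_ge_at_top[of n]
      proof eventually_elim
        fix m assume "n \<le> m"
        then have "l2_norm M (\<lambda>x. u m x - u n x) \<le> 2 * (1/2) ^ n"
          using cauchy[of n "m - n"] by (simp add: order_trans)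
        moreover have "(\<integral>\<^sup>+x. ennreal ((cmod (u n x - u m x))\<^sup>2) \<partial>M)
            = ennreal ((l2_norm M (\<lambda>x. u m x - u n x))\<^sup>2)"
          using l2_nn_integral[OF l2_diff[OF u[of m] u[of n]]] by (simp add: norm_minus_commute)
        ultimately show "(\<integral>\<^sup>+x. ennreal ((cmod (u n x - u m x))\<^sup>2) \<partial>M) \<le> ennreal ((2 * (1/2) ^ n)\<^sup>2)"
          by (simp only:) (intro ennreal_leI power_mono; simp)
      qed
    qed simp
    finally show ?thesis
      using l2_of_nn_integral_le[of "\<lambda>x. u n x - f x" M "2 * (1/2) ^ n"] by simp
  qed
  show thesis
  proof
    show "f \<in> l2 M"
      using l2_diff[OF u[of 0] conjunct1[OF diff[of 0]]] by simp
    show "(\<lambda>n. l2_norm M (\<lambda>x. u n x - f x)) \<longlonglongrightarrow> 0"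
    proof (rule Lim_null_comparison)
      show "\<forall>\<^sub>F n in sequentially. norm (l2_norm M (\<lambda>x. u n x - f x)) \<le> 2 * (1/2) ^ n"
        using diff by simp
      show "(\<lambda>n. 2 * (1/2) ^ n :: real) \<longlonglongrightarrow> 0"
        by (intro tendsto_mult_right_zero LIMSEQ_power_zero) simp
    qed
  qed
qed

section \<open>Orthonormal bases\<close>

text \<open>Source and target may differ, so that the adjoint theory covers both the operators on
  the Hardy space and \<open>U\<close>, which maps into the torus space.\<close>

definition bdd_lin ::
    "'a measure \<Rightarrow> ('a \<Rightarrow> complex) set \<Rightarrow> 'b measure \<Rightarrow>
     (('a \<Rightarrow> complex) \<Rightarrow> 'b \<Rightarrow> complex) \<Rightarrow> bool" where
  "bdd_lin M H N T \<longleftrightarrow>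
     (\<forall>f\<in>H. T f \<in> l2 N) \<and>
     (\<forall>f\<in>H. \<forall>g\<in>H. AE x in N. T (\<lambda>y. f y + g y) x = T f x + T g x) \<and>
     (\<forall>c. \<forall>f\<in>H. AE x in N. T (\<lambda>y. c * f y) x = c * T f x) \<and>
     (\<exists>C. \<forall>f\<in>H. l2_norm N (T f) \<le> C * l2_norm M f)"

lemma bounded_op_bdd_lin: "H \<subseteq> l2 M \<Longrightarrow> bounded_op M H T \<Longrightarrow> bdd_lin M H M T"
  by (auto simp: bounded_op_def bdd_lin_def)

lemma bdd_linD:
  assumes "bdd_lin M H N T"
  shows "f \<in> H \<Longrightarrow> T f \<in> l2 N"
    and "f \<in> H \<Longrightarrow> g \<in> H \<Longrightarrow> AE x in N. T (\<lambda>y. f y + g y) x = T f x + T g x"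
    and "f \<in> H \<Longrightarrow> AE x in N. T (\<lambda>y. c * f y) x = c * T f x"
  using assms by (auto simp: bdd_lin_def)

text \<open>Presenting \<open>H\<close> as the annihilator of a set \<open>G\<close> makes
  closedness automatic and fits all three uses: \<open>G\<close> is empty for L^2(bG), consists of
  the basis functions with negative first index for \<open>H2_G\<close>, and of monomial constraints
  for \<open>H2_anti\<close>.\<close>

locale l2_subspace = finite_measure M for M :: "'a measure" +
  fixes H G :: "('a \<Rightarrow> complex) set"
  assumes H_eq: "H = {f \<in> l2 M. \<forall>g\<in>G. l2_inner M f g = 0}" and G_l2: "G \<subseteq> l2 M"
begin

lemma H_l2: "f \<in> H \<Longrightarrow> f \<in> l2 M"
  by (simp add: H_eq)

lemma H_zero: "(\<lambda>x. 0) \<in> H"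
  by (simp add: H_eq l2_zero l2_inner_zero_left)

lemma H_add: "f \<in> H \<Longrightarrow> g \<in> H \<Longrightarrow> (\<lambda>x. f x + g x) \<in> H"
  using G_l2 by (auto simp: H_eq l2_add l2_inner_add_left)

lemma H_diff: "f \<in> H \<Longrightarrow> g \<in> H \<Longrightarrow> (\<lambda>x. f x - g x) \<in> H"
  using G_l2 by (auto simp: H_eq l2_diff l2_inner_diff_left)

lemma H_scale: "f \<in> H \<Longrightarrow> (\<lambda>x. c * f x) \<in> H"
  by (auto simp: H_eq l2_scale l2_inner_scale_left)

lemma H_sum: "(\<And>i. i \<in> F \<Longrightarrow> f i \<in> H) \<Longrightarrow> (\<lambda>x. \<Sum>i\<in>F. f i x) \<in> H"
  by (induction F rule: infinite_finite_induct) (auto intro: H_zero H_add)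

lemma H_closed:
  assumes u: "\<And>n. u n \<in> H" and f: "f \<in> l2 M"
    and lim: "(\<lambda>n. l2_norm M (\<lambda>x. u n x - f x)) \<longlonglongrightarrow> 0"
  shows "f \<in> H"
proof -
  have "l2_inner M f g = 0" if "g \<in> G" for g
  proof -
    have "(\<lambda>n. l2_inner M (u n) g) \<longlonglongrightarrow> l2_inner M f g"
      using that G_l2 by (intro l2_inner_tendsto[OF _ f _ lim] H_l2[OF u]) auto
    moreover have "l2_inner M (u n) g = 0" for n
      using u[of n] that by (simp add: H_eq)
    ultimately show ?thesis
      by (simp add: LIMSEQ_const_iff)
  qed
  then show ?thesis
    using f by (simp add: H_eq)
qed

lemma bdd_lin_diff:
  assumes T: "bdd_lin M H N T" and f: "f \<in> H" and g: "g \<in> H"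
  shows "AE x in N. T (\<lambda>y. f y - g y) x = T f x - T g x"
proof -
  have "AE x in N. T (\<lambda>y. f y + (-1) * g y) x = T f x + T (\<lambda>y. (-1) * g y) x"
    by (rule bdd_linD(2)[OF T f H_scale[OF g]])
  moreover have "AE x in N. T (\<lambda>y. (-1) * g y) x = (-1) * T g x"
    by (rule bdd_linD(3)[OF T g])
  ultimately show ?thesis
    by eventually_elim simp
qed

lemma bdd_lin_sum:
  assumes T: "bdd_lin M H N T" and f: "\<And>i. i \<in> F \<Longrightarrow> f i \<in> H" and "finite F"
  shows "AE x in N. T (\<lambda>y. \<Sum>i\<in>F. c i * f i y) x = (\<Sum>i\<in>F. c i * T (f i) x)"
  using \<open>finite F\<close> f
proof (induction F rule: finite_induct)
  case empty
  have "AE x in N. T (\<lambda>y. 0 * 0) x = 0 * T (\<lambda>y. 0) x"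
    by (rule bdd_linD(3)[OF T H_zero])
  then show ?case
    by simp
next
  case (insert i F)
  have "AE x in N. T (\<lambda>y. c i * f i y + (\<Sum>i\<in>F. c i * f i y)) x
      = T (\<lambda>y. c i * f i y) x + T (\<lambda>y. \<Sum>i\<in>F. c i * f i y) x"
    using insert.prems by (intro bdd_linD(2)[OF T] H_scale H_sum) auto
  moreover have "AE x in N. T (\<lambda>y. c i * f i y) x = c i * T (f i) x"
    using insert.prems by (intro bdd_linD(3)[OF T]) auto
  moreover have "AE x in N. T (\<lambda>y. \<Sum>i\<in>F. c i * f i y) x = (\<Sum>i\<in>F. c i * T (f i) x)"
    using insert by simp
  ultimately show ?case
    by eventually_elim (simp add: insert.hyps)
qed

lemma bdd_lin_bound:
  assumes "bdd_lin M H N T"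
  obtains C where "0 \<le> C" "\<And>f. f \<in> H \<Longrightarrow> l2_norm N (T f) \<le> C * l2_norm M f"
proof -
  obtain C where C: "\<And>f. f \<in> H \<Longrightarrow> l2_norm N (T f) \<le> C * l2_norm M f"
    using assms unfolding bdd_lin_def by blast
  have "l2_norm N (T f) \<le> \<bar>C\<bar> * l2_norm M f" if "f \<in> H" for f
    using C[OF that] by (smt (verit) l2_norm_nonneg mult_right_mono)
  then show thesis
    using that[of "\<bar>C\<bar>"] by simp
qed

lemma bdd_lin_inner_tendsto:
  assumes T: "bdd_lin M H N T" and u: "\<And>n. u n \<in> H" and f: "f \<in> H" and g: "g \<in> l2 N"
    and lim: "((\<lambda>n. l2_norm M (\<lambda>x. u n x - f x)) \<longlongrightarrow> 0) F"
  shows "((\<lambda>n. l2_inner N (T (u n)) g) \<longlongrightarrow> l2_inner N (T f) g) F"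
proof (rule l2_inner_tendsto[OF _ _ g])
  have Tl2: "T h \<in> l2 N" if "h \<in> H" for h
    using T that by (auto simp: bdd_lin_def)
  show "T (u n) \<in> l2 N" "T f \<in> l2 N" for n
    using Tl2 u f by auto
  obtain C where C: "0 \<le> C" "\<And>f. f \<in> H \<Longrightarrow> l2_norm N (T f) \<le> C * l2_norm M f"
    using bdd_lin_bound[OF T] by blast
  show "((\<lambda>n. l2_norm N (\<lambda>x. T (u n) x - T f x)) \<longlongrightarrow> 0) F"
  proof (rule Lim_null_comparison[OF always_eventually])
    show "((\<lambda>n. C * l2_norm M (\<lambda>x. u n x - f x)) \<longlongrightarrow> 0) F"
      by (rule tendsto_mult_right_zero[OF lim])
    show "\<forall>n. norm (l2_norm N (\<lambda>x. T (u n) x - T f x)) \<le> C * l2_norm M (\<lambda>x. u n x - f x)"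
    proof
      fix n
      have "l2_norm N (\<lambda>x. T (u n) x - T f x) = l2_norm N (T (\<lambda>x. u n x - f x))"
        using bdd_lin_diff[OF T u[of n] f]
        by (intro l2_norm_cong_AE Tl2 l2_diff H_diff u f) auto
      then show "norm (l2_norm N (\<lambda>x. T (u n) x - T f x)) \<le> C * l2_norm M (\<lambda>x. u n x - f x)"
        using C(2)[OF H_diff[OF u[of n] f]] by simp
    qed
  qed
qed

end

text \<open>Totality concerns elements of \<open>H\<close>, while coefficients make sense on all of
  \<open>l2 M\<close>; this is what lets the projection onto \<open>H\<close> be read off the
  coefficients. Countability serves the exhaustion by finite sets and the diagonal argument.\<close>

locale l2_basis = l2_subspace M H G for M :: "'a measure" and H G +
  fixes e :: "'i :: countable \<Rightarrow> 'a \<Rightarrow> complex"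
  assumes e_H: "e i \<in> H"
    and e_orth: "l2_inner M (e i) (e j) = (if i = j then 1 else 0)"
    and e_total: "f \<in> H \<Longrightarrow> (\<And>i. l2_inner M f (e i) = 0) \<Longrightarrow> AE x in M. f x = 0"
begin

abbreviation cf :: "('a \<Rightarrow> complex) \<Rightarrow> 'i \<Rightarrow> complex" where
  "cf f i \<equiv> l2_inner M f (e i)"

definition fsum :: "'i set \<Rightarrow> ('i \<Rightarrow> complex) \<Rightarrow> 'a \<Rightarrow> complex" where
  "fsum F c = (\<lambda>x. \<Sum>i\<in>F. c i * e i x)"

lemma e_l2: "e i \<in> l2 M"
  by (rule H_l2[OF e_H])

lemma fsum_H: "fsum F c \<in> H"
  unfolding fsum_def by (intro H_sum H_scale e_H)

lemma fsum_l2: "fsum F c \<in> l2 M"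
  by (rule H_l2[OF fsum_H])

lemma inner_fsum_left: "g \<in> l2 M \<Longrightarrow> l2_inner M (fsum F c) g = (\<Sum>i\<in>F. c i * l2_inner M (e i) g)"
  unfolding fsum_def by (simp add: l2_inner_sum_left l2_scale e_l2 l2_inner_scale_left)

lemma inner_fsum_right: "g \<in> l2 M \<Longrightarrow> l2_inner M g (fsum F c) = (\<Sum>i\<in>F. cnj (c i) * cf g i)"
  unfolding fsum_def by (simp add: l2_inner_sum_right l2_scale e_l2 l2_inner_scale_right)

lemma cf_fsum: "finite F \<Longrightarrow> cf (fsum F c) i = (if i \<in> F then c i else 0)"
  by (simp add: inner_fsum_left e_l2 e_orth if_distrib cong: if_cong)

lemma cf_add: "f \<in> l2 M \<Longrightarrow> g \<in> l2 M \<Longrightarrow> cf (\<lambda>x. f x + g x) i = cf f i + cf g i"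
  by (simp add: l2_inner_add_left e_l2)

lemma cf_diff: "f \<in> l2 M \<Longrightarrow> g \<in> l2 M \<Longrightarrow> cf (\<lambda>x. f x - g x) i = cf f i - cf g i"
  by (simp add: l2_inner_diff_left e_l2)

lemma norm_fsum: "finite F \<Longrightarrow> (l2_norm M (fsum F c))\<^sup>2 = (\<Sum>i\<in>F. (cmod (c i))\<^sup>2)"
proof -
  assume "finite F"
  then have "complex_of_real ((l2_norm M (fsum F c))\<^sup>2) = of_real (\<Sum>i\<in>F. (cmod (c i))\<^sup>2)"
    by (simp add: inner_fsum_right fsum_l2 cf_fsum complex_norm_square mult.commute del: of_real_power
        flip: l2_inner_self)
  then show ?thesis
    by (simp only: of_real_eq_iff)
qed

lemma Bessel_eq:
  assumes "f \<in> l2 M" "finite F"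
  shows "(l2_norm M (\<lambda>x. f x - fsum F (cf f) x))\<^sup>2 = (l2_norm M f)\<^sup>2 - (\<Sum>i\<in>F. (cmod (cf f i))\<^sup>2)"
proof -
  have "l2_inner M f (fsum F (cf f)) = of_real (\<Sum>i\<in>F. (cmod (cf f i))\<^sup>2)"
    by (simp add: inner_fsum_right assms complex_norm_square mult.commute del: of_real_power)
  then show ?thesis
    using assms by (simp add: l2_norm_diff_sq fsum_l2 norm_fsum)
qed

lemma Bessel:
  assumes "f \<in> l2 M" "finite F"
  shows "(\<Sum>i\<in>F. (cmod (cf f i))\<^sup>2) \<le> (l2_norm M f)\<^sup>2"
proof -
  have "0 \<le> (l2_norm M (\<lambda>x. f x - fsum F (cf f) x))\<^sup>2"
    by simp
  then show ?thesis
    unfolding Bessel_eq[OF assms] by simp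
qed

lemma Bessel_summable:
  assumes "f \<in> l2 M"
  shows "(\<lambda>i. (cmod (cf f i))\<^sup>2) summable_on UNIV"
  using Bessel[OF assms]
  by (intro nonneg_bdd_above_summable_on) (auto simp: bdd_above_def)

text \<open>The finite index sets are chosen so that the sums of squares converge at rate
  \<open>(1/4) ^ n\<close>; by \<open>norm_fsum\<close> the partial sums then move by at most
  \<open>(1/2) ^ n\<close> in norm, as the completeness lemma requires.\<close>

theorem Riesz_Fischer:
  assumes "(\<lambda>i. (cmod (c i))\<^sup>2) summable_on UNIV"
  obtains f where "f \<in> H" "\<And>i. cf f i = c i" "((\<lambda>i. (cmod (c i))\<^sup>2) has_sum (l2_norm M f)\<^sup>2) UNIV"
proof -
  define q where "q i = (cmod (c i))\<^sup>2" for i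
  obtain S where S: "(q has_sum S) UNIV"
    using assms unfolding q_def summable_on_def by blast
  have "\<exists>A. finite A \<and> (\<forall>B. finite B \<and> A \<subseteq> B \<longrightarrow> \<bar>sum q B - S\<bar> < (1/4) ^ n / 2)" for n :: nat
  proof -
    have "eventually (\<lambda>B. dist (sum q B) S < (1/4) ^ n / 2) (finite_subsets_at_top UNIV)"
      using S unfolding has_sum_def by (rule tendstoD) simp
    then show ?thesis
      unfolding eventually_finite_subsets_at_top by (auto simp: dist_real_def)
  qed
  then obtain A where A: "\<And>n. finite (A n)"
      "\<And>n B. finite B \<Longrightarrow> A n \<subseteq> B \<Longrightarrow> \<bar>sum q B - S\<bar> < (1/4) ^ n / 2"
    by metis
  define F where "F n = (\<Union>k\<le>n. A k) \<union> {i. to_nat i \<le> n}" for n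
  have finF: "finite (F n)" for n
    using A(1) finite_vimageI[OF finite_atMost[of n] inj_to_nat] by (simp add: F_def vimage_def)
  have monoF: "F n \<subseteq> F (Suc n)" for n
    unfolding F_def by (intro Un_mono UN_mono) auto
  have FS: "\<bar>sum q (F n) - S\<bar> < (1/4) ^ n / 2" for n
    by (intro A(2) finF) (auto simp: F_def)
  have step: "l2_norm M (\<lambda>x. fsum (F (Suc n)) c x - fsum (F n) c x) \<le> (1/2) ^ n" for n
  proof (rule power2_le_imp_le)
    have "(\<lambda>x. fsum (F (Suc n)) c x - fsum (F n) c x) = fsum (F (Suc n) - F n) c"
      using monoF[of n] finF[of "Suc n"] by (simp add: fsum_def sum_diff fun_eq_iff)
    then have "(l2_norm M (\<lambda>x. fsum (F (Suc n)) c x - fsum (F n) c x))\<^sup>2 = sum q (F (Suc n) - F n)"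
      using finF by (simp add: norm_fsum q_def)
    also have "\<dots> = sum q (F (Suc n)) - sum q (F n)"
      using monoF[of n] finF[of "Suc n"] by (simp add: sum_diff)
    also have "\<dots> \<le> (1/4) ^ n"
      using FS[of n] FS[of "Suc n"] zero_le_power[of "1/4::real" n] by (simp add: abs_if split: if_splits)
    also have "\<dots> = ((1/2) ^ n)\<^sup>2"
      by (simp add: power2_eq_square flip: power_mult_distrib)
    finally show "(l2_norm M (\<lambda>x. fsum (F (Suc n)) c x - fsum (F n) c x))\<^sup>2 \<le> ((1/2) ^ n)\<^sup>2" .
  qed simp
  obtain f where f: "f \<in> l2 M" "(\<lambda>n. l2_norm M (\<lambda>x. fsum (F n) c x - f x)) \<longlonglongrightarrow> 0"
    using l2_rapidly_Cauchy_converges[of "\<lambda>n. fsum (F n) c"] fsum_l2 step by blast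
  show thesis
  proof
    show "f \<in> H"
      using H_closed[OF fsum_H f] .
    show "cf f i = c i" for i
    proof (rule LIMSEQ_unique)
      show "(\<lambda>n. cf (fsum (F n) c) i) \<longlonglongrightarrow> cf f i"
        by (intro l2_inner_tendsto f fsum_l2 e_l2)
      have "\<forall>\<^sub>F n in sequentially. cf (fsum (F n) c) i = c i"
        using eventually_ge_at_top[of "to_nat i"]
      proof eventually_elim
        fix n assume "to_nat i \<le> n"
        then have "i \<in> F n"
          by (simp add: F_def)
        then show "cf (fsum (F n) c) i = c i"
          by (simp add: cf_fsum[OF finF])
      qed
      then show "(\<lambda>n. cf (fsum (F n) c) i) \<longlonglongrightarrow> c i"
        by (rule tendsto_eventually)
    qed
    have "(\<lambda>n. (l2_norm M (fsum (F n) c))\<^sup>2) \<longlonglongrightarrow> (l2_norm M f)\<^sup>2"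
      by (intro tendsto_power l2_norm_tendsto f fsum_l2)
    then have "(\<lambda>n. sum q (F n)) \<longlonglongrightarrow> (l2_norm M f)\<^sup>2"
      by (simp add: norm_fsum finF q_def)
    moreover have "(\<lambda>n. sum q (F n)) \<longlonglongrightarrow> S"
    proof (rule LIM_zero_cancel, rule Lim_null_comparison)
      show "\<forall>\<^sub>F n in sequentially. norm (sum q (F n) - S) \<le> (1/4) ^ n / 2"
        using FS by (simp add: less_imp_le)
      show "(\<lambda>n. (1/4) ^ n / 2 :: real) \<longlonglongrightarrow> 0"
        by (intro tendsto_divide_zero LIMSEQ_power_zero) simp
    qed
    ultimately have "S = (l2_norm M f)\<^sup>2"
      by (rule LIMSEQ_unique[symmetric])
    then show "((\<lambda>i. (cmod (c i))\<^sup>2) has_sum (l2_norm M f)\<^sup>2) UNIV"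
      using S by (simp add: q_def[abs_def])
  qed
qed

lemma H_with_cf:
  assumes "(\<lambda>i. (cmod (c i))\<^sup>2) summable_on UNIV"
  obtains f where "f \<in> H" "\<And>i. cf f i = c i"
  by (rule Riesz_Fischer[OF assms]) (rule that)

lemma eq_AE_if_cf_eq:
  assumes "f \<in> H" "g \<in> H" "\<And>i. cf f i = cf g i"
  shows "AE x in M. f x = g x"
  using e_total[OF H_diff[OF assms(1,2)]] assms by (simp add: cf_diff H_l2)

text \<open>Riesz-Fischer rebuilds a vector of \<open>H\<close> from the coefficients of
  \<open>f\<close>, with the right norm; totality identifies it with \<open>f\<close>.\<close>

theorem Parseval:
  assumes "f \<in> H"
  shows "((\<lambda>i. (cmod (cf f i))\<^sup>2) has_sum (l2_norm M f)\<^sup>2) UNIV"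
proof -
  obtain g where g: "g \<in> H" "\<And>i. cf g i = cf f i"
      "((\<lambda>i. (cmod (cf f i))\<^sup>2) has_sum (l2_norm M g)\<^sup>2) UNIV"
    using Riesz_Fischer[OF Bessel_summable[OF H_l2[OF assms]]] by blast
  have "l2_norm M g = l2_norm M f"
    using eq_AE_if_cf_eq[OF g(1) assms g(2)] g(1) assms by (intro l2_norm_cong_AE H_l2)
  then show ?thesis
    using g(3) by simp
qed

lemma fsum_tendsto:
  assumes "f \<in> H"
  shows "((\<lambda>F. l2_norm M (\<lambda>x. fsum F (cf f) x - f x)) \<longlongrightarrow> 0) (finite_subsets_at_top UNIV)"
proof -
  have "((\<lambda>F. sqrt ((l2_norm M f)\<^sup>2 - (\<Sum>i\<in>F. (cmod (cf f i))\<^sup>2))) \<longlongrightarrow> sqrt ((l2_norm M f)\<^sup>2 - (l2_norm M f)\<^sup>2))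
      (finite_subsets_at_top UNIV)"
    using Parseval[OF assms] unfolding has_sum_def by (intro tendsto_intros)
  moreover have "\<forall>\<^sub>F F in finite_subsets_at_top UNIV.
      sqrt ((l2_norm M f)\<^sup>2 - (\<Sum>i\<in>F. (cmod (cf f i))\<^sup>2)) = l2_norm M (\<lambda>x. fsum F (cf f) x - f x)"
  proof (rule eventually_finite_subsets_at_top_weakI)
    fix F :: "'i set" assume "finite F"
    then have "sqrt ((l2_norm M f)\<^sup>2 - (\<Sum>i\<in>F. (cmod (cf f i))\<^sup>2)) = l2_norm M (\<lambda>x. f x - fsum F (cf f) x)"
      by (simp flip: Bessel_eq[OF H_l2[OF assms]])
    also have "\<dots> = l2_norm M (\<lambda>x. fsum F (cf f) x - f x)"
      by (simp add: l2_norm_def norm_minus_commute)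
    finally show "sqrt ((l2_norm M f)\<^sup>2 - (\<Sum>i\<in>F. (cmod (cf f i))\<^sup>2)) = l2_norm M (\<lambda>x. fsum F (cf f) x - f x)" .
  qed
  ultimately show ?thesis
    by (auto elim: Lim_transform_eventually)
qed

lemma fsum_seq_tendsto:
  assumes "f \<in> H"
  obtains F where "\<And>n. finite (F n)" "(\<lambda>n::nat. l2_norm M (\<lambda>x. fsum (F n) (cf f) x - f x)) \<longlonglongrightarrow> 0"
proof -
  have "\<exists>F. finite F \<and> l2_norm M (\<lambda>x. fsum F (cf f) x - f x) < 1 / real (Suc n)" for n
    using order_tendstoD(2)[OF fsum_tendsto[OF assms], of "1 / real (Suc n)"]
    unfolding eventually_finite_subsets_at_top by auto
  then obtain F where F: "\<And>n. finite (F n)" "\<And>n. l2_norm M (\<lambda>x. fsum (F n) (cf f) x - f x) < 1 / real (Suc n)"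
    by metis
  have "(\<lambda>n. l2_norm M (\<lambda>x. fsum (F n) (cf f) x - f x)) \<longlonglongrightarrow> 0"
  proof (rule Lim_null_comparison)
    show "\<forall>\<^sub>F n in sequentially. norm (l2_norm M (\<lambda>x. fsum (F n) (cf f) x - f x)) \<le> 1 / real (Suc n)"
      using F(2) by (auto simp: less_imp_le)
    show "(\<lambda>n. 1 / real (Suc n)) \<longlonglongrightarrow> 0"
      by (rule lim_1_over_n[THEN LIMSEQ_Suc])
  qed
  then show thesis
    using that F(1) by blast
qed

text \<open>Here \<open>h\<close> may lie outside \<open>H\<close>. Products with a symbol, which
  leave the Hardy space, are compared in this way.\<close>

lemma inner_eq_0_if_cf_eq_0:
  assumes "h \<in> l2 M" "\<And>i. cf h i = 0" "g \<in> H"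
  shows "l2_inner M h g = 0"
proof -
  obtain F where F: "\<And>n. finite (F n)" "(\<lambda>n::nat. l2_norm M (\<lambda>x. fsum (F n) (cf g) x - g x)) \<longlonglongrightarrow> 0"
    using fsum_seq_tendsto[OF assms(3)] by blast
  have "(\<lambda>n. l2_inner M (fsum (F n) (cf g)) h) \<longlonglongrightarrow> l2_inner M g h"
    by (rule l2_inner_tendsto[OF fsum_l2 H_l2[OF assms(3)] assms(1) F(2)])
  moreover have "l2_inner M (fsum (F n) (cf g)) h = 0" for n
    using assms by (simp add: inner_fsum_left l2_inner_commute[of M "e _"])
  ultimately have "l2_inner M g h = 0"
    by (simp add: LIMSEQ_const_iff)
  then show ?thesis
    by (simp add: l2_inner_commute[of M h])
qed

lemma inner_eq_if_cf_eq:
  assumes "h \<in> l2 M" "k \<in> l2 M" "\<And>i. cf h i = cf k i" "g \<in> H"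
  shows "l2_inner M h g = l2_inner M k g"
  using inner_eq_0_if_cf_eq_0[OF l2_diff[OF assms(1,2)] _ assms(4)] assms
  by (simp add: cf_diff l2_inner_diff_left H_l2)

text \<open>The choice in \<open>l2_proj\<close> is realised by the vector of \<open>H\<close> that
  has the coefficients of \<open>g\<close>; Bessel's inequality makes them square summable.\<close>

lemma l2_proj:
  assumes "g \<in> l2 M"
  shows "l2_proj M H g \<in> H" "\<And>f. f \<in> H \<Longrightarrow> l2_inner M (l2_proj M H g) f = l2_inner M g f"
proof -
  obtain h where h: "h \<in> H" "\<And>i. cf h i = cf g i"
    by (rule H_with_cf[OF Bessel_summable[OF assms]]) (rule that)
  have "\<forall>f\<in>H. l2_inner M (\<lambda>x. g x - h x) f = 0"
    by (rule ballI, rule inner_eq_0_if_cf_eq_0[OF l2_diff[OF assms H_l2[OF h(1)]]])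
      (simp_all add: cf_diff[OF assms H_l2[OF h(1)]] h(2))
  then have P: "l2_proj M H g \<in> H \<and> (\<forall>f\<in>H. l2_inner M (\<lambda>x. g x - l2_proj M H g x) f = 0)"
    unfolding l2_proj_def using h(1) by (intro someI_ex[of "\<lambda>h. h \<in> H \<and> (\<forall>f\<in>H. l2_inner M (\<lambda>x. g x - h x) f = 0)"]) auto
  then show "l2_proj M H g \<in> H" ..
  show "l2_inner M (l2_proj M H g) f = l2_inner M g f" if "f \<in> H" for f
  proof -
    have "l2_inner M (\<lambda>x. g x - l2_proj M H g x) f = 0"
      using P that by blast
    then show ?thesis
      using l2_inner_diff_left[OF assms H_l2[OF conjunct1[OF P]] H_l2[OF that]] by simp
  qed
qed

lemma l2_proj_AE:
  assumes "g \<in> H"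
  shows "AE x in M. l2_proj M H g x = g x"
  using l2_proj[OF H_l2[OF assms]] by (intro eq_AE_if_cf_eq assms) (auto simp: e_H)

text \<open>Riesz representation in coordinates: the coefficients of the adjoint vector are forced,
  and their square sum is bounded by testing \<open>T\<close> on the finite sums formed with these
  very coefficients.\<close>

lemma adjoint_exists:
  assumes T: "bdd_lin M H N T" and g: "g \<in> l2 N"
  shows "\<exists>h\<in>H. \<forall>f\<in>H. l2_inner M f h = l2_inner N (T f) g"
proof -
  obtain C where C: "0 \<le> C" "\<And>f. f \<in> H \<Longrightarrow> l2_norm N (T f) \<le> C * l2_norm M f"
    using bdd_lin_bound[OF T] by blast
  have Tl2: "T h \<in> l2 N" if "h \<in> H" for h
    using T that by (auto simp: bdd_lin_def)
  define c where "c i = cnj (l2_inner N (T (e i)) g)" for i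
  have Tfsum: "l2_inner N (T (fsum F a)) g = (\<Sum>i\<in>F. a i * l2_inner N (T (e i)) g)" if "finite F" for F a
  proof -
    have "l2_inner N (T (fsum F a)) g = l2_inner N (\<lambda>x. \<Sum>i\<in>F. a i * T (e i) x) g"
      using bdd_lin_sum[OF T e_H that, where c=a] g
      by (intro l2_inner_cong_AE Tl2 fsum_H l2_sum l2_scale e_H) (auto simp: fsum_def)
    then show ?thesis
      using g by (simp add: l2_inner_sum_left l2_scale Tl2 e_H l2_inner_scale_left)
  qed
  have bnd: "(\<Sum>i\<in>F. (cmod (c i))\<^sup>2) \<le> (C * l2_norm N g)\<^sup>2" if "finite F" for F
  proof -
    define s where "s = l2_norm M (fsum F c)"
    have s: "s\<^sup>2 = (\<Sum>i\<in>F. (cmod (c i))\<^sup>2)"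
      unfolding s_def by (rule norm_fsum[OF that])
    have "l2_inner N (T (fsum F c)) g = of_real (\<Sum>i\<in>F. (cmod (c i))\<^sup>2)"
      by (simp add: Tfsum[OF that] complex_norm_square mult.commute c_def del: of_real_power)
    then have "s\<^sup>2 = cmod (l2_inner N (T (fsum F c)) g)"
      by (simp add: s[symmetric] norm_power)
    also have "\<dots> \<le> l2_norm N (T (fsum F c)) * l2_norm N g"
      by (intro l2_Cauchy_Schwarz Tl2 fsum_H g)
    also have "\<dots> \<le> C * s * l2_norm N g"
      unfolding s_def by (intro mult_right_mono C fsum_H) simp
    \<comment> \<open>Cancelling one factor \<open>s\<close> gives a bound that does not depend on
      \<open>F\<close>.\<close>
    finally have "s * s \<le> s * (C * l2_norm N g)"
      by (simp add: power2_eq_square algebra_simps)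
    moreover have "0 \<le> s"
      by (simp add: s_def)
    ultimately have "s \<le> C * l2_norm N g"
      using C(1) by (cases "s = 0") auto
    then show ?thesis
      unfolding s[symmetric] using \<open>0 \<le> s\<close> by (intro power_mono)
  qed
  have "(\<lambda>i. (cmod (c i))\<^sup>2) summable_on UNIV"
    using bnd by (intro nonneg_bdd_above_summable_on) (auto simp: bdd_above_def)
  then obtain h where h: "h \<in> H" "\<And>i. cf h i = c i"
    by (rule H_with_cf) (rule that)
  have "l2_inner M f h = l2_inner N (T f) g" if "f \<in> H" for f
  proof -
    obtain F where F: "\<And>n. finite (F n)" "(\<lambda>n::nat. l2_norm M (\<lambda>x. fsum (F n) (cf f) x - f x)) \<longlonglongrightarrow> 0"
      using fsum_seq_tendsto[OF \<open>f \<in> H\<close>] by blast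
    have "(\<lambda>n. l2_inner M (fsum (F n) (cf f)) h) \<longlonglongrightarrow> l2_inner M f h"
      by (rule l2_inner_tendsto[OF fsum_l2 H_l2[OF that] H_l2[OF h(1)] F(2)])
    moreover have "l2_inner M (fsum (F n) (cf f)) h = l2_inner N (T (fsum (F n) (cf f))) g" for n
      using h by (simp add: Tfsum[OF F(1)] inner_fsum_left H_l2 l2_inner_commute[of M "e _" h] c_def)
    moreover have "(\<lambda>n. l2_inner N (T (fsum (F n) (cf f))) g) \<longlonglongrightarrow> l2_inner N (T f) g"
      by (intro bdd_lin_inner_tendsto[OF T] fsum_H that g F)
    ultimately show ?thesis
      by (simp add: LIMSEQ_unique)
  qed
  then show ?thesis
    using h(1) by blast
qed

lemma l2_adjoint:
  assumes "bdd_lin M H N T" and "g \<in> l2 N"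
  shows "l2_adjoint M H N T g \<in> H"
    and "\<And>f. f \<in> H \<Longrightarrow> l2_inner M f (l2_adjoint M H N T g) = l2_inner N (T f) g"
proof -
  have "l2_adjoint M H N T g \<in> H \<and> (\<forall>f\<in>H. l2_inner M f (l2_adjoint M H N T g) = l2_inner N (T f) g)"
    unfolding l2_adjoint_def using adjoint_exists[OF assms]
    by (intro someI_ex[of "\<lambda>h. h \<in> H \<and> (\<forall>f\<in>H. l2_inner M f h = l2_inner N (T f) g)"]) auto
  then show "l2_adjoint M H N T g \<in> H"
    and "\<And>f. f \<in> H \<Longrightarrow> l2_inner M f (l2_adjoint M H N T g) = l2_inner N (T f) g"
    by auto
qed

end

section \<open>Shifts of an orthonormal basis\<close>

context l2_basis
begin

text \<open>The isometry induced by an injection of the index set. It is described by coefficients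
  because the operators concerned are known only up to a.e. equality.\<close>

definition shift :: "('i \<Rightarrow> 'i) \<Rightarrow> (('a \<Rightarrow> complex) \<Rightarrow> 'a \<Rightarrow> complex) \<Rightarrow> bool" where
  "shift \<sigma> A \<longleftrightarrow> inj \<sigma> \<and>
     (\<forall>f\<in>H. A f \<in> H \<and> (\<forall>i. cf (A f) (\<sigma> i) = cf f i) \<and> (\<forall>k. k \<notin> range \<sigma> \<longrightarrow> cf (A f) k = 0))"

lemma shiftD:
  assumes "shift \<sigma> A"
  shows "inj \<sigma>" "f \<in> H \<Longrightarrow> A f \<in> H" "f \<in> H \<Longrightarrow> cf (A f) (\<sigma> i) = cf f i"
    "f \<in> H \<Longrightarrow> k \<notin> range \<sigma> \<Longrightarrow> cf (A f) k = 0"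
  using assms unfolding shift_def by blast+

lemma cf_cong_AE: "f \<in> l2 M \<Longrightarrow> g \<in> l2 M \<Longrightarrow> AE x in M. f x = g x \<Longrightarrow> cf f i = cf g i"
  by (rule l2_inner_cong_AE) (simp_all add: e_l2)

lemma shift_AE_eqI:
  assumes A: "shift \<sigma> A" and f: "f \<in> H" and h: "h \<in> H"
    and "\<And>i. cf h (\<sigma> i) = cf f i" "\<And>k. k \<notin> range \<sigma> \<Longrightarrow> cf h k = 0"
  shows "AE x in M. A f x = h x"
proof (rule eq_AE_if_cf_eq[OF shiftD(2)[OF A f] h])
  show "cf (A f) k = cf h k" for k
    using assms(4,5) shiftD(3)[OF A f] shiftD(4)[OF A f] by (cases "k \<in> range \<sigma>") auto
qed

lemma shift_basis:
  assumes "shift \<sigma> A"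
  shows "AE x in M. A (e i) x = e (\<sigma> i) x"
  using shiftD(1)[OF assms] by (intro shift_AE_eqI[OF assms] e_H) (auto simp: e_orth inj_eq)

lemma shift_norm:
  assumes A: "shift \<sigma> A" and f: "f \<in> H"
  shows "l2_norm M (A f) = l2_norm M f"
proof -
  have "((\<lambda>k. (cmod (cf (A f) k))\<^sup>2) has_sum (l2_norm M (A f))\<^sup>2) (range \<sigma>)"
    using Parseval[OF shiftD(2)[OF A f]] shiftD(4)[OF A f]
    by (subst has_sum_cong_neutral[where T=UNIV and g="\<lambda>k. (cmod (cf (A f) k))\<^sup>2"]) auto
  then have "((\<lambda>i. (cmod (cf f i))\<^sup>2) has_sum (l2_norm M (A f))\<^sup>2) UNIV"
    using shiftD(3)[OF A f] by (subst (asm) has_sum_reindex[OF shiftD(1)[OF A]]) (simp add: o_def)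
  from has_sum_unique[OF this Parseval[OF f]] show ?thesis
    by simp
qed

lemma shift_bounded_op:
  assumes A: "shift \<sigma> A"
  shows "bounded_op M H A"
proof -
  note H = H_l2 shiftD(2)[OF A] H_add H_scale
  have "AE x in M. A f x = A g x" if f: "f \<in> H" and g: "g \<in> H" and "AE x in M. f x = g x" for f g
    using cf_cong_AE[OF H_l2[OF f] H_l2[OF g] that(3)] shiftD(3,4)[OF A g]
    by (intro shift_AE_eqI[OF A f shiftD(2)[OF A g]]) auto
  moreover have "AE x in M. A (\<lambda>y. f y + g y) x = A f x + A g x" if f: "f \<in> H" and g: "g \<in> H" for f g
    using shiftD(3,4)[OF A f] shiftD(3,4)[OF A g] f g
    by (intro shift_AE_eqI[OF A] H_add f g shiftD(2)[OF A]) (simp_all add: cf_add H)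
  moreover have "AE x in M. A (\<lambda>y. c * f y) x = c * A f x" if f: "f \<in> H" for c f
    using shiftD(3,4)[OF A f]
    by (intro shift_AE_eqI[OF A] H_scale f shiftD(2)[OF A]) (simp_all add: l2_inner_scale_left)
  moreover have "l2_norm M (A f) \<le> 1 * l2_norm M f" if f: "f \<in> H" for f
    using shift_norm[OF A f] by simp
  ultimately show ?thesis
    unfolding bounded_op_def using shiftD(2)[OF A] by blast
qed

text \<open>Supplies the witness for the choice that defines \<open>X\<close>.\<close>

lemma shift_exists:
  assumes "inj \<sigma>"
  shows "\<exists>A. shift \<sigma> A"
proof -
  have "\<exists>h\<in>H. (\<forall>i. cf h (\<sigma> i) = cf f i) \<and> (\<forall>k. k \<notin> range \<sigma> \<longrightarrow> cf h k = 0)" if f: "f \<in> H" for f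
  proof -
    define c where "c k = (if k \<in> range \<sigma> then cf f (inv \<sigma> k) else 0)" for k
    have "(\<lambda>k. (cmod (c k))\<^sup>2) summable_on range \<sigma>"
      using Bessel_summable[OF H_l2[OF f]] assms
      by (subst summable_on_reindex) (simp_all add: o_def c_def)
    then have "(\<lambda>k. (cmod (c k))\<^sup>2) summable_on UNIV"
      by (subst summable_on_cong_neutral[where T="range \<sigma>" and g="\<lambda>k. (cmod (c k))\<^sup>2"])
        (auto simp: c_def)
    then obtain h where "h \<in> H" "\<And>k. cf h k = c k"
      by (rule H_with_cf) (rule that)
    then show ?thesis
      using assms by (intro bexI[of _ h]) (auto simp: c_def)
  qed
  then obtain A where "\<And>f. f \<in> H \<Longrightarrow>
      A f \<in> H \<and> (\<forall>i. cf (A f) (\<sigma> i) = cf f i) \<and> (\<forall>k. k \<notin> range \<sigma> \<longrightarrow> cf (A f) k = 0)"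
    by metis
  then show ?thesis
    using assms unfolding shift_def by blast
qed

text \<open>Continuity carries the action on basis vectors to all of \<open>H\<close>: the
  coefficients of \<open>A f\<close> are limits of those of \<open>A\<close> on finite sums. It is
  applied to \<open>X\<close>, whose specification speaks only of basis vectors.\<close>

lemma bounded_op_shift:
  assumes A: "bounded_op M H A" and "inj \<sigma>" and AE: "\<And>i. AE x in M. A (e i) x = e (\<sigma> i) x"
  shows "shift \<sigma> A"
proof -
  have bl: "bdd_lin M H M A"
    using A by (intro bounded_op_bdd_lin) (auto intro: H_l2)
  have AH: "f \<in> H \<Longrightarrow> A f \<in> H" for f
    using A by (simp add: bounded_op_def)
  have *: "(\<lambda>n. \<Sum>i\<in>F n. cf f i * (if \<sigma> i = k then 1 else 0)) \<longlonglongrightarrow> cf (A f) k"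
    if f: "f \<in> H" and F: "\<And>n. finite (F n)" "(\<lambda>n. l2_norm M (\<lambda>x. fsum (F n) (cf f) x - f x)) \<longlonglongrightarrow> 0"
    for f k and F :: "nat \<Rightarrow> 'i set"
  proof -
    have "(\<lambda>n. cf (A (fsum (F n) (cf f))) k) \<longlonglongrightarrow> cf (A f) k"
      by (rule bdd_lin_inner_tendsto[OF bl fsum_H f e_l2 F(2)])
    moreover have "cf (A (fsum (F n) (cf f))) k = (\<Sum>i\<in>F n. cf f i * (if \<sigma> i = k then 1 else 0))" for n
    proof -
      have "cf (A (fsum (F n) (cf f))) k = cf (\<lambda>x. \<Sum>i\<in>F n. cf f i * A (e i) x) k"
        using bdd_lin_sum[OF bl e_H F(1), where c="cf f"]
        by (intro cf_cong_AE H_l2 AH fsum_H H_sum H_scale e_H) (simp add: fsum_def)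
      also have "\<dots> = (\<Sum>i\<in>F n. cf f i * cf (A (e i)) k)"
        by (simp add: l2_inner_sum_left l2_scale H_l2 AH e_H l2_inner_scale_left)
      also have "\<dots> = (\<Sum>i\<in>F n. cf f i * cf (e (\<sigma> i)) k)"
        using cf_cong_AE[OF H_l2[OF AH[OF e_H]] e_l2 AE] by simp
      finally show ?thesis
        by (simp add: e_orth)
    qed
    ultimately show ?thesis
      by simp
  qed
  have "cf (A f) (\<sigma> i) = cf f i" if f: "f \<in> H" for f i
  proof -
    obtain F where F: "\<And>n. finite (F n)" "(\<lambda>n::nat. l2_norm M (\<lambda>x. fsum (F n) (cf f) x - f x)) \<longlonglongrightarrow> 0"
      using fsum_seq_tendsto[OF f] by blast
    have "(\<lambda>n. cf (fsum (F n) (cf f)) i) \<longlonglongrightarrow> cf f i"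
      by (rule l2_inner_tendsto[OF fsum_l2 H_l2[OF f] e_l2 F(2)])
    moreover have "(\<Sum>m\<in>F n. cf f m * (if \<sigma> m = \<sigma> i then 1 else 0)) = cf (fsum (F n) (cf f)) i" for n
      using \<open>inj \<sigma>\<close> F(1)[of n] by (simp add: cf_fsum inj_eq if_distrib cong: if_cong)
    ultimately show ?thesis
      using *[OF f F, of "\<sigma> i"] by (simp add: LIMSEQ_unique)
  qed
  moreover have "cf (A f) k = 0" if f: "f \<in> H" and k: "k \<notin> range \<sigma>" for f k
  proof -
    obtain F where F: "\<And>n. finite (F n)" "(\<lambda>n::nat. l2_norm M (\<lambda>x. fsum (F n) (cf f) x - f x)) \<longlonglongrightarrow> 0"
      using fsum_seq_tendsto[OF f] by blast
    have "(\<Sum>m\<in>F n. cf f m * (if \<sigma> m = k then 1 else 0)) = 0" for n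
      using k by (intro sum.neutral) auto
    then show ?thesis
      using *[OF f F, of k] by (simp add: LIMSEQ_const_iff)
  qed
  ultimately show ?thesis
    using \<open>inj \<sigma>\<close> AH unfolding shift_def by blast
qed

lemma shift_funpow:
  assumes A: "shift \<sigma> A"
  shows "shift (\<sigma> ^^ n) (A ^^ n)"
proof (induction n)
  case 0
  then show ?case
    by (simp add: shift_def)
next
  case (Suc n)
  have "cf ((A ^^ Suc n) f) k = 0" if f: "f \<in> H" and k: "k \<notin> range (\<sigma> ^^ Suc n)" for f k
  proof (cases "k \<in> range \<sigma>")
    case True
    then obtain m where m: "k = \<sigma> m"
      by blast
    with k have "m \<notin> range (\<sigma> ^^ n)"
      by auto
    then show ?thesis
      using shiftD(3)[OF A shiftD(2)[OF Suc f]] shiftD(4)[OF Suc f] by (simp add: m)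
  next
    case False
    then show ?thesis
      using shiftD(4)[OF A shiftD(2)[OF Suc f]] by simp
  qed
  moreover have "cf ((A ^^ Suc n) f) ((\<sigma> ^^ Suc n) i) = cf f i" if "f \<in> H" for f i
    using shiftD(3)[OF A shiftD(2)[OF Suc that]] shiftD(3)[OF Suc that] by simp
  moreover have "(A ^^ Suc n) f \<in> H" if "f \<in> H" for f
    using shiftD(2)[OF A shiftD(2)[OF Suc that]] by simp
  moreover have "inj (\<sigma> ^^ Suc n)"
    using shiftD(1)[OF A] shiftD(1)[OF Suc] by (simp add: inj_compose)
  ultimately show ?case
    unfolding shift_def by blast
qed

lemma shift_adjoint:
  assumes A: "shift \<sigma> A" and g: "g \<in> H"
  shows "l2_adjoint M H M A g \<in> H" "cf (l2_adjoint M H M A g) i = cf g (\<sigma> i)"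
proof -
  have bl: "bdd_lin M H M A"
    using shift_bounded_op[OF A] by (intro bounded_op_bdd_lin) (auto intro: H_l2)
  show adj: "l2_adjoint M H M A g \<in> H"
    by (rule l2_adjoint(1)[OF bl H_l2[OF g]])
  have "l2_inner M (e i) (l2_adjoint M H M A g) = l2_inner M (A (e i)) g"
    by (rule l2_adjoint(2)[OF bl H_l2[OF g] e_H])
  also have "\<dots> = l2_inner M (e (\<sigma> i)) g"
    using shift_basis[OF A] by (intro l2_inner_cong_AE H_l2[OF shiftD(2)[OF A e_H]] e_l2 H_l2[OF g]) auto
  finally show "cf (l2_adjoint M H M A g) i = cf g (\<sigma> i)"
    by (simp add: l2_inner_commute[of M "e _"])
qed

lemma shift_adjoint_funpow:
  assumes A: "shift \<sigma> A" and g: "g \<in> H"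
  shows "(l2_adjoint M H M A ^^ n) g \<in> H \<and> (\<forall>i. cf ((l2_adjoint M H M A ^^ n) g) i = cf g ((\<sigma> ^^ n) i))"
proof (induction n)
  case (Suc n)
  then have "l2_adjoint M H M A ((l2_adjoint M H M A ^^ n) g) \<in> H"
    by (intro shift_adjoint[OF A]) auto
  moreover have "cf (l2_adjoint M H M A ((l2_adjoint M H M A ^^ n) g)) i = cf g ((\<sigma> ^^ Suc n) i)" for i
    using Suc shift_adjoint(2)[OF A, of "(l2_adjoint M H M A ^^ n) g" i] by (simp add: funpow_swap1)
  ultimately show ?case
    by simp
qed (simp add: g)

lemma norm_le_if_cf_sums_le:
  assumes "f \<in> H" "0 \<le> b" "\<And>F. finite F \<Longrightarrow> (\<Sum>i\<in>F. (cmod (cf f i))\<^sup>2) \<le> b\<^sup>2"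
  shows "l2_norm M f \<le> b"
proof (rule power2_le_imp_le[OF _ assms(2)])
  show "(l2_norm M f)\<^sup>2 \<le> b\<^sup>2"
    by (rule has_sum_le_finite_sums[OF Parseval[OF assms(1)]]) (rule assms(3))
qed

text \<open>The n-th power of the adjoint keeps exactly the coefficients of \<open>g\<close> with
  index in the range of \<open>\<sigma> ^^ n\<close>. If \<open>F\<close> misses that range, they
  are among those left after subtracting the sum over \<open>F\<close>. The empty \<open>F\<close>
  gives contractivity.\<close>

lemma shift_adjoint_norm_le:
  assumes A: "shift \<sigma> A" and g: "g \<in> H" and F: "finite F" "\<And>i. (\<sigma> ^^ n) i \<notin> F"
  shows "l2_norm M ((l2_adjoint M H M A ^^ n) g) \<le> l2_norm M (\<lambda>x. fsum F (cf g) x - g x)"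
proof (rule norm_le_if_cf_sums_le)
  have inj: "inj (\<sigma> ^^ n)"
    using shiftD(1)[OF shift_funpow[OF A]] .
  fix B :: "'i set" assume B: "finite B"
  have "(\<Sum>i\<in>B. (cmod (cf ((l2_adjoint M H M A ^^ n) g) i))\<^sup>2) = (\<Sum>i\<in>(\<sigma> ^^ n) ` B. (cmod (cf g i))\<^sup>2)"
    using shift_adjoint_funpow[OF A g] inj
    by (subst sum.reindex) (auto intro: inj_on_subset)
  moreover have "(\<Sum>i\<in>(\<sigma> ^^ n) ` B. (cmod (cf g i))\<^sup>2) + (\<Sum>i\<in>F. (cmod (cf g i))\<^sup>2) \<le> (l2_norm M g)\<^sup>2"
  proof -
    have "(\<sigma> ^^ n) ` B \<inter> F = {}"
      using F(2) by auto
    then show ?thesis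
      using F(1) B Bessel[OF H_l2[OF g], of "(\<sigma> ^^ n) ` B \<union> F"]
        sum.union_disjoint[of "(\<sigma> ^^ n) ` B" F "\<lambda>i. (cmod (cf g i))\<^sup>2"] by simp
  qed
  moreover have "l2_norm M (\<lambda>x. fsum F (cf g) x - g x) = l2_norm M (\<lambda>x. g x - fsum F (cf g) x)"
    by (simp add: l2_norm_def norm_minus_commute)
  ultimately show "(\<Sum>i\<in>B. (cmod (cf ((l2_adjoint M H M A ^^ n) g) i))\<^sup>2)
      \<le> (l2_norm M (\<lambda>x. fsum F (cf g) x - g x))\<^sup>2"
    using Bessel_eq[OF H_l2[OF g] F(1)] by simp
qed (use shift_adjoint_funpow[OF A g] in auto)

lemma shift_adjoint_funpow_norm_le:
  assumes "shift \<sigma> A" "g \<in> H"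
  shows "l2_norm M ((l2_adjoint M H M A ^^ n) g) \<le> l2_norm M g"
  using shift_adjoint_norm_le[OF assms, of "{}" n] by (simp add: fsum_def l2_norm_def)

lemma shift_adjoint_inner:
  assumes A: "shift \<sigma> A" and h: "h \<in> H" and "g \<in> H"
  shows "l2_inner M ((l2_adjoint M H M A ^^ n) h) g = l2_inner M h ((A ^^ n) g)"
  using \<open>g \<in> H\<close>
proof (induction n arbitrary: g)
  case (Suc n)
  let ?k = "(l2_adjoint M H M A ^^ n) h"
  have bl: "bdd_lin M H M A"
    using shift_bounded_op[OF A] by (intro bounded_op_bdd_lin) (auto intro: H_l2)
  have "?k \<in> l2 M"
    using shift_adjoint_funpow[OF A h] H_l2 by blast
  from l2_adjoint(2)[OF bl this Suc.prems]
  have "l2_inner M (l2_adjoint M H M A ?k) g = l2_inner M ?k (A g)"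
    by (simp add: l2_inner_commute[of M _ g] l2_inner_commute[of M "A g"])
  also have "\<dots> = l2_inner M h ((A ^^ n) (A g))"
    by (rule Suc.IH[OF shiftD(2)[OF A Suc.prems]])
  finally show ?case
    by (simp add: funpow_swap1)
qed simp

text \<open>Lets the strong limit at one vector \<open>h\<close> control nearby vectors
  \<open>g\<close>, uniformly in \<open>n\<close>.\<close>

lemma shift_adjoint_diff_le:
  assumes A: "shift \<sigma> A" and g: "g \<in> H" and h: "h \<in> H"
  shows "l2_norm M ((l2_adjoint M H M A ^^ n) g)
    \<le> l2_norm M ((l2_adjoint M H M A ^^ n) h) + l2_norm M (\<lambda>x. g x - h x)"
proof -
  let ?B = "l2_adjoint M H M A ^^ n"
  note B = shift_adjoint_funpow[OF A, THEN conjunct1] shift_adjoint_funpow[OF A, THEN conjunct2, rule_format]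
  note gh = H_diff[OF g h]
  have "AE x in M. ?B (\<lambda>x. g x - h x) x = ?B g x - ?B h x"
    using g h gh by (intro eq_AE_if_cf_eq H_diff B) (simp_all add: B cf_diff H_l2)
  then have "l2_norm M (\<lambda>x. ?B g x - ?B h x) = l2_norm M (?B (\<lambda>x. g x - h x))"
    using g h gh by (intro l2_norm_cong_AE H_l2 H_diff B) auto
  also have "\<dots> \<le> l2_norm M (\<lambda>x. g x - h x)"
    by (rule shift_adjoint_funpow_norm_le[OF A gh])
  finally show ?thesis
    using l2_norm_le_diff[OF H_l2[OF B(1)[OF g]] H_l2[OF B(1)[OF h]], of n n] by simp
qed

text \<open>In a finite sum close to \<open>g\<close> the finitely many indices have all left the
  range for large \<open>n\<close>, and only the small remainder survives.\<close>

lemma shift_adjoint_tendsto_0: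
  assumes A: "shift \<sigma> A" and g: "g \<in> H"
    and leaves: "\<And>i. \<forall>\<^sub>F n in sequentially. i \<notin> range (\<sigma> ^^ n)"
  shows "(\<lambda>n. l2_norm M ((l2_adjoint M H M A ^^ n) g)) \<longlonglongrightarrow> 0"
proof (rule tendstoI)
  fix \<epsilon> :: real assume "\<epsilon> > 0"
  obtain F where F: "\<And>n. finite (F n)" "(\<lambda>n::nat. l2_norm M (\<lambda>x. fsum (F n) (cf g) x - g x)) \<longlonglongrightarrow> 0"
    using fsum_seq_tendsto[OF g] by blast
  obtain m where m: "l2_norm M (\<lambda>x. fsum (F m) (cf g) x - g x) < \<epsilon>"
    using order_tendstoD(2)[OF F(2) \<open>\<epsilon> > 0\<close>] by (auto simp: eventually_sequentially)
  have "\<forall>\<^sub>F n in sequentially. \<forall>i\<in>F m. i \<notin> range (\<sigma> ^^ n)"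
    using leaves F(1) by (simp add: eventually_ball_finite)
  then show "\<forall>\<^sub>F n in sequentially. dist (l2_norm M ((l2_adjoint M H M A ^^ n) g)) 0 < \<epsilon>"
  proof eventually_elim
    case (elim n)
    then have "l2_norm M ((l2_adjoint M H M A ^^ n) g) \<le> l2_norm M (\<lambda>x. fsum (F m) (cf g) x - g x)"
      by (intro shift_adjoint_norm_le[OF A g F(1)]) auto
    then show ?case
      using m by simp
  qed
qed

text \<open>Strong convergence to zero becomes uniform on the relatively compact image of the unit ball.\<close>

lemma compact_op_shift_adjoint:
  assumes K: "compact_op M H K" and A: "shift \<sigma> A"
    and leaves: "\<And>i. \<forall>\<^sub>F n in sequentially. i \<notin> range (\<sigma> ^^ n)" and "\<epsilon> > 0"
  shows "\<forall>\<^sub>F n in sequentially. \<forall>f\<in>H. l2_norm M f \<le> C \<longrightarrow>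
    l2_norm M ((l2_adjoint M H M A ^^ n) (K f)) < \<epsilon>"
proof (rule ccontr)
  let ?B = "\<lambda>n. l2_adjoint M H M A ^^ n"
  assume neg: "\<not> ?thesis"
  \<comment> \<open>The exponents at which the bound fails. If there are infinitely many, the images
    under \<open>K\<close> of the bad vectors have a norm convergent subsequence, and strong
    convergence at its limit gives the contradiction.\<close>
  define S where "S = {n. \<exists>f\<in>H. l2_norm M f \<le> C \<and> \<epsilon> \<le> l2_norm M (?B n (K f))}"
  have "\<exists>n\<ge>m. n \<in> S" for m
    using neg unfolding eventually_sequentially S_def by (auto simp: not_less)
  then have "infinite S"
    by (auto simp: infinite_nat_iff_unbounded_le)
  then obtain s :: "nat \<Rightarrow> nat" where s: "strict_mono s" "\<And>n. s n \<in> S"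
    using infinite_enumerate by blast
  then have "\<exists>f\<in>H. l2_norm M f \<le> C \<and> \<epsilon> \<le> l2_norm M (?B (s n) (K f))" for n
    by (auto simp: S_def)
  then obtain f where f: "\<And>n. f n \<in> H" "\<And>n. l2_norm M (f n) \<le> C"
      "\<And>n. \<epsilon> \<le> l2_norm M (?B (s n) (K (f n)))"
    by metis
  obtain r g where r: "strict_mono r" and g: "g \<in> H"
      and lim: "(\<lambda>n. l2_norm M (\<lambda>x. K (f (r n)) x - g x)) \<longlonglongrightarrow> 0"
    using K f(1,2) unfolding compact_op_def by blast
  have KH: "K (f n) \<in> H" for n
    using K f(1) unfolding compact_op_def bounded_op_def by blast
  have "(\<lambda>n. l2_norm M (?B (s (r n)) g)) \<longlonglongrightarrow> 0"
    using LIMSEQ_subseq_LIMSEQ[OF shift_adjoint_tendsto_0[OF A g leaves] strict_mono_o[OF s(1) r]]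
    by (simp add: o_def)
  from tendsto_add[OF this lim]
  have "(\<lambda>n. l2_norm M (?B (s (r n)) g) + l2_norm M (\<lambda>x. K (f (r n)) x - g x)) \<longlonglongrightarrow> 0"
    by simp
  then have "\<forall>\<^sub>F n in sequentially. l2_norm M (?B (s (r n)) g) + l2_norm M (\<lambda>x. K (f (r n)) x - g x) < \<epsilon>"
    using \<open>\<epsilon> > 0\<close> by (rule order_tendstoD)
  then obtain n where "l2_norm M (?B (s (r n)) g) + l2_norm M (\<lambda>x. K (f (r n)) x - g x) < \<epsilon>"
    by (auto simp: eventually_sequentially)
  then show False
    using shift_adjoint_diff_le[OF A KH g, of "s (r n)" "r n"] f(3)[of "r n"] by linarith
qed

end

section \<open>Fourier coefficients on the torus\<close>

lemma space_circle [simp]: "space circle_measure = UNIV"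
  and sets_circle [simp, measurable_cong]: "sets circle_measure = sets borel"
  by (simp_all add: circle_measure_def)

lemma measurable_cis [measurable]: "cis \<in> borel_measurable borel"
  by (intro borel_measurable_continuous_onI continuous_intros)

lemma emeasure_circle: "emeasure circle_measure UNIV = 1"
  unfolding circle_measure_def by (subst emeasure_distr) (auto simp: divide_ennreal)

interpretation circle: finite_measure circle_measure
  by (rule finite_measureI) (simp add: emeasure_circle)

lemma AE_circle: "AE z in circle_measure. cmod z = 1"
  unfolding circle_measure_def by (subst AE_distr_iff) auto

lemma integral_circle:
  fixes f :: "complex \<Rightarrow> complex"
  assumes [measurable]: "f \<in> borel_measurable borel"
  shows "(\<integral>z. f z \<partial>circle_measure) = (\<integral>t. indicator {0..2*pi} t *\<^sub>R (f (cis t) / of_real (2 * pi)) \<partial>lborel)"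
proof -
  have eq: "uniform_measure lborel {0..2 * pi} = density lborel (\<lambda>t. ennreal (indicator {0..2*pi} t / (2 * pi)))"
    unfolding uniform_measure_def
    by (intro arg_cong2[where f=density] refl ext)
      (auto simp: divide_ennreal indicator_def simp flip: ennreal_1)
  have "(\<integral>z. f z \<partial>circle_measure) = (\<integral>t. f (cis t) \<partial>uniform_measure lborel {0..2*pi})"
    unfolding circle_measure_def by (rule integral_distr) measurable
  also have "\<dots> = (\<integral>t. (indicator {0..2*pi} t / (2 * pi)) *\<^sub>R f (cis t) \<partial>lborel)"
    unfolding eq by (rule integral_density) auto
  also have "\<dots> = (\<integral>t. indicator {0..2*pi} t *\<^sub>R (f (cis t) / of_real (2 * pi)) \<partial>lborel)"
    by (intro Bochner_Integration.integral_cong refl) (simp add: scaleR_conv_of_real)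
  finally show ?thesis .
qed

lemma measurable_powi [measurable]:
  fixes f :: "'a \<Rightarrow> complex"
  assumes [measurable]: "f \<in> borel_measurable M"
  shows "(\<lambda>x. f x powi k) \<in> borel_measurable M"
  by (cases "k \<ge> 0") (simp_all add: power_int_def)

lemma integral_circle_powi: "(\<integral>z. z powi n \<partial>circle_measure) = (if n = 0 then 1 else 0)"
proof (cases "n = 0")
  case True
  then show ?thesis
    by (simp add: measure_def emeasure_circle)
next
  case False
  define c where "c = \<i> * of_int n"
  have c: "c \<noteq> 0"
    using False by (simp add: c_def)
  have "(\<integral>z. z powi n \<partial>circle_measure)
      = (\<integral>t. indicator {0..2*pi} t *\<^sub>R (exp (c * of_real t) / of_real (2 * pi)) \<partial>lborel)"
  proof (subst integral_circle)
    have "cis t powi n = exp (c * of_real t)" for t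
      by (simp add: cis_power_int) (simp add: cis_conv_exp c_def mult_ac)
    then show "(\<integral>t. indicator {0..2*pi} t *\<^sub>R (cis t powi n / of_real (2 * pi)) \<partial>lborel)
        = (\<integral>t. indicator {0..2*pi} t *\<^sub>R (exp (c * of_real t) / of_real (2 * pi)) \<partial>lborel)"
      by simp
  qed measurable
  also have "\<dots> = exp (c * of_real (2 * pi)) / (c * of_real (2 * pi)) - exp (c * of_real 0) / (c * of_real (2 * pi))"
  proof (rule integral_FTC_atLeastAtMost)
    fix t :: real
    have "((\<lambda>z. exp (c * z) / (c * of_real (2 * pi))) has_field_derivative exp (c * of_real t) / of_real (2 * pi)) (at (of_real t))"
      using c by (auto intro!: derivative_eq_intros)
    then show "((\<lambda>t. exp (c * of_real t) / (c * of_real (2 * pi))) has_vector_derivative exp (c * of_real t) / of_real (2 * pi))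
        (at t within {0..2 * pi})"
      by (rule has_vector_derivative_real_field)
  qed (auto intro!: continuous_intros)
  also have "exp (c * of_real (2 * pi)) = 1"
  proof -
    have "c * of_real (2 * pi) = 2 * of_int n * of_real pi * \<i>"
      by (simp add: c_def)
    then show ?thesis
      using exp_eq_1[of "c * of_real (2 * pi)"] by (auto simp: c_def)
  qed
  finally show ?thesis
    using False by simp
qed

interpretation torus: pair_sigma_finite circle_measure circle_measure
  by unfold_locales

interpretation torus: finite_measure torus_measure
  unfolding torus_measure_def by (intro finite_measure_pair_measure circle.finite_measure_axioms)

lemma space_torus [simp]: "space torus_measure = UNIV"
  by (simp add: torus_measure_def space_pair_measure)

lemma sets_torus [simp, measurable_cong]: "sets torus_measure = sets borel"
proof -
  have "sets torus_measure = sets (borel \<Otimes>\<^sub>M borel :: (complex \<times> complex) measure)"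
    unfolding torus_measure_def by (intro sets_pair_measure_cong) simp_all
  also have "\<dots> = sets borel"
    unfolding borel_prod ..
  finally show ?thesis .
qed

lemma measurable_fst_borel [measurable]: "(fst :: complex \<times> complex \<Rightarrow> complex) \<in> borel_measurable borel"
  and measurable_snd_borel [measurable]: "(snd :: complex \<times> complex \<Rightarrow> complex) \<in> borel_measurable borel"
  by (intro borel_measurable_continuous_onI continuous_intros)+

lemma AE_torus: "AE z in torus_measure. cmod (fst z) = 1 \<and> cmod (snd z) = 1"
  unfolding torus_measure_def
proof (rule torus.AE_pair_measure)
  have "{z :: complex \<times> complex. cmod (fst z) = 1 \<and> cmod (snd z) = 1} \<in> sets borel"
    by measurable
  then show "{z \<in> space (circle_measure \<Otimes>\<^sub>M circle_measure). cmod (fst z) = 1 \<and> cmod (snd z) = 1}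
      \<in> sets (circle_measure \<Otimes>\<^sub>M circle_measure)"
    using sets_torus by (simp add: torus_measure_def space_pair_measure)
  show "AE x in circle_measure. AE y in circle_measure. cmod (fst (x, y)) = 1 \<and> cmod (snd (x, y)) = 1"
    using AE_circle
  proof eventually_elim
    case (elim x)
    show ?case
      using AE_circle by eventually_elim (simp add: elim)
  qed
qed

definition monomial :: "int \<Rightarrow> int \<Rightarrow> complex \<times> complex \<Rightarrow> complex" where
  "monomial k l z = fst z powi k * snd z powi l"

lemma monomial_measurable [measurable]: "monomial k l \<in> borel_measurable borel"
  unfolding monomial_def[abs_def] by measurable

lemma cmod_monomial: "AE z in torus_measure. cmod (monomial k l z) \<le> 1"
  using AE_torus by eventually_elim (simp add: monomial_def norm_mult norm_power_int)

lemma monomial_l2: "monomial k l \<in> l2 torus_measure"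
  by (rule torus.l2_bounded[OF _ cmod_monomial]) (simp add: measurable_cong_sets[OF sets_torus refl])

lemma integral_monomial: "(\<integral>z. monomial k l z \<partial>torus_measure) = (if k = 0 \<and> l = 0 then 1 else 0)"
proof -
  have "integrable torus_measure (monomial k l)"
    by (rule torus.l2_integrable[OF monomial_l2])
  then have "(\<integral>z. monomial k l z \<partial>torus_measure) = (\<integral>x. (\<integral>y. monomial k l (x, y) \<partial>circle_measure) \<partial>circle_measure)"
    unfolding torus_measure_def by (subst torus.integral_fst) simp_all
  also have "\<dots> = (if k = 0 \<and> l = 0 then 1 else 0)"
    by (simp add: monomial_def integral_circle_powi)
  finally show ?thesis .
qed

lemma monomial_mult: "AE z in torus_measure. monomial k l z * monomial k' l' z = monomial (k + k') (l + l') z"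
  using AE_torus
proof eventually_elim
  case (elim z)
  then have "fst z \<noteq> 0" "snd z \<noteq> 0"
    by auto
  then show ?case
    by (simp add: monomial_def power_int_add)
qed

lemma cnj_eq_inverse: "cmod z = 1 \<Longrightarrow> cnj z = inverse z"
  using complex_norm_square[of z] by (intro inverse_unique[symmetric]) simp

lemma cnj_powi: "cmod z = 1 \<Longrightarrow> cnj (z powi k) = z powi (- k)"
  by (simp add: cnj_eq_inverse power_int_minus power_int_inverse)

lemma cnj_monomial: "AE z in torus_measure. cnj (monomial k l z) = monomial (-k) (-l) z"
  using AE_torus by eventually_elim (simp only: monomial_def cnj_powi complex_cnj_mult)

lemma inner_monomial:
  "l2_inner torus_measure (monomial k l) (monomial k' l') = (if k = k' \<and> l = l' then 1 else 0)"
proof -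
  have "l2_inner torus_measure (monomial k l) (monomial k' l') = (\<integral>z. monomial (k - k') (l - l') z \<partial>torus_measure)"
    unfolding l2_inner_def
  proof (rule integral_cong_AE)
    show "AE z in torus_measure. monomial k l z * cnj (monomial k' l' z) = monomial (k - k') (l - l') z"
      using cnj_monomial[of k' l'] monomial_mult[of k l "-k'" "-l'"] by eventually_elim simp
  qed measurable
  then show ?thesis
    by (simp add: integral_monomial)
qed

lemma fourier_coeff_eq: "fourier_coeff f k l = l2_inner torus_measure f (monomial k l)"
  by (simp add: fourier_coeff_def monomial_def[abs_def])

text \<open>The functions orthogonal to all monomials form a module over the trigonometric polynomials;
  this avoids any explicit description of those polynomials.\<close>

definition annihilates :: "(complex \<times> complex \<Rightarrow> complex) \<Rightarrow> bool" where
  "annihilates h \<longleftrightarrow> integrable torus_measure h \<and> (\<forall>k l. (\<integral>z. h z * monomial k l z \<partial>torus_measure) = 0)"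

lemma integrable_mult_monomial:
  assumes "integrable torus_measure h"
  shows "integrable torus_measure (\<lambda>z. h z * monomial k l z)"
proof (rule Bochner_Integration.integrable_bound[OF assms])
  have [measurable]: "h \<in> borel_measurable torus_measure"
    using assms by auto
  show "(\<lambda>z. h z * monomial k l z) \<in> borel_measurable torus_measure"
    by measurable
  show "AE z in torus_measure. norm (h z * monomial k l z) \<le> norm (h z)"
    using cmod_monomial[of k l] by eventually_elim (simp add: norm_mult mult_left_le)
qed

lemma annihilates_add: "annihilates f \<Longrightarrow> annihilates g \<Longrightarrow> annihilates (\<lambda>z. f z + g z)"
  by (simp add: annihilates_def distrib_right integrable_mult_monomial)

lemma annihilates_scale: "annihilates f \<Longrightarrow> annihilates (\<lambda>z. c * f z)"
  by (simp add: annihilates_def mult.assoc)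

lemma annihilates_cong_AE:
  assumes "annihilates f" "g \<in> borel_measurable torus_measure" "AE z in torus_measure. f z = g z"
  shows "annihilates g"
proof -
  have [measurable]: "f \<in> borel_measurable torus_measure" "g \<in> borel_measurable torus_measure"
    using assms by (auto simp: annihilates_def)
  have "integrable torus_measure g"
    using assms by (subst integrable_cong_AE[of _ _ f]) (auto simp: annihilates_def)
  moreover have "(\<integral>z. g z * monomial k l z \<partial>torus_measure) = (\<integral>z. f z * monomial k l z \<partial>torus_measure)" for k l
    using assms(3) by (intro integral_cong_AE) (auto, measurable)
  ultimately show ?thesis
    using assms(1) by (simp add: annihilates_def)
qed

lemma annihilates_monomial:
  assumes "annihilates f"
  shows "annihilates (\<lambda>z. monomial k l z * f z)"
proof -
  have [measurable]: "f \<in> borel_measurable torus_measure"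
    using assms by (auto simp: annihilates_def)
  have "(\<integral>z. monomial k l z * f z * monomial k' l' z \<partial>torus_measure)
      = (\<integral>z. f z * monomial (k + k') (l + l') z \<partial>torus_measure)" for k' l'
  proof (rule integral_cong_AE)
    show "AE z in torus_measure. monomial k l z * f z * monomial k' l' z = f z * monomial (k + k') (l + l') z"
      using monomial_mult[of k l k' l'] by eventually_elim (simp add: mult_ac)
  qed measurable
  then show ?thesis
    using assms integrable_mult_monomial[of f k l] by (simp add: annihilates_def mult.commute)
qed

text \<open>Base case for the real polynomials of Stone-Weierstrass, which are generated by
  real-linear functionals: on the unit circle the real and imaginary parts of w are combinations of
  w and its inverse.\<close>

lemma real_linear_eq_monomials:
  assumes "bounded_linear g"
  obtains a b c d where "AE z in torus_measure. complex_of_real (g z) =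
    a * monomial 1 0 z + b * monomial (-1) 0 z + c * monomial 0 1 z + d * monomial 0 (-1) z"
proof -
  interpret g: bounded_linear g by fact
  have g: "g z = Re (fst z) * g (1, 0) + Im (fst z) * g (\<i>, 0) + Re (snd z) * g (0, 1) + Im (snd z) * g (0, \<i>)"
    for z :: "complex \<times> complex"
  proof -
    have "z = Re (fst z) *\<^sub>R (1, 0) + Im (fst z) *\<^sub>R (\<i>, 0) + Re (snd z) *\<^sub>R (0, 1) + Im (snd z) *\<^sub>R (0, \<i>)"
      by (cases z) (simp add: complex_eq_iff)
    then have "g z = g (Re (fst z) *\<^sub>R (1, 0) + Im (fst z) *\<^sub>R (\<i>, 0) + Re (snd z) *\<^sub>R (0, 1) + Im (snd z) *\<^sub>R (0, \<i>))"
      by simp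
    then show ?thesis
      by (simp only: g.add g.scaleR real_scaleR_def)
  qed
  have Re: "complex_of_real (Re w) = (w + w powi (-1)) / 2"
    and Im: "complex_of_real (Im w) = - (\<i> / 2) * (w - w powi (-1))" if "cmod w = 1" for w
  proof -
    have "w powi (-1) = cnj w"
      using cnj_powi[OF that, of 1] by simp
    then show "complex_of_real (Re w) = (w + w powi (-1)) / 2"
      "complex_of_real (Im w) = - (\<i> / 2) * (w - w powi (-1))"
      by (simp_all add: complex_eq_iff)
  qed
  have alg: "(x + x') / 2 * A + (- (\<i> / 2) * (x - x')) * B + (y + y') / 2 * C + (- (\<i> / 2) * (y - y')) * D
      = ((A - \<i> * B) / 2) * x + ((A + \<i> * B) / 2) * x' + ((C - \<i> * D) / 2) * y + ((C + \<i> * D) / 2) * y'"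
    for x x' y y' A B C D :: complex
    by (simp add: field_simps)
  show thesis
  proof (rule that)
    show "AE z in torus_measure. complex_of_real (g z) =
        ((g (1, 0) - \<i> * g (\<i>, 0)) / 2) * monomial 1 0 z + ((g (1, 0) + \<i> * g (\<i>, 0)) / 2) * monomial (-1) 0 z
        + ((g (0, 1) - \<i> * g (0, \<i>)) / 2) * monomial 0 1 z + ((g (0, 1) + \<i> * g (0, \<i>)) / 2) * monomial 0 (-1) z"
      using AE_torus
    proof eventually_elim
      case (elim z)
      have "complex_of_real (g z) = complex_of_real (Re (fst z)) * complex_of_real (g (1, 0))
          + complex_of_real (Im (fst z)) * complex_of_real (g (\<i>, 0))
          + complex_of_real (Re (snd z)) * complex_of_real (g (0, 1))
          + complex_of_real (Im (snd z)) * complex_of_real (g (0, \<i>))"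
        by (subst g) simp
      then show ?case
        unfolding Re[OF conjunct1[OF elim]] Im[OF conjunct1[OF elim]] Re[OF conjunct2[OF elim]] Im[OF conjunct2[OF elim]]
        using alg[of "fst z" "fst z powi (-1)" "g (1, 0)" "g (\<i>, 0)" "snd z" "snd z powi (-1)" "g (0, 1)" "g (0, \<i>)"]
        by (simp only: monomial_def power_int_0_right power_int_1_right mult_1_left mult_1_right)
    qed
  qed
qed

lemma real_polynomial_borel:
  "real_polynomial_function g \<Longrightarrow> (g :: complex \<times> complex \<Rightarrow> real) \<in> borel_measurable borel"
  by (intro borel_measurable_continuous_onI continuous_on_polymonial_function) (simp flip: real_polynomial_function_eq)

text \<open>The function \<open>h\<close> is kept arbitrary because the product case applies the
  hypothesis for one factor to \<open>h\<close> multiplied by the other.\<close>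

lemma annihilates_real_polynomial:
  assumes "real_polynomial_function g" "annihilates h"
  shows "annihilates (\<lambda>z. complex_of_real (g z) * h z)"
  using assms
proof (induction g arbitrary: h rule: real_polynomial_function.induct)
  case (linear g)
  obtain a b c d where g: "AE z in torus_measure. complex_of_real (g z) =
      a * monomial 1 0 z + b * monomial (-1) 0 z + c * monomial 0 1 z + d * monomial 0 (-1) z"
    using real_linear_eq_monomials[OF linear.hyps] by blast
  have [measurable]: "h \<in> borel_measurable torus_measure" "g \<in> borel_measurable borel"
    using linear by (auto simp: annihilates_def intro!: real_polynomial_borel)
  have "annihilates (\<lambda>z. a * (monomial 1 0 z * h z) + b * (monomial (-1) 0 z * h z)
      + c * (monomial 0 1 z * h z) + d * (monomial 0 (-1) z * h z))"
    by (intro annihilates_add annihilates_scale annihilates_monomial linear)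
  then show ?case
  proof (rule annihilates_cong_AE)
    show "AE z in torus_measure. a * (monomial 1 0 z * h z) + b * (monomial (-1) 0 z * h z)
        + c * (monomial 0 1 z * h z) + d * (monomial 0 (-1) z * h z) = complex_of_real (g z) * h z"
      using g by eventually_elim (simp add: algebra_simps)
  qed measurable
next
  case (const c)
  then show ?case
    by (rule annihilates_scale)
next
  case (add f g)
  then show ?case
    by (simp add: distrib_right annihilates_add)
next
  case (mult f g)
  then show ?case
    by (simp add: mult.assoc)
qed

lemma annihilates_continuous:
  assumes "annihilates f" "continuous_on UNIV g"
  shows "(\<integral>z. complex_of_real (g z) * f z \<partial>torus_measure) = 0"
proof -
  have f: "integrable torus_measure f" and [measurable]: "f \<in> borel_measurable torus_measure" "g \<in> borel_measurable borel"
    using assms by (auto simp: annihilates_def intro: borel_measurable_continuous_onI)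
  define N where "N = (\<integral>z. cmod (f z) \<partial>torus_measure)"
  have "cmod (\<integral>z. complex_of_real (g z) * f z \<partial>torus_measure) \<le> \<epsilon> * N" if "\<epsilon> > 0" for \<epsilon>
  proof -
    \<comment> \<open>The torus is compact and carries the measure, so uniform approximation on it
      suffices.\<close>
    define S :: "(complex \<times> complex) set" where "S = sphere 0 1 \<times> sphere 0 1"
    have "compact S"
      unfolding S_def by (intro compact_Times compact_sphere)
    then obtain p where p: "real_polynomial_function p" "\<And>z. z \<in> S \<Longrightarrow> \<bar>g z - p z\<bar> < \<epsilon>"
      using Stone_Weierstrass_real_polynomial_function[of S g \<epsilon>] continuous_on_subset[OF assms(2)] \<open>\<epsilon> > 0\<close> by auto
    note [measurable] = real_polynomial_borel[OF p(1)]
    have pf: "integrable torus_measure (\<lambda>z. complex_of_real (p z) * f z)"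
      using annihilates_real_polynomial[OF p(1) assms(1)] by (simp add: annihilates_def)
    have "(\<integral>z. complex_of_real (p z) * f z * monomial 0 0 z \<partial>torus_measure) = 0"
      using annihilates_real_polynomial[OF p(1) assms(1)] unfolding annihilates_def by blast
    then have p0: "(\<integral>z. complex_of_real (p z) * f z \<partial>torus_measure) = 0"
      by (simp add: monomial_def)
    have bnd: "AE z in torus_measure. norm (complex_of_real (g z - p z) * f z) \<le> \<epsilon> * cmod (f z)"
      using AE_torus
    proof eventually_elim
      case (elim z)
      then have "\<bar>g z - p z\<bar> < \<epsilon>"
        by (intro p) (auto simp: S_def mem_Times_iff)
      then show ?case
        by (simp add: norm_mult mult_right_mono del: of_real_diff)
    qed
    have gpf: "integrable torus_measure (\<lambda>z. complex_of_real (g z - p z) * f z)"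
    proof (rule Bochner_Integration.integrable_bound)
      show "integrable torus_measure (\<lambda>z. \<epsilon> * cmod (f z))"
        using f by simp
      show "AE z in torus_measure. norm (complex_of_real (g z - p z) * f z) \<le> norm (\<epsilon> * cmod (f z))"
        using bnd by eventually_elim (use \<open>\<epsilon> > 0\<close> in \<open>simp add: abs_mult\<close>)
    qed measurable
    have "(\<integral>z. complex_of_real (g z) * f z \<partial>torus_measure)
        = (\<integral>z. complex_of_real (g z - p z) * f z + complex_of_real (p z) * f z \<partial>torus_measure)"
      by (simp add: algebra_simps)
    also have "\<dots> = (\<integral>z. complex_of_real (g z - p z) * f z \<partial>torus_measure)"
      using gpf pf p0 by simp
    also have "cmod \<dots> \<le> (\<integral>z. norm (complex_of_real (g z - p z) * f z) \<partial>torus_measure)"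
      by (rule integral_norm_bound)
    also have "\<dots> \<le> (\<integral>z. \<epsilon> * cmod (f z) \<partial>torus_measure)"
      using bnd gpf f by (intro integral_mono_AE) auto
    finally show ?thesis
      by (simp add: N_def)
  qed
  then have "cmod (\<integral>z. complex_of_real (g z) * f z \<partial>torus_measure) \<le> 0 + \<epsilon>" if "\<epsilon> > 0" for \<epsilon>
  proof -
    have N: "N \<ge> 0"
      by (simp add: N_def)
    \<comment> \<open>\<open>N + 1\<close> in place of \<open>N\<close> covers the case
      \<open>N = 0\<close>.\<close>
    have "cmod (\<integral>z. complex_of_real (g z) * f z \<partial>torus_measure) \<le> \<epsilon> / (N + 1) * N"
      using that N by (intro \<open>\<And>\<epsilon>. \<epsilon> > 0 \<Longrightarrow> _ \<le> \<epsilon> * N\<close>) simp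
    also have "\<dots> \<le> \<epsilon>"
      using that N by (simp add: field_simps)
    finally show ?thesis
      by simp
  qed
  then have "cmod (\<integral>z. complex_of_real (g z) * f z \<partial>torus_measure) \<le> 0"
    by (rule field_le_epsilon)
  then show ?thesis
    by simp
qed

lemma annihilates_closed:
  assumes f: "annihilates f" and "closed C"
  shows "(LINT z:C|torus_measure. f z) = 0"
\<comment> \<open>\<open>infdist\<close> to the empty set is 0, so the tent functions below would
  tend to 1 instead of to the indicator.\<close>
proof (cases "C = {}")
  case False
  have fi: "integrable torus_measure f" and [measurable]: "f \<in> borel_measurable torus_measure" "C \<in> sets borel"
    using assms by (auto simp: annihilates_def)
  define g where "g n z = max 0 (1 - real n * infdist z C)" for n z
  have cont: "continuous_on UNIV (g n)" for n
    unfolding g_def by (intro continuous_intros)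
  then have [measurable]: "g n \<in> borel_measurable borel" for n
    by (rule borel_measurable_continuous_onI)
  have lim: "(\<lambda>n. g n z) \<longlonglongrightarrow> indicator C z" for z
  proof (cases "z \<in> C")
    case True
    then show ?thesis
      by (simp add: g_def)
  next
    case zC: False
    then have pos: "infdist z C > 0"
      using infdist_pos_not_in_closed[OF \<open>closed C\<close> False] by simp
    obtain m :: nat where m: "1 / infdist z C < real m"
      using reals_Archimedean2 by blast
    have "\<forall>\<^sub>F n in sequentially. g n z = 0"
      using eventually_ge_at_top[of m]
    proof eventually_elim
      case (elim n)
      then have "1 / infdist z C < real n"
        using m by linarith
      then show ?case
        using pos by (simp add: g_def field_simps)
    qed
    then show ?thesis
      using zC by (simp add: tendsto_eventually)
  qed
  have "(\<lambda>n. \<integral>z. complex_of_real (g n z) * f z \<partial>torus_measure) \<longlonglongrightarrow> (\<integral>z. indicator C z *\<^sub>R f z \<partial>torus_measure)"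
  proof (rule integral_dominated_convergence[where w="\<lambda>z. cmod (f z)"])
    show "AE z in torus_measure. (\<lambda>n. complex_of_real (g n z) * f z) \<longlonglongrightarrow> indicator C z *\<^sub>R f z"
      unfolding scaleR_conv_of_real by (intro always_eventually allI tendsto_intros lim)
    have "\<bar>g n z\<bar> \<le> 1" for n z
      using infdist_nonneg[of z C] by (auto simp: g_def)
    then show "AE z in torus_measure. norm (complex_of_real (g n z) * f z) \<le> cmod (f z)" for n
      by (intro always_eventually allI) (simp add: norm_mult mult_left_le_one_le)
  qed (use fi in \<open>auto, measurable\<close>)
  then show ?thesis
    by (simp add: annihilates_continuous[OF f cont] set_lebesgue_integral_def LIMSEQ_const_iff)
qed (simp add: set_lebesgue_integral_def)

text \<open>Closed sets form an intersection-stable generator of the Borel sets; for complements the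
  integral over the whole space vanishes too.\<close>

lemma annihilates_borel:
  assumes f: "annihilates f" and "A \<in> sets borel"
  shows "(LINT z:A|torus_measure. f z) = 0"
proof -
  have fi: "integrable torus_measure f" and [measurable]: "f \<in> borel_measurable torus_measure"
    using assms by (auto simp: annihilates_def)
  have si: "set_integrable torus_measure A f" if "A \<in> sets borel" for A
    unfolding set_integrable_def using fi that by (intro integrable_mult_indicator) auto
  have total: "(LINT z:UNIV|torus_measure. f z) = 0"
    by (rule annihilates_closed[OF f]) simp
  have "Int_stable (Collect closed :: (complex \<times> complex) set set)"
    by (auto simp: Int_stable_def)
  moreover have "Collect closed \<subseteq> Pow (UNIV :: (complex \<times> complex) set)"
    by simp
  moreover have "A \<in> sigma_sets UNIV (Collect closed)"
    using assms(2) by (simp add: borel_eq_closed)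
  ultimately show ?thesis
  proof (induction A rule: sigma_sets_induct_disjoint)
    case (basic C)
    then show ?case
      by (simp add: annihilates_closed[OF f])
  next
    case empty
    then show ?case
      by (simp add: set_lebesgue_integral_def)
  next
    case (compl A)
    then have A: "A \<in> sets borel"
      by (simp add: borel_eq_closed)
    have "(LINT z:(UNIV - A)|torus_measure. f z) + (LINT z:A|torus_measure. f z) = (LINT z:UNIV|torus_measure. f z)"
      using si[of "UNIV - A"] si[OF A] A by (subst set_integral_Un[symmetric]) auto
    then show ?case
      using compl total by simp
  next
    case (union A)
    then have A: "A i \<in> sets borel" for i
      by (auto simp: borel_eq_closed)
    have "(LINT z:(\<Union>i. A i)|torus_measure. f z) = (\<Sum>i. LINT z:(A i)|torus_measure. f z)"
      using union A by (intro lebesgue_integral_countable_add si) (auto simp: disjoint_family_on_def)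
    then show ?case
      using union by simp
  qed
qed

lemma annihilates_Re_le_0:
  assumes f: "annihilates f"
  shows "AE z in torus_measure. Re (f z) \<le> 0"
proof -
  have fi: "integrable torus_measure f" and [measurable]: "f \<in> borel_measurable torus_measure"
    using assms by (auto simp: annihilates_def)
  define A where "A = {z. Re (f z) > 0}"
  have [measurable]: "A \<in> sets borel"
  proof -
    have "{z \<in> space torus_measure. Re (f z) > 0} \<in> sets torus_measure"
      by measurable
    then show ?thesis
      by (simp add: A_def)
  qed
  have i: "integrable torus_measure (\<lambda>z. indicator A z *\<^sub>R f z)"
    using fi by (intro integrable_mult_indicator) auto
  have "(\<integral>z. Re (indicator A z *\<^sub>R f z) \<partial>torus_measure) = 0"
    using annihilates_borel[OF f, of A] by (subst integral_Re[OF i]) (simp add: set_lebesgue_integral_def)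
  moreover have "integrable torus_measure (\<lambda>z. Re (indicator A z *\<^sub>R f z))"
    by (rule integrable_Re[OF i])
  ultimately have "AE z in torus_measure. Re (indicator A z *\<^sub>R f z) = 0"
    by (subst (asm) integral_nonneg_eq_0_iff_AE) (auto simp: A_def indicator_def)
  then show ?thesis
    by eventually_elim (auto simp: A_def indicator_def split: if_splits)
qed

theorem torus_Fourier_unique:
  assumes f: "f \<in> l2 torus_measure" and "\<And>k l. l2_inner torus_measure f (monomial k l) = 0"
  shows "AE z in torus_measure. f z = 0"
proof -
  have [measurable]: "f \<in> borel_measurable torus_measure"
    using f by (rule l2D)
  have "(\<integral>z. f z * monomial k l z \<partial>torus_measure) = l2_inner torus_measure f (monomial (-k) (-l))" for k l
    unfolding l2_inner_def
  proof (rule integral_cong_AE)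
    show "AE z in torus_measure. f z * monomial k l z = f z * cnj (monomial (-k) (-l) z)"
      using cnj_monomial[of "-k" "-l"] by eventually_elim simp
  qed measurable
  then have f0: "annihilates f"
    using assms torus.l2_integrable[OF f] by (simp add: annihilates_def)
  \<comment> \<open>The factors 1, -1, i and -i bound the real and imaginary parts from both
    sides.\<close>
  note annihilates_Re_le_0[OF annihilates_scale[OF f0, of 1]] annihilates_Re_le_0[OF annihilates_scale[OF f0, of "-1"]]
    annihilates_Re_le_0[OF annihilates_scale[OF f0, of \<i>]] annihilates_Re_le_0[OF annihilates_scale[OF f0, of "-\<i>"]]
  then show ?thesis
    by eventually_elim (simp add: complex_eq_iff)
qed

section \<open>Orthonormal bases of the spaces on the torus and its symmetrization\<close>

lemma Jac_monomial: "Jac z = monomial 1 0 z - monomial 0 1 z"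
  by (simp add: Jac_def monomial_def)

lemma Jac_measurable [measurable]: "Jac \<in> borel_measurable borel"
  unfolding Jac_def[abs_def] by measurable

lemma Jac_norm_sq: "Jac_norm\<^sup>2 = 2"
proof -
  have one: "(l2_norm torus_measure (monomial k l))\<^sup>2 = 1" for k l
  proof -
    have "complex_of_real ((l2_norm torus_measure (monomial k l))\<^sup>2) = of_real 1"
      by (simp only: l2_inner_self[symmetric] inner_monomial) simp
    then show ?thesis
      by (simp only: of_real_eq_iff)
  qed
  have "Jac = (\<lambda>z. monomial 1 0 z - monomial 0 1 z)"
    by (simp add: Jac_monomial fun_eq_iff)
  then show ?thesis
    using l2_norm_diff_sq[OF monomial_l2[of 1 0] monomial_l2[of 0 1]]
    by (simp add: Jac_norm_def one inner_monomial)
qed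

lemma Jac_norm_eq: "Jac_norm = sqrt 2"
  using Jac_norm_sq by (metis Jac_norm_def l2_norm_nonneg real_sqrt_unique)

lemma sym_map_measurable [measurable]: "sym_map \<in> borel_measurable borel"
  unfolding sym_map_def[abs_def] by (intro borel_measurable_continuous_onI continuous_intros)

lemma sets_nu [simp]: "sets nu = sets borel" and space_nu [simp]: "space nu = UNIV"
  by (simp_all add: nu_def)

lemma sets_bG [simp, measurable_cong]: "sets bG = sets borel"
  by (simp add: bG_def)

lemma space_bG [simp]: "space bG = UNIV"
  using sets_eq_imp_space_eq[OF sets_bG] by simp

text \<open>The factor 1 / ||J||^2 = 1/2 is absorbed into the density, which makes \<open>U\<close>
  visibly isometric.\<close>

lemma bG_eq: "bG = distr (density torus_measure (\<lambda>z. ennreal ((cmod (Jac z))\<^sup>2 / 2))) borel sym_map"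
proof (rule measure_eqI)
  fix A assume "A \<in> sets bG"
  then have [measurable]: "A \<in> sets borel"
    by simp
  have [measurable]: "sym_map -` A \<in> sets borel"
    using measurable_sets[OF sym_map_measurable, of A] by simp
  have "emeasure bG A = ennreal (1 / 2) * (\<integral>\<^sup>+z. ennreal ((cmod (Jac z))\<^sup>2) * indicator (sym_map -` A) z \<partial>torus_measure)"
    by (simp add: bG_def nu_def Jac_norm_sq emeasure_distr emeasure_density)
  also have "\<dots> = (\<integral>\<^sup>+z. ennreal (1 / 2) * (ennreal ((cmod (Jac z))\<^sup>2) * indicator (sym_map -` A) z) \<partial>torus_measure)"
    by (subst nn_integral_cmult) simp_all
  also have "\<dots> = (\<integral>\<^sup>+z. ennreal ((cmod (Jac z))\<^sup>2 / 2) * indicator (sym_map -` A) z \<partial>torus_measure)"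
  proof (intro nn_integral_cong)
    fix z
    have "ennreal (1 / 2) * ennreal ((cmod (Jac z))\<^sup>2) = ennreal ((cmod (Jac z))\<^sup>2 / 2)"
      by (subst ennreal_mult[symmetric]) auto
    then show "ennreal (1 / 2) * (ennreal ((cmod (Jac z))\<^sup>2) * indicator (sym_map -` A) z)
        = ennreal ((cmod (Jac z))\<^sup>2 / 2) * indicator (sym_map -` A) z"
      by (simp only: mult.assoc[symmetric])
  qed
  also have "\<dots> = emeasure (distr (density torus_measure (\<lambda>z. ennreal ((cmod (Jac z))\<^sup>2 / 2))) borel sym_map) A"
    by (simp add: emeasure_distr emeasure_density)
  finally show "emeasure bG A = emeasure (distr (density torus_measure (\<lambda>z. ennreal ((cmod (Jac z))\<^sup>2 / 2))) borel sym_map) A" .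
qed simp

lemma integral_bG:
  fixes f :: "complex \<times> complex \<Rightarrow> 'b :: {banach, second_countable_topology}"
  assumes [measurable]: "f \<in> borel_measurable borel"
  shows "(\<integral>w. f w \<partial>bG) = (\<integral>z. ((cmod (Jac z))\<^sup>2 / 2) *\<^sub>R f (sym_map z) \<partial>torus_measure)"
    and "integrable bG f \<longleftrightarrow> integrable torus_measure (\<lambda>z. ((cmod (Jac z))\<^sup>2 / 2) *\<^sub>R f (sym_map z))"
  unfolding bG_eq by (simp_all add: integral_distr integral_density integrable_distr_eq integrable_density)

text \<open>The density vanishes exactly on the diagonal, hence the guard
  \<open>Jac z \<noteq> 0\<close>.\<close>

lemma AE_bG_iff:
  assumes [measurable]: "Measurable.pred borel P"
  shows "(AE w in bG. P w) \<longleftrightarrow> (AE z in torus_measure. Jac z \<noteq> 0 \<longrightarrow> P (sym_map z))"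
  unfolding bG_eq by (subst AE_distr_iff) (simp_all add: AE_density)

lemma AE_nu_iff_bG:
  assumes "{w. P w} \<in> sets borel"
  shows "(AE w in nu. P w) \<longleftrightarrow> (AE w in bG. P w)"
proof -
  have [measurable]: "Measurable.pred borel P"
    using assms by (simp add: pred_def)
  show ?thesis
    unfolding AE_bG_iff[OF \<open>Measurable.pred borel P\<close>] nu_def
    by (subst AE_distr_iff) (simp_all add: AE_density)
qed

interpretation bG: finite_measure bG
proof (rule finite_measureI)
  have "AE z in torus_measure. (cmod (Jac z))\<^sup>2 / 2 \<le> 2"
    using AE_torus
  proof eventually_elim
    case (elim z)
    then have "cmod (Jac z) \<le> 2"
      using norm_triangle_ineq4[of "fst z" "snd z"] by (simp add: Jac_def)
    then show ?case
      using power_mono[of "cmod (Jac z)" 2 2] by simp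
  qed
  then have "(\<integral>\<^sup>+z. ennreal ((cmod (Jac z))\<^sup>2 / 2) \<partial>torus_measure) \<le> (\<integral>\<^sup>+z. 2 \<partial>torus_measure)"
    by (intro nn_integral_mono_AE) (auto elim!: eventually_mono simp flip: ennreal_numeral intro: ennreal_leI)
  also have "\<dots> < \<infinity>"
    using torus.emeasure_finite[of UNIV] by (simp add: ennreal_mult_eq_top_iff less_top[symmetric])
  finally show "emeasure bG (space bG) \<noteq> \<infinity>"
    by (simp add: bG_eq emeasure_distr emeasure_density)
qed

section \<open>The map \<open>U\<close> and antisymmetric functions\<close>

lemma U_measurable:
  assumes [measurable]: "f \<in> borel_measurable borel"
  shows "U f \<in> borel_measurable borel"
  unfolding U_def[abs_def] by measurable

lemma cmod_U_sq: "(cmod (U f z))\<^sup>2 = (cmod (Jac z))\<^sup>2 / 2 * (cmod (f (sym_map z)))\<^sup>2"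
  using Jac_norm_sq by (simp add: U_def norm_mult power_mult_distrib norm_divide power_divide)

lemma l2_bG_measurable: "f \<in> l2 bG \<Longrightarrow> f \<in> borel_measurable borel"
  using measurable_cong_sets[OF sets_bG refl] by (auto dest: l2D)

lemma l2_bG_iff: "f \<in> l2 bG \<longleftrightarrow> f \<in> borel_measurable borel \<and> U f \<in> l2 torus_measure"
proof (cases "f \<in> borel_measurable borel")
  case True
  then have [measurable]: "f \<in> borel_measurable borel" "U f \<in> borel_measurable borel"
    by (auto intro: U_measurable)
  have "integrable bG (\<lambda>w. (cmod (f w))\<^sup>2) \<longleftrightarrow> integrable torus_measure (\<lambda>z. (cmod (U f z))\<^sup>2)"
    by (subst integral_bG(2)) (simp_all add: cmod_U_sq)
  then show ?thesis
    by (simp add: l2_def measurable_cong_sets[OF sets_bG refl] measurable_cong_sets[OF sets_torus refl])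
qed (auto dest: l2_bG_measurable)

lemma U_l2: "f \<in> l2 bG \<Longrightarrow> U f \<in> l2 torus_measure"
  by (simp add: l2_bG_iff)

lemma inner_U:
  assumes f: "f \<in> l2 bG" and g: "g \<in> l2 bG"
  shows "l2_inner torus_measure (U f) (U g) = l2_inner bG f g"
proof -
  have [measurable]: "f \<in> borel_measurable borel" "g \<in> borel_measurable borel"
    using f g by (auto intro: l2_bG_measurable)
  have "U f z * cnj (U g z) = ((cmod (Jac z))\<^sup>2 / 2) *\<^sub>R (f (sym_map z) * cnj (g (sym_map z)))" for z
  proof -
    have "complex_of_real Jac_norm * complex_of_real Jac_norm = 2"
      using Jac_norm_sq by (simp add: power2_eq_square flip: of_real_mult)
    then show ?thesis
      unfolding U_def scaleR_conv_of_real of_real_divide complex_norm_square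
      by (simp add: field_simps)
  qed
  then show ?thesis
    by (simp add: l2_inner_def integral_bG(1))
qed

lemma norm_U: "f \<in> l2 bG \<Longrightarrow> l2_norm torus_measure (U f) = l2_norm bG f"
proof -
  assume f: "f \<in> l2 bG"
  have "complex_of_real ((l2_norm torus_measure (U f))\<^sup>2) = of_real ((l2_norm bG f)\<^sup>2)"
    using inner_U[OF f f] by (simp only: l2_inner_self)
  then show ?thesis
    by (simp only: of_real_eq_iff) simp
qed

lemma U_add: "U (\<lambda>w. f w + g w) = (\<lambda>z. U f z + U g z)"
  and U_scale: "U (\<lambda>w. c * f w) = (\<lambda>z. c * U f z)"
  by (simp_all add: U_def fun_eq_iff algebra_simps)

lemma torus_swap: "distr torus_measure torus_measure prod.swap = torus_measure"
proof -
  have "prod.swap = (\<lambda>(x, y). (y, x) :: complex \<times> complex)"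
    by (auto simp: fun_eq_iff)
  then show ?thesis
    unfolding torus_measure_def using torus.distr_pair_swap by simp
qed

lemma swap_measurable [measurable]: "prod.swap \<in> torus_measure \<rightarrow>\<^sub>M torus_measure"
proof -
  have "(prod.swap :: complex \<times> complex \<Rightarrow> _) \<in> borel_measurable borel"
    unfolding prod.swap_def[abs_def] by (intro borel_measurable_continuous_onI continuous_intros)
  then show ?thesis
    by (simp add: measurable_cong_sets[OF sets_torus sets_torus])
qed

lemma l2_swap:
  assumes f: "f \<in> l2 torus_measure"
  shows "(\<lambda>z. f (prod.swap z)) \<in> l2 torus_measure"
    and "l2_inner torus_measure (\<lambda>z. f (prod.swap z)) (monomial k l) = l2_inner torus_measure f (monomial l k)"
proof -
  have [measurable]: "f \<in> borel_measurable torus_measure"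
    using f by (rule l2D)
  have "integrable (distr torus_measure torus_measure prod.swap) (\<lambda>x. (cmod (f x))\<^sup>2)"
    using l2D(2)[OF f] by (simp add: torus_swap)
  then have "integrable torus_measure (\<lambda>x. (cmod (f (prod.swap x)))\<^sup>2)"
    by (subst (asm) integrable_distr_eq) simp_all
  then show "(\<lambda>z. f (prod.swap z)) \<in> l2 torus_measure"
    by (simp add: l2_def)
  have "l2_inner torus_measure f (monomial l k)
      = (\<integral>z. f z * cnj (monomial l k z) \<partial>distr torus_measure torus_measure prod.swap)"
    by (simp add: l2_inner_def torus_swap)
  also have "\<dots> = (\<integral>z. f (prod.swap z) * cnj (monomial l k (prod.swap z)) \<partial>torus_measure)"
    by (rule integral_distr) measurable
  also have "\<dots> = l2_inner torus_measure (\<lambda>z. f (prod.swap z)) (monomial k l)"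
    by (simp add: l2_inner_def monomial_def mult.commute)
  finally show "l2_inner torus_measure (\<lambda>z. f (prod.swap z)) (monomial k l) = l2_inner torus_measure f (monomial l k)" ..
qed

text \<open>Swapping the variables swaps the Fourier indices, and the coefficients determine the
  function.\<close>

lemma L2_anti_iff:
  assumes f: "f \<in> l2 torus_measure"
  shows "f \<in> L2_anti \<longleftrightarrow>
    (\<forall>k l. l2_inner torus_measure f (monomial k l) = - l2_inner torus_measure f (monomial l k))"
proof -
  have fs: "(\<lambda>z. f z + f (prod.swap z)) \<in> l2 torus_measure"
    using f by (intro l2_add l2_swap)
  have "f \<in> L2_anti \<longleftrightarrow> (AE z in torus_measure. f z + f (prod.swap z) = 0)"
    using f by (simp add: L2_anti_def eq_neg_iff_add_eq_0)
  also have "\<dots> \<longleftrightarrow> (\<forall>k l. l2_inner torus_measure (\<lambda>z. f z + f (prod.swap z)) (monomial k l) = 0)"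
    using torus_Fourier_unique[OF fs] l2_inner_AE_0[OF fs monomial_l2] by blast
  also have "\<dots> \<longleftrightarrow> (\<forall>k l. l2_inner torus_measure f (monomial k l) = - l2_inner torus_measure f (monomial l k))"
    using f by (simp add: l2_inner_add_left l2_swap monomial_l2 eq_neg_iff_add_eq_0)
  finally show ?thesis .
qed

lemma U_L2_anti: "f \<in> l2 bG \<Longrightarrow> U f \<in> L2_anti"
  by (simp add: L2_anti_def U_l2) (simp add: U_def Jac_def sym_map_def prod.swap_def algebra_simps)

text \<open>\<open>hsym j\<close> is the complete homogeneous symmetric polynomial of degree \<open>j - 1\<close> in \<open>z\<^sub>1, z\<^sub>2\<close>,
  written in the elementary symmetric functions \<open>s\<close> and \<open>p\<close>.\<close>

fun hsym :: "nat \<Rightarrow> complex \<times> complex \<Rightarrow> complex" where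
  "hsym 0 w = 0"
| "hsym (Suc 0) w = 1"
| "hsym (Suc (Suc j)) w = fst w * hsym (Suc j) w - snd w * hsym j w"

text \<open>Both \<open>fst z\<close> and \<open>snd z\<close> are roots of t^2 - s t + p, so the
  differences of their powers obey the recurrence of \<open>hsym\<close>.\<close>

lemma Jac_hsym: "Jac z * hsym j (sym_map z) = fst z ^ j - snd z ^ j"
proof (induction j "sym_map z" rule: hsym.induct)
  case (3 j)
  have "Jac z * hsym (Suc (Suc j)) (sym_map z)
      = (fst z + snd z) * (Jac z * hsym (Suc j) (sym_map z)) - fst z * snd z * (Jac z * hsym j (sym_map z))"
    by (simp add: sym_map_def algebra_simps)
  also have "\<dots> = fst z ^ Suc (Suc j) - snd z ^ Suc (Suc j)"
    by (simp add: 3 algebra_simps)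
  finally show ?case .
qed (simp_all add: Jac_def)

lemma hsym_measurable [measurable]: "hsym j \<in> borel_measurable borel"
proof (induction j rule: induct_nat_012)
  case (ge2 j)
  then show ?case
    by (simp add: fun_eq_iff[of "hsym (Suc (Suc j))", THEN iffD2])
qed simp_all

text \<open>In the notation of the overview this is p^i h_j; the successor skips
  \<open>hsym 0 = 0\<close>. Negative i makes sense because p has modulus 1 almost
  everywhere.\<close>

definition ebas :: "int \<times> nat \<Rightarrow> complex \<times> complex \<Rightarrow> complex" where
  "ebas a w = snd w powi fst a * hsym (Suc (snd a)) w"

lemma ebas_measurable [measurable]: "ebas a \<in> borel_measurable borel"
  unfolding ebas_def[abs_def] by measurable

text \<open>The value of \<open>1 / Jac_norm\<close>, which is also the factor normalising a
  difference of two orthonormal monomials.\<close>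

definition rt :: complex where
  "rt = of_real (1 / sqrt 2)"

lemma rt: "rt * rt = 1 / 2" "cnj rt = rt" "rt \<noteq> 0"
proof -
  have "rt * rt = of_real (1 / sqrt 2 * (1 / sqrt 2))"
    unfolding rt_def by (rule of_real_mult[symmetric])
  then show "rt * rt = 1 / 2"
    by simp
qed (simp_all add: rt_def)

lemma U_ebas: "U (ebas (i, j)) z = rt * ((fst z * snd z) powi i * (fst z ^ Suc j - snd z ^ Suc j))"
proof -
  have "U (ebas (i, j)) z = rt * (snd (sym_map z) powi i * (Jac z * hsym (Suc j) (sym_map z)))"
    unfolding U_def ebas_def Jac_norm_eq rt_def by simp
  then show ?thesis
    unfolding Jac_hsym by (simp add: sym_map_def)
qed

lemma U_ebas_AE:
  "AE z in torus_measure. U (ebas (i, j)) z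
    = rt * (monomial (i + int j + 1) i z - monomial i (i + int j + 1) z)"
  using AE_torus
proof eventually_elim
  case (elim z)
  then have "fst z \<noteq> 0" "snd z \<noteq> 0"
    by auto
  then have "fst z powi (i + int j + 1) = fst z powi i * fst z ^ Suc j"
    "snd z powi (i + int j + 1) = snd z powi i * snd z ^ Suc j"
    by (simp_all add: power_int_add)
  then show ?case
    by (simp add: U_ebas monomial_def power_int_mult_distrib algebra_simps)
qed

lemma monomial_diff_l2: "(\<lambda>z. c * (monomial k l z - monomial k' l' z)) \<in> l2 torus_measure"
  by (intro l2_scale l2_diff monomial_l2)

lemma ebas_l2: "ebas a \<in> l2 bG"
proof -
  obtain i j where a: "a = (i, j)"
    by force
  have "U (ebas a) \<in> l2 torus_measure"
  proof -
    let ?g = "\<lambda>z. rt * (monomial (i + int j + 1) i z - monomial i (i + int j + 1) z)"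
    have [measurable]: "U (ebas a) \<in> borel_measurable borel"
      by (intro U_measurable ebas_measurable)
    have "integrable torus_measure (\<lambda>z. (cmod (?g z))\<^sup>2)"
      by (rule l2D(2)[OF monomial_diff_l2])
    then have "integrable torus_measure (\<lambda>z. (cmod (U (ebas a) z))\<^sup>2)"
    proof (rule integrable_cong_AE_imp)
      show "AE z in torus_measure. (cmod (?g z))\<^sup>2 = (cmod (U (ebas a) z))\<^sup>2"
        using U_ebas_AE[of i j] by eventually_elim (simp add: a)
    qed measurable
    then show ?thesis
      by (simp add: l2_def)
  qed
  then show ?thesis
    by (simp add: l2_bG_iff)
qed

lemma inner_U_ebas:
  assumes f: "f \<in> l2 torus_measure"
  shows "l2_inner torus_measure f (U (ebas (i, j))) = rt *
    (l2_inner torus_measure f (monomial (i + int j + 1) i) - l2_inner torus_measure f (monomial i (i + int j + 1)))"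
proof -
  have "l2_inner torus_measure f (U (ebas (i, j))) = l2_inner torus_measure f
      (\<lambda>z. rt * (monomial (i + int j + 1) i z - monomial i (i + int j + 1) z))"
    using f U_ebas_AE[of i j] by (intro l2_inner_cong_AE U_l2 ebas_l2 monomial_diff_l2) auto
  then show ?thesis
    using f by (simp add: l2_inner_scale_right l2_inner_diff_right monomial_l2 rt)
qed

lemma inner_anti_ebas:
  assumes f: "f \<in> L2_anti"
  shows "l2_inner torus_measure f (U (ebas (i, j))) = 2 * rt * l2_inner torus_measure f (monomial (i + int j + 1) i)"
proof -
  have f2: "f \<in> l2 torus_measure"
    using f by (simp add: L2_anti_def)
  have "l2_inner torus_measure f (monomial i (i + int j + 1)) = - l2_inner torus_measure f (monomial (i + int j + 1) i)"
    using f L2_anti_iff[OF f2] by blast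
  then show ?thesis
    unfolding inner_U_ebas[OF f2] by simp
qed

text \<open>The coefficients of an antisymmetric function vanish on the diagonal and are determined
  by those with k > l; each such pair is (i + j + 1, i) for exactly one basis index. The symmetric
  predicate \<open>P\<close> selects the coefficients concerned: all of them for totality, those
  with a negative index for the Hardy space.\<close>

lemma L2_anti_coeff_0I:
  assumes f: "f \<in> L2_anti" and P: "\<And>k l. P k l \<Longrightarrow> P l k"
    and 0: "\<And>i j. P (i + int j + 1) i \<Longrightarrow> l2_inner torus_measure f (U (ebas (i, j))) = 0"
    and "P k l"
  shows "l2_inner torus_measure f (monomial k l) = 0"
proof -
  let ?F = "\<lambda>k l. l2_inner torus_measure f (monomial k l)"
  have f2: "f \<in> l2 torus_measure"
    using f by (simp add: L2_anti_def)
  have anti: "?F k l = - ?F l k" for k l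
    using f L2_anti_iff[OF f2] by blast
  have gt: "?F k l = 0" if "l < k" "P k l" for k l
  proof -
    have k: "k = l + int (nat (k - l - 1)) + 1"
      using that by simp
    then have "2 * rt * ?F k l = 0"
      using inner_anti_ebas[OF f, of l "nat (k - l - 1)"] 0[of l "nat (k - l - 1)"] that(2) by simp
    then show ?thesis
      using rt by simp
  qed
  consider "l < k" | "k < l" | "k = l"
    by linarith
  then show ?thesis
  proof cases
    case 2
    then show ?thesis
      using gt[OF _ P[OF \<open>P k l\<close>]] anti[of k l] by simp
  next
    case 3
    then show ?thesis
      using anti[of k k]
      by (metis add_cancel_right_right add.right_inverse mult_2 mult_eq_0_iff zero_neq_numeral)
  qed (use gt \<open>P k l\<close> in auto)
qed

lemma ebas_orth: "l2_inner bG (ebas a) (ebas b) = (if a = b then 1 else 0)"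
proof -
  obtain i j i' j' where ab: "a = (i, j)" "b = (i', j')"
    by (metis surj_pair)
  let ?k = "i' + int j' + 1"
  have *: "l2_inner torus_measure (U (ebas (i, j))) (monomial k l)
      = rt * ((if i + int j + 1 = k \<and> i = l then 1 else 0) - (if i = k \<and> i + int j + 1 = l then 1 else 0))" for k l
  proof -
    have "l2_inner torus_measure (U (ebas (i, j))) (monomial k l) = cnj (l2_inner torus_measure (monomial k l) (U (ebas (i, j))))"
      by (rule l2_inner_commute)
    also have "\<dots> = rt * ((if i + int j + 1 = k \<and> i = l then 1 else 0) - (if i = k \<and> i + int j + 1 = l then 1 else 0))"
      unfolding inner_U_ebas[OF monomial_l2] inner_monomial by (auto simp: rt)
    finally show ?thesis .
  qed
  have "l2_inner bG (ebas a) (ebas b) = l2_inner torus_measure (U (ebas (i, j))) (U (ebas (i', j')))"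
    by (simp add: inner_U ebas_l2 ab)
  also have "\<dots> = 2 * rt * l2_inner torus_measure (U (ebas (i, j))) (monomial ?k i')"
    by (intro inner_anti_ebas U_L2_anti ebas_l2)
  also have "\<dots> = (if a = b then 1 else 0)"
  proof -
    have r: "2 * rt * rt = 1"
      by (simp only: mult.assoc rt(1)) simp
    show ?thesis
      unfolding * mult.assoc[symmetric] r by (auto simp: ab)
  qed
  finally show ?thesis .
qed

lemma ebas_total:
  assumes f: "f \<in> l2 bG" and "\<And>a. l2_inner bG f (ebas a) = 0"
  shows "AE w in bG. f w = 0"
proof -
  have [measurable]: "f \<in> borel_measurable borel"
    using f by (rule l2_bG_measurable)
  have "AE z in torus_measure. U f z = 0"
  proof (rule torus_Fourier_unique[OF U_l2[OF f]])
    show "l2_inner torus_measure (U f) (monomial k l) = 0" for k l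
      using assms by (intro L2_anti_coeff_0I[where P="\<lambda>_ _. True"] U_L2_anti) (auto simp: inner_U ebas_l2)
  qed
  then have "AE z in torus_measure. Jac z \<noteq> 0 \<longrightarrow> f (sym_map z) = 0"
    by eventually_elim (auto simp: U_def Jac_norm_eq)
  then show ?thesis
    by (subst AE_bG_iff) auto
qed

interpretation LG: l2_basis bG "l2 bG" "{}" ebas
  by unfold_locales (auto simp: ebas_l2 ebas_orth intro: ebas_total)

text \<open>In the pair (i + j + 1, i) the smaller exponent is i, so the condition on both Fourier
  indices collapses to i < 0.\<close>

lemma H2_G_eq: "H2_G = {f \<in> l2 bG. \<forall>g \<in> ebas ` ({..<0} \<times> UNIV). l2_inner bG f g = 0}"
proof -
  have "(\<forall>k l. k < 0 \<or> l < 0 \<longrightarrow> fourier_coeff (U f) k l = 0) \<longleftrightarrow>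
      (\<forall>g \<in> ebas ` ({..<0} \<times> UNIV). l2_inner bG f g = 0)" if f: "f \<in> l2 bG" for f
  proof
    assume *: "\<forall>k l. k < 0 \<or> l < 0 \<longrightarrow> fourier_coeff (U f) k l = 0"
    show "\<forall>g \<in> ebas ` ({..<0} \<times> UNIV). l2_inner bG f g = 0"
      using * by (auto simp: inner_U[OF f ebas_l2, symmetric] inner_U_ebas[OF U_l2[OF f]] fourier_coeff_eq)
  next
    assume *: "\<forall>g \<in> ebas ` ({..<0} \<times> UNIV). l2_inner bG f g = 0"
    show "\<forall>k l. k < 0 \<or> l < 0 \<longrightarrow> fourier_coeff (U f) k l = 0"
      unfolding fourier_coeff_eq
      using * by (intro allI impI L2_anti_coeff_0I[where P="\<lambda>k l. k < 0 \<or> l < 0"] U_L2_anti f)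
        (auto simp: inner_U[OF f ebas_l2])
  qed
  then show ?thesis
    unfolding H2_G_def by blast
qed

definition hbas :: "nat \<times> nat \<Rightarrow> complex \<times> complex \<Rightarrow> complex" where
  "hbas a = ebas (int (fst a), snd a)"

interpretation HG: l2_basis bG H2_G "ebas ` ({..<0} \<times> UNIV)" hbas
proof unfold_locales
  show "ebas ` ({..<0} \<times> UNIV) \<subseteq> l2 bG"
    using ebas_l2 by auto
  show "hbas a \<in> H2_G" for a
    by (auto simp: H2_G_eq hbas_def ebas_l2 ebas_orth)
  show "l2_inner bG (hbas a) (hbas b) = (if a = b then 1 else 0)" for a b
    by (simp add: hbas_def ebas_orth prod_eq_iff)
  fix f assume f: "f \<in> H2_G" "\<And>a. l2_inner bG f (hbas a) = 0"
  show "AE w in bG. f w = 0"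
  proof (rule ebas_total)
    show "f \<in> l2 bG"
      using f(1) by (simp add: H2_G_def)
    fix a :: "int \<times> nat"
    show "l2_inner bG f (ebas a) = 0"
    proof (cases "fst a < 0")
      case True
      then have "ebas a \<in> ebas ` ({..<0} \<times> UNIV)"
        by (intro imageI) (auto simp: mem_Times_iff)
      then show ?thesis
        using f(1) unfolding H2_G_eq by blast
    next
      case False
      then show ?thesis
        using f(2)[of "(nat (fst a), snd a)"] by (simp add: hbas_def)
    qed
  qed
qed (rule H2_G_eq)

lemma U_H2_anti: "f \<in> H2_G \<Longrightarrow> U f \<in> H2_anti"
  by (simp add: H2_G_def H2_anti_def U_L2_anti)

text \<open>Antisymmetry, too, is written as orthogonality, namely to symmetrised monomials, so that
  \<open>H2_anti\<close> becomes an annihilator.\<close>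

definition anti_constraints :: "(complex \<times> complex \<Rightarrow> complex) set" where
  "anti_constraints = {monomial k l |k l. k < 0 \<or> l < 0} \<union> {(\<lambda>z. monomial k l z + monomial l k z) |k l. True}"

lemma H2_anti_eq: "H2_anti = {f \<in> l2 torus_measure. \<forall>g\<in>anti_constraints. l2_inner torus_measure f g = 0}"
proof -
  have "f \<in> H2_anti \<longleftrightarrow> (\<forall>g\<in>anti_constraints. l2_inner torus_measure f g = 0)" if f: "f \<in> l2 torus_measure" for f
  proof -
    have "f \<in> L2_anti \<longleftrightarrow> (\<forall>k l. l2_inner torus_measure f (\<lambda>z. monomial k l z + monomial l k z) = 0)"
      by (simp add: L2_anti_iff[OF f] l2_inner_add_right monomial_l2 f eq_neg_iff_add_eq_0)
    then show ?thesis
      unfolding H2_anti_def anti_constraints_def fourier_coeff_eq by blast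
  qed
  moreover have "f \<in> H2_anti \<Longrightarrow> f \<in> l2 torus_measure" for f
    by (simp add: H2_anti_def L2_anti_def)
  ultimately show ?thesis
    by blast
qed

interpretation HA: l2_basis torus_measure H2_anti anti_constraints "\<lambda>a. U (hbas a)"
proof unfold_locales
  show "anti_constraints \<subseteq> l2 torus_measure"
    by (auto simp: anti_constraints_def intro!: monomial_l2 l2_add)
  show "U (hbas a) \<in> H2_anti" for a
    by (intro U_H2_anti HG.e_H)
  show "l2_inner torus_measure (U (hbas a)) (U (hbas b)) = (if a = b then 1 else 0)" for a b
    by (simp add: inner_U HG.e_l2 HG.e_orth)
  fix f assume f: "f \<in> H2_anti" "\<And>a. l2_inner torus_measure f (U (hbas a)) = 0"
  have f': "f \<in> L2_anti" "f \<in> l2 torus_measure"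
    "\<And>k l. k < 0 \<or> l < 0 \<Longrightarrow> l2_inner torus_measure f (monomial k l) = 0"
    using f(1) by (auto simp: H2_anti_def L2_anti_def fourier_coeff_eq)
  show "AE w in torus_measure. f w = 0"
  proof (rule torus_Fourier_unique[OF f'(2)])
    show "l2_inner torus_measure f (monomial k l) = 0" for k l
    proof (rule L2_anti_coeff_0I[OF f'(1), where P="\<lambda>_ _. True"])
      fix i j
      show "l2_inner torus_measure f (U (ebas (i, j))) = 0"
        using f(2)[of "(nat i, j)"] f'(3)[of "i + int j + 1" i] inner_anti_ebas[OF f'(1), of i j]
        by (cases "i < 0") (simp_all add: hbas_def)
    qed simp_all
  qed
qed (rule H2_anti_eq)

section \<open>The shift operators\<close>

abbreviation sig_y :: "nat \<times> nat \<Rightarrow> nat \<times> nat" where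
  "sig_y \<equiv> \<lambda>a. (fst a, Suc (snd a))"

abbreviation sig_p :: "nat \<times> nat \<Rightarrow> nat \<times> nat" where
  "sig_p \<equiv> \<lambda>a. (Suc (fst a), snd a)"

lemma sig_y_funpow: "(sig_y ^^ n) a = (fst a, snd a + n)"
  by (induction n) auto

lemma sig_p_funpow: "(sig_p ^^ n) a = (fst a + n, snd a)"
  by (induction n) auto

lemma range_sig_y_funpow: "a \<in> range (sig_y ^^ n) \<longleftrightarrow> n \<le> snd a"
proof
  assume "n \<le> snd a"
  then have "a = (sig_y ^^ n) (fst a, snd a - n)"
    by (simp add: sig_y_funpow)
  then show "a \<in> range (sig_y ^^ n)"
    by (rule range_eqI)
qed (auto simp: sig_y_funpow)

lemma range_sig_p_funpow: "a \<in> range (sig_p ^^ n) \<longleftrightarrow> n \<le> fst a"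
proof
  assume "n \<le> fst a"
  then have "a = (sig_p ^^ n) (fst a - n, snd a)"
    by (simp add: sig_p_funpow)
  then show "a \<in> range (sig_p ^^ n)"
    by (rule range_eqI)
qed (auto simp: sig_p_funpow)

lemma sig_y_leaves: "\<forall>\<^sub>F n in sequentially. a \<notin> range (sig_y ^^ n)"
  using eventually_gt_at_top[of "snd a"] by eventually_elim (simp add: range_sig_y_funpow)

lemma sig_p_leaves: "\<forall>\<^sub>F n in sequentially. a \<notin> range (sig_p ^^ n)"
  using eventually_gt_at_top[of "fst a"] by eventually_elim (simp add: range_sig_p_funpow)

lemma U_hbas: "U (hbas (i, j)) = (\<lambda>z. rt * anti_basis i (Suc j) z)"
  by (simp add: fun_eq_iff hbas_def U_ebas anti_basis_def)

lemma anti_basis_eq: "anti_basis i (Suc j) = (\<lambda>z. (1 / rt) * U (hbas (i, j)) z)"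
  by (simp add: fun_eq_iff U_hbas rt)

text \<open>\<open>X\<close> is a choice, so an operator with the property must be exhibited. The
  shift of the orthonormal basis is one, after rescaling from \<open>U (hbas (i, j))\<close> to
  \<open>anti_basis i (Suc j)\<close>.\<close>

lemma X_spec: "bounded_op torus_measure H2_anti X \<and>
  (\<forall>i. \<forall>j\<ge>1. AE z in torus_measure. X (anti_basis i j) z = anti_basis i (j + 1) z)"
proof -
  obtain A where A: "HA.shift sig_y A"
    using HA.shift_exists[of sig_y] by (auto simp: inj_def)
  have bA: "bounded_op torus_measure H2_anti A"
    by (rule HA.shift_bounded_op[OF A])
  have "AE z in torus_measure. A (anti_basis i j) z = anti_basis i (j + 1) z" if "j \<ge> 1" for i j
  proof -
    obtain j' where j: "j = Suc j'"
      using \<open>j \<ge> 1\<close> by (cases j) auto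
    have "AE z in torus_measure. A (\<lambda>z. (1 / rt) * U (hbas (i, j')) z) z = (1 / rt) * A (U (hbas (i, j'))) z"
      using bA HA.e_H[of "(i, j')"] unfolding bounded_op_def by blast
    moreover have "AE z in torus_measure. A (U (hbas (i, j'))) z = U (hbas (i, Suc j')) z"
      using HA.shift_basis[OF A, of "(i, j')"] by simp
    ultimately show ?thesis
      unfolding j by eventually_elim (simp add: anti_basis_eq)
  qed
  then have "\<exists>A. bounded_op torus_measure H2_anti A \<and>
      (\<forall>i. \<forall>j\<ge>1. AE z in torus_measure. A (anti_basis i j) z = anti_basis i (j + 1) z)"
    using bA by blast
  then show ?thesis
    unfolding X_def by (rule someI_ex)
qed

lemma X_shift: "HA.shift sig_y X"
proof (rule HA.bounded_op_shift)
  show bX: "bounded_op torus_measure H2_anti X"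
    using X_spec ..
  show "inj sig_y"
    by (auto simp: inj_def)
  fix a :: "nat \<times> nat"
  obtain i j where a: "a = (i, j)"
    by force
  have "anti_basis i (Suc j) \<in> H2_anti"
    unfolding anti_basis_eq by (intro HA.H_scale HA.e_H)
  then have "AE z in torus_measure. X (\<lambda>z. rt * anti_basis i (Suc j) z) z = rt * X (anti_basis i (Suc j)) z"
    using bX unfolding bounded_op_def by blast
  moreover have "AE z in torus_measure. X (anti_basis i (Suc j)) z = anti_basis i (Suc j + 1) z"
    using X_spec by (metis le_add1 plus_1_eq_Suc)
  ultimately show "AE z in torus_measure. X (U (hbas a)) z = U (hbas (fst a, Suc (snd a))) z"
    unfolding a U_hbas by eventually_elim (simp add: U_hbas)
qed

lemma U_bdd_lin: "bdd_lin bG (l2 bG) torus_measure U"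
  unfolding bdd_lin_def by (auto simp: U_l2 U_add U_scale norm_U intro!: exI[of _ 1])

text \<open>\<open>U_adj\<close> is the adjoint on all of L^2(bG), so membership of
  \<open>Y f\<close> in the Hardy space has to be shown. The coefficients of \<open>Y f\<close> are
  those of \<open>X (U f)\<close>, and the ones with negative first index vanish.\<close>

lemma Y_shift: "HG.shift sig_y Y"
proof -
  have *: "Y f \<in> H2_G \<and> (\<forall>a. l2_inner bG (Y f) (hbas a) = l2_inner torus_measure (X (U f)) (U (hbas a)))"
    if f: "f \<in> H2_G" for f
  proof -
    have XU: "X (U f) \<in> H2_anti" "X (U f) \<in> l2 torus_measure" "X (U f) \<in> L2_anti"
      using HA.shiftD(2)[OF X_shift U_H2_anti[OF f]] HA.H_l2 by (auto simp: H2_anti_def)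
    have Yl2: "Y f \<in> l2 bG"
      unfolding Y_def U_adj_def by (rule LG.l2_adjoint(1)[OF U_bdd_lin XU(2)])
    have Yi: "l2_inner bG (Y f) g = l2_inner torus_measure (X (U f)) (U g)" if "g \<in> l2 bG" for g
      using LG.l2_adjoint(2)[OF U_bdd_lin XU(2) that]
      by (simp add: Y_def U_adj_def l2_inner_commute[of bG _ g] l2_inner_commute[of torus_measure _ "U g"])
    have "l2_inner bG (Y f) (ebas (i, j)) = 0" if "i < 0" for i j
    proof -
      have "l2_inner torus_measure (X (U f)) (monomial (i + int j + 1) i) = 0"
        using XU(1) that by (simp add: H2_anti_def fourier_coeff_eq)
      then show ?thesis
        by (simp add: Yi[OF ebas_l2] inner_anti_ebas[OF XU(3)])
    qed
    then show ?thesis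
      using Yl2 Yi[OF HG.e_l2] by (auto simp: H2_G_eq)
  qed
  have cfU: "l2_inner torus_measure (U f) (U (hbas a)) = l2_inner bG f (hbas a)" if "f \<in> H2_G" for f a
    by (rule inner_U[OF HG.H_l2[OF that] HG.e_l2])
  have "l2_inner bG (Y f) (hbas (sig_y a)) = l2_inner bG f (hbas a)" if "f \<in> H2_G" for f a
    using *[OF that] HA.shiftD(3)[OF X_shift U_H2_anti[OF that], of a] cfU[OF that, of a] by metis
  moreover have "l2_inner bG (Y f) (hbas k) = 0" if "f \<in> H2_G" "k \<notin> range sig_y" for f k
    using *[OF that(1)] HA.shiftD(4)[OF X_shift U_H2_anti[OF that(1)] that(2)] by metis
  moreover have "inj sig_y"
    by (auto simp: inj_def)
  ultimately show ?thesis
    unfolding HG.shift_def using * by blast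
qed

section \<open>Multiplication by s and p\<close>

lemma AE_bG: "AE w in bG. cmod (fst w) \<le> 2 \<and> cmod (snd w) = 1 \<and> cnj (fst w) * snd w = fst w"
proof (subst AE_bG_iff)
  have [measurable]: "(\<lambda>w. cnj (fst w) * snd w) \<in> borel_measurable (borel :: (complex \<times> complex) measure)"
    by measurable
  show "Measurable.pred borel (\<lambda>w. cmod (fst w) \<le> 2 \<and> cmod (snd w) = 1 \<and> cnj (fst w) * snd w = fst w)"
    by measurable
  show "AE z in torus_measure. Jac z \<noteq> 0 \<longrightarrow> cmod (fst (sym_map z)) \<le> 2 \<and> cmod (snd (sym_map z)) = 1 \<and>
      cnj (fst (sym_map z)) * snd (sym_map z) = fst (sym_map z)"
    using AE_torus
  proof eventually_elim
    case (elim z)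
    then have nz: "fst z \<noteq> 0" "snd z \<noteq> 0"
      by auto
    have "cmod (fst z + snd z) \<le> 2"
      using norm_triangle_ineq[of "fst z" "snd z"] elim by simp
    \<comment> \<open>On the circle conjugation is inversion, so the conjugate of z1 + z2 times z1
      z2 is z2 + z1.\<close>
    moreover have "cnj (fst z + snd z) * (fst z * snd z) = fst z + snd z"
      using elim nz by (simp add: cnj_eq_inverse field_simps)
    ultimately show ?case
      using elim by (simp add: sym_map_def norm_mult)
  qed
qed

lemma AE_bG_snd: "AE w in bG. cmod (snd w) \<le> 1"
  using AE_bG by eventually_elim simp

lemma AE_bG_fst: "AE w in bG. cmod (fst w) \<le> 2"
  using AE_bG by eventually_elim simp

lemma bG_measurable: "f \<in> borel_measurable bG \<longleftrightarrow> f \<in> borel_measurable borel"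
  by (simp add: measurable_cong_sets[OF sets_bG refl])

lemma l2_mult_fst: "f \<in> l2 bG \<Longrightarrow> (\<lambda>w. fst w * f w) \<in> l2 bG"
  and l2_mult_snd: "f \<in> l2 bG \<Longrightarrow> (\<lambda>w. snd w * f w) \<in> l2 bG"
  by (intro l2_mult_bounded[OF _ _ AE_bG_fst] l2_mult_bounded[OF _ _ AE_bG_snd]; simp add: bG_measurable)+

lemma inner_snd_snd:
  assumes "f \<in> l2 bG" "g \<in> l2 bG"
  shows "l2_inner bG (\<lambda>w. snd w * f w) (\<lambda>w. snd w * g w) = l2_inner bG f g"
  unfolding l2_inner_def
proof (rule integral_cong_AE)
  show "(\<lambda>w. snd w * f w * cnj (snd w * g w)) \<in> borel_measurable bG"
    "(\<lambda>w. f w * cnj (g w)) \<in> borel_measurable bG"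
    by (intro borel_measurable_integrable l2_integrable_mult l2_mult_snd assms)+
  show "AE w in bG. snd w * f w * cnj (snd w * g w) = f w * cnj (g w)"
    using AE_bG
  proof eventually_elim
    case (elim w)
    then have "snd w * cnj (snd w) = 1"
      using complex_norm_square[of "snd w"] by simp
    then show ?case
      by (metis (no_types, lifting) complex_cnj_mult mult.assoc mult.commute mult_1)
  qed
qed

text \<open>The identity in \<open>AE_bG\<close>, conjugated: s times the conjugate of p is the
  conjugate of s. It moves multiplication by s across the inner product at the cost of one factor
  p.\<close>

lemma inner_fst_snd:
  assumes "f \<in> l2 bG" "g \<in> l2 bG"
  shows "l2_inner bG (\<lambda>w. fst w * f w) (\<lambda>w. snd w * g w) = l2_inner bG f (\<lambda>w. fst w * g w)"
  unfolding l2_inner_def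
proof (rule integral_cong_AE)
  show "(\<lambda>w. fst w * f w * cnj (snd w * g w)) \<in> borel_measurable bG"
    "(\<lambda>w. f w * cnj (fst w * g w)) \<in> borel_measurable bG"
    by (intro borel_measurable_integrable l2_integrable_mult l2_mult_snd l2_mult_fst assms)+
  show "AE w in bG. fst w * f w * cnj (snd w * g w) = f w * cnj (fst w * g w)"
    using AE_bG
  proof eventually_elim
    case (elim w)
    then have "fst w * cnj (snd w) = cnj (fst w)"
      by (metis complex_cnj_cnj complex_cnj_mult)
    then show ?case
      by (simp add: mult_ac)
  qed
qed

lemma inner_snd_fst:
  assumes "f \<in> l2 bG" "g \<in> l2 bG"
  shows "l2_inner bG (\<lambda>w. snd w * f w) (\<lambda>w. fst w * g w) = l2_inner bG (\<lambda>w. fst w * f w) g"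
  using inner_fst_snd[OF assms(2,1)]
  by (simp add: l2_inner_commute[of bG "\<lambda>w. snd w * f w"] l2_inner_commute[of bG "\<lambda>w. fst w * f w" g])

lemma ebas_shift: "AE w in bG. ebas (i + 1, j) w = snd w * ebas (i, j) w"
  using AE_bG
proof eventually_elim
  case (elim w)
  then have "snd w \<noteq> 0"
    by auto
  then show ?case
    by (simp add: ebas_def power_int_add)
qed

lemma inner_snd_ebas:
  assumes "f \<in> l2 bG"
  shows "l2_inner bG (\<lambda>w. snd w * f w) (ebas (i + 1, j)) = l2_inner bG f (ebas (i, j))"
proof -
  have "l2_inner bG (\<lambda>w. snd w * f w) (ebas (i + 1, j)) = l2_inner bG (\<lambda>w. snd w * f w) (\<lambda>w. snd w * ebas (i, j) w)"
    using ebas_shift[of i j] assms by (intro l2_inner_cong_AE l2_mult_snd ebas_l2) auto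
  then show ?thesis
    by (simp add: inner_snd_snd assms ebas_l2)
qed

lemma fst_ebas: "fst w * ebas (i, j) w = ebas (i, Suc j) w + snd w powi i * snd w * hsym j w"
  by (simp add: ebas_def algebra_simps)

lemma H2_G_mult_snd:
  assumes f: "f \<in> H2_G"
  shows "(\<lambda>w. snd w * f w) \<in> H2_G"
proof -
  have "l2_inner bG (\<lambda>w. snd w * f w) (ebas (i, j)) = 0" if "i < 0" for i j
    using inner_snd_ebas[OF HG.H_l2[OF f], of "i - 1" j] f that by (auto simp: H2_G_eq)
  then show ?thesis
    using f by (auto simp: H2_G_eq l2_mult_snd)
qed

text \<open>Writing \<open>ebas (i, j)\<close> as p times \<open>ebas (i - 1, j)\<close> moves s to
  the basis function, where the recurrence yields \<open>ebas (i - 1, j + 1)\<close> and, for j > 0,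
  also \<open>ebas (i, j - 1)\<close>; the first index stays negative.\<close>

lemma H2_G_mult_fst:
  assumes f: "f \<in> H2_G"
  shows "(\<lambda>w. fst w * f w) \<in> H2_G"
proof -
  have f0: "l2_inner bG f (ebas (i, j)) = 0" if "i < 0" for i j
    using f that by (auto simp: H2_G_eq)
  have fl2: "f \<in> l2 bG"
    by (rule HG.H_l2[OF f])
  have "l2_inner bG (\<lambda>w. fst w * f w) (ebas (i, j)) = 0" if i: "i < 0" for i j
  proof -
    have "l2_inner bG (\<lambda>w. fst w * f w) (ebas (i, j)) = l2_inner bG (\<lambda>w. fst w * f w) (\<lambda>w. snd w * ebas (i - 1, j) w)"
      using ebas_shift[of "i - 1" j] fl2 by (intro l2_inner_cong_AE l2_mult_fst l2_mult_snd ebas_l2) auto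
    also have "\<dots> = l2_inner bG f (\<lambda>w. fst w * ebas (i - 1, j) w)"
      by (rule inner_fst_snd[OF fl2 ebas_l2])
    also have "\<dots> = 0"
    proof (cases j)
      case 0
      then have "(\<lambda>w. fst w * ebas (i - 1, j) w) = ebas (i - 1, Suc j)"
        by (simp add: fst_ebas)
      then show ?thesis
        using i by (simp add: f0)
    next
      case (Suc j')
      have "AE w in bG. fst w * ebas (i - 1, j) w = ebas (i - 1, Suc j) w + ebas (i, j') w"
        using ebas_shift[of "i - 1" j'] by eventually_elim (simp add: fst_ebas Suc, simp add: ebas_def)
      then have "l2_inner bG f (\<lambda>w. fst w * ebas (i - 1, j) w) = l2_inner bG f (\<lambda>w. ebas (i - 1, Suc j) w + ebas (i, j') w)"
        by (intro l2_inner_cong_AE fl2 l2_mult_fst ebas_l2 l2_add) auto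
      then show ?thesis
        using i by (simp add: l2_inner_add_right ebas_l2 fl2 f0)
    qed
    finally show ?thesis .
  qed
  then show ?thesis
    using fl2 by (auto simp: H2_G_eq l2_mult_fst)
qed

lemma T_p: "f \<in> H2_G \<Longrightarrow> T_p f \<in> H2_G" "f \<in> H2_G \<Longrightarrow> AE w in bG. T_p f w = snd w * f w"
  unfolding T_p_def toeplitz_def
  by (auto intro!: HG.l2_proj(1) HG.l2_proj_AE H2_G_mult_snd HG.H_l2)

lemma T_s: "f \<in> H2_G \<Longrightarrow> T_s f \<in> H2_G" "f \<in> H2_G \<Longrightarrow> AE w in bG. T_s f w = fst w * f w"
  unfolding T_s_def toeplitz_def
  by (auto intro!: HG.l2_proj(1) HG.l2_proj_AE H2_G_mult_fst HG.H_l2)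

lemma T_p_shift: "HG.shift sig_p T_p"
proof -
  have cf: "l2_inner bG (T_p f) (hbas a) = l2_inner bG f (ebas (int (fst a) - 1, snd a))" if f: "f \<in> H2_G" for f a
  proof -
    have "l2_inner bG (T_p f) (hbas a) = l2_inner bG (\<lambda>w. snd w * f w) (hbas a)"
      by (intro HG.cf_cong_AE HG.H_l2 T_p f H2_G_mult_snd)
    then show ?thesis
      using inner_snd_ebas[OF HG.H_l2[OF f], of "int (fst a) - 1" "snd a"] by (simp add: hbas_def)
  qed
  have "l2_inner bG (T_p f) (hbas (sig_p a)) = l2_inner bG f (hbas a)" if "f \<in> H2_G" for f a
    by (simp add: cf[OF that]) (simp add: hbas_def)
  moreover have "l2_inner bG (T_p f) (hbas a) = 0" if f: "f \<in> H2_G" and a: "a \<notin> range sig_p" for f a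
  proof -
    have "fst a = 0"
      using range_sig_p_funpow[of a 1] a by simp
    then show ?thesis
      using f by (auto simp: cf[OF f] H2_G_eq)
  qed
  moreover have "inj sig_p"
    by (auto simp: inj_def)
  ultimately show ?thesis
    unfolding HG.shift_def using T_p(1) by blast
qed

lemmas Y_funpow = HG.shift_funpow[OF Y_shift]
lemmas T_p_funpow = HG.shift_funpow[OF T_p_shift]

lemma T_p_funpow_H: "f \<in> H2_G \<Longrightarrow> (T_p ^^ n) f \<in> H2_G"
  by (rule HG.shiftD(2)[OF T_p_funpow])

lemma Y_funpow_H: "f \<in> H2_G \<Longrightarrow> (Y ^^ n) f \<in> H2_G"
  by (rule HG.shiftD(2)[OF Y_funpow])

lemma T_p_funpow_AE: "f \<in> H2_G \<Longrightarrow> AE w in bG. (T_p ^^ n) f w = snd w ^ n * f w"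
proof (induction n)
  case (Suc n)
  have "AE w in bG. T_p ((T_p ^^ n) f) w = snd w * (T_p ^^ n) f w"
    by (intro T_p T_p_funpow_H Suc.prems)
  with Suc.IH[OF Suc.prems] show ?case
    by eventually_elim simp
qed simp

lemma T_s_T_p_funpow:
  assumes f: "f \<in> H2_G"
  shows "AE w in bG. T_s ((T_p ^^ n) f) w = (T_p ^^ n) (T_s f) w"
  using T_s(2)[OF T_p_funpow_H[OF f, of n]] T_p_funpow_AE[OF f, of n]
    T_p_funpow_AE[OF T_s(1)[OF f], of n] T_s(2)[OF f]
  by eventually_elim simp

text \<open>In operator form: \<open>T_p_adj\<close> after \<open>T_s\<close> is the adjoint of
  \<open>T_s\<close>.\<close>

lemma inner_T_s_T_p:
  assumes f: "f \<in> H2_G" and g: "g \<in> H2_G"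
  shows "l2_inner bG (T_s f) (T_p g) = l2_inner bG f (T_s g)"
proof -
  have "l2_inner bG (T_s f) (T_p g) = l2_inner bG (\<lambda>w. fst w * f w) (\<lambda>w. snd w * g w)"
    by (intro l2_inner_cong_AE HG.H_l2 T_p T_s f g H2_G_mult_snd H2_G_mult_fst)
  also have "\<dots> = l2_inner bG f (\<lambda>w. fst w * g w)"
    by (intro inner_fst_snd HG.H_l2 f g)
  also have "\<dots> = l2_inner bG f (T_s g)"
    using T_s(2)[OF g] by (intro l2_inner_cong_AE HG.H_l2 T_s f g H2_G_mult_fst) auto
  finally show ?thesis .
qed

lemma inner_T_p_adj_funpow:
  assumes "h \<in> H2_G" "g \<in> H2_G"
  shows "l2_inner bG ((T_p_adj ^^ n) h) g = l2_inner bG h ((T_p ^^ n) g)"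
  unfolding T_p_adj_def by (rule HG.shift_adjoint_inner[OF T_p_shift assms])

lemma inner_Y_adj_funpow:
  assumes "h \<in> H2_G" "g \<in> H2_G"
  shows "l2_inner bG ((Y_adj ^^ n) h) g = l2_inner bG h ((Y ^^ n) g)"
  unfolding Y_adj_def by (rule HG.shift_adjoint_inner[OF Y_shift assms])

lemma T_p_adj_funpow:
  assumes "h \<in> H2_G"
  shows "(T_p_adj ^^ n) h \<in> H2_G" "l2_inner bG ((T_p_adj ^^ n) h) (hbas (i, j)) = l2_inner bG h (hbas (i + n, j))"
  using HG.shift_adjoint_funpow[OF T_p_shift assms, of n] by (simp_all add: T_p_adj_def sig_p_funpow)

lemma Y_adj_funpow:
  assumes "h \<in> H2_G"
  shows "(Y_adj ^^ n) h \<in> H2_G" "l2_inner bG ((Y_adj ^^ n) h) (hbas (i, j)) = l2_inner bG h (hbas (i, j + n))"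
  using HG.shift_adjoint_funpow[OF Y_shift assms, of n] by (simp_all add: Y_adj_def sig_y_funpow)

lemma T_p_adj_funpow_norm_le: "h \<in> H2_G \<Longrightarrow> l2_norm bG ((T_p_adj ^^ n) h) \<le> l2_norm bG h"
  and Y_adj_funpow_norm_le: "h \<in> H2_G \<Longrightarrow> l2_norm bG ((Y_adj ^^ n) h) \<le> l2_norm bG h"
  unfolding T_p_adj_def Y_adj_def
  by (rule HG.shift_adjoint_funpow_norm_le[OF T_p_shift] HG.shift_adjoint_funpow_norm_le[OF Y_shift]; assumption)+

lemma T_p_funpow_norm: "f \<in> H2_G \<Longrightarrow> l2_norm bG ((T_p ^^ n) f) = l2_norm bG f"
  and Y_funpow_norm: "f \<in> H2_G \<Longrightarrow> l2_norm bG ((Y ^^ n) f) = l2_norm bG f"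
  by (rule HG.shift_norm[OF T_p_funpow] HG.shift_norm[OF Y_funpow]; assumption)+

section \<open>Compact plus Toeplitz operators are asymptotic Toeplitz\<close>

lemma bounded_opD:
  assumes "bounded_op M H T"
  shows "f \<in> H \<Longrightarrow> T f \<in> H"
    and "f \<in> H \<Longrightarrow> g \<in> H \<Longrightarrow> AE x in M. f x = g x \<Longrightarrow> AE x in M. T f x = T g x"
    and "f \<in> H \<Longrightarrow> g \<in> H \<Longrightarrow> AE x in M. T (\<lambda>y. f y + g y) x = T f x + T g x"
    and "f \<in> H \<Longrightarrow> AE x in M. T (\<lambda>y. c * f y) x = c * T f x"
  using assms unfolding bounded_op_def by blast+

lemma H2_G_bdd_lin: "bounded_op bG H2_G T \<Longrightarrow> bdd_lin bG H2_G bG T"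
  by (rule bounded_op_bdd_lin) (auto intro: HG.H_l2)

lemma bounded_op_diff:
  assumes T: "bounded_op bG H2_G T" and B: "bounded_op bG H2_G B"
  shows "bounded_op bG H2_G (\<lambda>f x. T f x - B f x)"
proof -
  note TB = bounded_opD[OF T] bounded_opD[OF B]
  obtain C where C: "\<And>f. f \<in> H2_G \<Longrightarrow> l2_norm bG (T f) \<le> C * l2_norm bG f"
    using T unfolding bounded_op_def by blast
  obtain C' where C': "\<And>f. f \<in> H2_G \<Longrightarrow> l2_norm bG (B f) \<le> C' * l2_norm bG f"
    using B unfolding bounded_op_def by blast
  have "l2_norm bG (\<lambda>x. T f x - B f x) \<le> (C + C') * l2_norm bG f" if f: "f \<in> H2_G" for f
    using l2_norm_triangle_diff[OF HG.H_l2[OF TB(1)[OF f]] HG.H_l2[OF TB(5)[OF f]]] C[OF f] C'[OF f]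
    by (simp add: distrib_right)
  moreover have "AE x in bG. T f x - B f x = T g x - B g x"
    if "f \<in> H2_G" "g \<in> H2_G" "AE x in bG. f x = g x" for f g
    using TB(2)[OF that] TB(6)[OF that] by eventually_elim simp
  moreover have "AE x in bG. T (\<lambda>y. f y + g y) x - B (\<lambda>y. f y + g y) x = T f x - B f x + (T g x - B g x)"
    if "f \<in> H2_G" "g \<in> H2_G" for f g
    using TB(3)[OF that] TB(7)[OF that] by eventually_elim simp
  moreover have "AE x in bG. T (\<lambda>y. c * f y) x - B (\<lambda>y. c * f y) x = c * (T f x - B f x)"
    if "f \<in> H2_G" for c f
    using TB(4)[OF that, of c] TB(8)[OF that, of c] by eventually_elim (simp add: right_diff_distrib)
  ultimately show ?thesis
    unfolding bounded_op_def
    by (intro conjI ballI allI impI exI[of _ "C + C'"]) (simp_all add: HG.H_diff TB(1,5))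
qed

text \<open>The compressed commutator converges weakly to B T_s minus the adjoint of T_s composed
  with B T_p, so the commutator condition becomes a relation for \<open>B\<close> alone.\<close>

lemma commutator_tendsto:
  assumes T: "bounded_op bG H2_G T" and B: "bounded_op bG H2_G B"
    and w: "weakly_tendsto bG H2_G (\<lambda>n f. (T_p_adj ^^ n) (T ((T_p ^^ n) f))) B"
    and f: "f \<in> H2_G" and g: "g \<in> H2_G"
  shows "(\<lambda>n. l2_inner bG ((T_p_adj ^^ n) (\<lambda>x. T (T_s ((T_p ^^ n) f)) x - T_s (T ((T_p ^^ n) f)) x)) g)
    \<longlonglongrightarrow> l2_inner bG (B (T_s f)) g - l2_inner bG (B (T_p f)) (T_s g)"
\<comment> \<open>The exponent n + 1 leaves one spare factor \<open>T_p\<close> on the side of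
  \<open>g\<close>, which \<open>inner_T_s_T_p\<close> spends to move \<open>T_s\<close>
  across.\<close>
proof (rule LIMSEQ_imp_Suc)
  note TH = bounded_opD(1)[OF T]
  have lim: "(\<lambda>n. l2_inner bG (T ((T_p ^^ n) f)) ((T_p ^^ n) g)) \<longlonglongrightarrow> l2_inner bG (B f) g"
    if "f \<in> H2_G" "g \<in> H2_G" for f g
    using w that unfolding weakly_tendsto_def by (simp add: inner_T_p_adj_funpow TH T_p_funpow_H)
  have "l2_inner bG ((T_p_adj ^^ Suc n) (\<lambda>x. T (T_s ((T_p ^^ Suc n) f)) x - T_s (T ((T_p ^^ Suc n) f)) x)) g
      = l2_inner bG (T ((T_p ^^ Suc n) (T_s f))) ((T_p ^^ Suc n) g)
      - l2_inner bG (T ((T_p ^^ n) (T_p f))) ((T_p ^^ n) (T_s g))" for n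
  proof -
    define q where "q = (T_p ^^ Suc n) f"
    have q: "q \<in> H2_G" "T_s q \<in> H2_G" "T q \<in> H2_G" "T (T_s q) \<in> H2_G" "T_s (T q) \<in> H2_G"
      unfolding q_def by (intro T_p_funpow_H f TH T_s)+
    have gn: "(T_p ^^ k) g \<in> H2_G" for k
      by (rule T_p_funpow_H[OF g])
    have "l2_inner bG ((T_p_adj ^^ Suc n) (\<lambda>x. T (T_s q) x - T_s (T q) x)) g
        = l2_inner bG (\<lambda>x. T (T_s q) x - T_s (T q) x) ((T_p ^^ Suc n) g)"
      by (intro inner_T_p_adj_funpow HG.H_diff q g)
    also have "\<dots> = l2_inner bG (T (T_s q)) ((T_p ^^ Suc n) g) - l2_inner bG (T_s (T q)) ((T_p ^^ Suc n) g)"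
      by (intro l2_inner_diff_left HG.H_l2 q gn)
    also have "l2_inner bG (T (T_s q)) ((T_p ^^ Suc n) g) = l2_inner bG (T ((T_p ^^ Suc n) (T_s f))) ((T_p ^^ Suc n) g)"
      using T_s_T_p_funpow[OF f, of "Suc n"] q
      by (intro l2_inner_cong_AE HG.H_l2 TH T_p_funpow_H T_s f g bounded_opD(2)[OF T]) (auto simp: q_def)
    also have "l2_inner bG (T_s (T q)) ((T_p ^^ Suc n) g) = l2_inner bG (T q) (T_s ((T_p ^^ n) g))"
      using inner_T_s_T_p[OF q(3) gn[of n]] by simp
    also have "\<dots> = l2_inner bG (T q) ((T_p ^^ n) (T_s g))"
      by (intro l2_inner_cong_AE HG.H_l2 q T_p_funpow_H T_s g T_s_T_p_funpow AE_I2 refl)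
    finally show ?thesis
      by (simp add: q_def funpow_swap1)
  qed
  then show "(\<lambda>n. l2_inner bG ((T_p_adj ^^ Suc n) (\<lambda>x. T (T_s ((T_p ^^ Suc n) f)) x - T_s (T ((T_p ^^ Suc n) f)) x)) g)
    \<longlonglongrightarrow> l2_inner bG (B (T_s f)) g - l2_inner bG (B (T_p f)) (T_s g)"
    using tendsto_diff[OF LIMSEQ_Suc[OF lim[OF T_s(1)[OF f] g]] lim[OF T_p(1)[OF f] T_s(1)[OF g]]]
    by simp
qed

lemma is_toeplitzE:
  assumes "is_toeplitz S"
  obtains \<phi> C where "\<phi> \<in> borel_measurable borel" "AE w in bG. cmod (\<phi> w) \<le> C"
    "\<And>f g. f \<in> H2_G \<Longrightarrow> g \<in> H2_G \<Longrightarrow> l2_inner bG (S f) g = l2_inner bG (\<lambda>w. \<phi> w * f w) g"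
proof -
  obtain \<phi> where S: "bounded_op bG H2_G S" and \<phi>: "\<phi> \<in> Linfty_bG"
    and eq: "\<And>f. f \<in> H2_G \<Longrightarrow> AE w in bG. S f w = toeplitz \<phi> f w"
    using assms unfolding is_toeplitz_def by blast
  have [measurable]: "\<phi> \<in> borel_measurable borel"
    using \<phi> by (simp add: Linfty_bG_def measurable_cong_sets[OF sets_nu refl])
  obtain C where "AE w in nu. cmod (\<phi> w) \<le> C"
    using \<phi> by (auto simp: Linfty_bG_def)
  then have C: "AE w in bG. cmod (\<phi> w) \<le> C"
    by (subst AE_nu_iff_bG[symmetric]) (auto intro: borel_measurable_le)
  have main: "l2_inner bG (S f) g = l2_inner bG (\<lambda>w. \<phi> w * f w) g" if f: "f \<in> H2_G" and g: "g \<in> H2_G" for f g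
  proof -
    have \<phi>f: "(\<lambda>w. \<phi> w * f w) \<in> l2 bG"
      using C by (intro l2_mult_bounded[OF HG.H_l2[OF f]]) (simp_all add: bG_measurable)
    have "l2_inner bG (S f) g = l2_inner bG (toeplitz \<phi> f) g"
      using eq[OF f] unfolding toeplitz_def
      by (intro l2_inner_cong_AE HG.H_l2 bounded_opD(1)[OF S] f g HG.l2_proj(1) \<phi>f) auto
    also have "\<dots> = l2_inner bG (\<lambda>w. \<phi> w * f w) g"
      unfolding toeplitz_def by (rule HG.l2_proj(2)[OF \<phi>f g])
    finally show ?thesis .
  qed
  show thesis
    by (rule that[OF _ C main]) measurable
qed

lemma is_toeplitz_relations:
  assumes "is_toeplitz S" and f: "f \<in> H2_G" and g: "g \<in> H2_G"
  shows "l2_inner bG (S (T_p f)) (T_p g) = l2_inner bG (S f) g"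
    and "l2_inner bG (S (T_s f)) g = l2_inner bG (S (T_p f)) (T_s g)"
proof -
  obtain \<phi> C where \<phi> [measurable]: "\<phi> \<in> borel_measurable borel" and C: "AE w in bG. cmod (\<phi> w) \<le> C"
    and S: "\<And>f g. f \<in> H2_G \<Longrightarrow> g \<in> H2_G \<Longrightarrow> l2_inner bG (S f) g = l2_inner bG (\<lambda>w. \<phi> w * f w) g"
    using is_toeplitzE[OF assms(1)] by blast
  have \<phi>l2: "(\<lambda>w. \<phi> w * h w) \<in> l2 bG" if "h \<in> l2 bG" for h
    using C by (intro l2_mult_bounded[OF that]) (simp_all add: bG_measurable)
  note l2 = HG.H_l2[OF f] HG.H_l2[OF g] HG.H_l2[OF T_p(1)[OF f]] HG.H_l2[OF T_p(1)[OF g]]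
    HG.H_l2[OF T_s(1)[OF f]] HG.H_l2[OF T_s(1)[OF g]]
  have \<phi>p: "AE w in bG. \<phi> w * T_p f w = snd w * (\<phi> w * f w)"
    using T_p(2)[OF f] by eventually_elim simp
  have \<phi>s: "AE w in bG. fst w * (\<phi> w * f w) = \<phi> w * T_s f w"
    using T_s(2)[OF f] by eventually_elim simp
  have "l2_inner bG (S (T_p f)) (T_p g) = l2_inner bG (\<lambda>w. snd w * (\<phi> w * f w)) (\<lambda>w. snd w * g w)"
    unfolding S[OF T_p(1)[OF f] T_p(1)[OF g]]
    using \<phi>p T_p(2)[OF g] by (intro l2_inner_cong_AE \<phi>l2 l2_mult_snd l2) auto
  then show "l2_inner bG (S (T_p f)) (T_p g) = l2_inner bG (S f) g"
    by (simp add: inner_snd_snd \<phi>l2 l2 S f g)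
  have "l2_inner bG (S (T_p f)) (T_s g) = l2_inner bG (\<lambda>w. snd w * (\<phi> w * f w)) (\<lambda>w. fst w * g w)"
    unfolding S[OF T_p(1)[OF f] T_s(1)[OF g]]
    using \<phi>p T_s(2)[OF g] by (intro l2_inner_cong_AE \<phi>l2 l2_mult_snd l2_mult_fst l2) auto
  also have "\<dots> = l2_inner bG (\<lambda>w. fst w * (\<phi> w * f w)) g"
    by (intro inner_snd_fst \<phi>l2 l2)
  also have "\<dots> = l2_inner bG (\<lambda>w. \<phi> w * T_s f w) g"
    using \<phi>s by (intro l2_inner_cong_AE l2_mult_fst \<phi>l2 l2) auto
  finally show "l2_inner bG (S (T_s f)) g = l2_inner bG (S (T_p f)) (T_s g)"
    by (simp add: S T_s(1) f g)
qed

section \<open>Pairs of functions and the operator \<open>eta\<close>\<close>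

lemma dsum_norm_nonneg: "0 \<le> dsum_norm M u"
  by (simp add: dsum_norm_def)

lemma dsum_norm_le_1D:
  assumes "dsum_norm M u \<le> 1"
  shows "l2_norm M (fst u) \<le> 1" "l2_norm M (snd u) \<le> 1"
proof -
  have "(l2_norm M (fst u))\<^sup>2 + (l2_norm M (snd u))\<^sup>2 \<le> 1"
    using assms by (simp add: dsum_norm_def)
  moreover have "0 \<le> (l2_norm M (fst u))\<^sup>2" "0 \<le> (l2_norm M (snd u))\<^sup>2"
    by simp_all
  ultimately have "(l2_norm M (fst u))\<^sup>2 \<le> 1" "(l2_norm M (snd u))\<^sup>2 \<le> 1"
    by linarith+
  then have "(l2_norm M (fst u))\<^sup>2 \<le> 1\<^sup>2" "(l2_norm M (snd u))\<^sup>2 \<le> 1\<^sup>2"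
    by simp_all
  then show "l2_norm M (fst u) \<le> 1" "l2_norm M (snd u) \<le> 1"
    by (metis power2_le_imp_le zero_le_one)+
qed

lemma dsum_norm_le: "dsum_norm M u \<le> l2_norm M (fst u) + l2_norm M (snd u)"
  unfolding dsum_norm_def by (rule sqrt_sum_squares_le_sum) simp_all

lemma zero_in_dsum_ball: "(\<lambda>x. 0, \<lambda>x. 0) \<in> {u \<in> H2_G \<times> H2_G. dsum_norm bG u \<le> 1}"
  using HG.H_zero by (simp add: dsum_norm_def)

lemma dsum_opnorm_le:
  assumes "\<And>u. u \<in> H2_G \<times> H2_G \<Longrightarrow> dsum_norm bG u \<le> 1 \<Longrightarrow> dsum_norm bG (A u) \<le> c"
  shows "dsum_opnorm bG H2_G A \<le> c"
  unfolding dsum_opnorm_def using zero_in_dsum_ball assms by (intro cSUP_least) blast+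

text \<open>A real \<open>SUP\<close> is informative only on sets bounded above; \<open>c\<close>
  provides the bound.\<close>

lemma le_dsum_opnorm:
  assumes "\<And>u. u \<in> H2_G \<times> H2_G \<Longrightarrow> dsum_norm bG u \<le> 1 \<Longrightarrow> dsum_norm bG (A u) \<le> c"
    and "u \<in> H2_G \<times> H2_G" "dsum_norm bG u \<le> 1"
  shows "dsum_norm bG (A u) \<le> dsum_opnorm bG H2_G A"
  unfolding dsum_opnorm_def using assms by (intro cSUP_upper bdd_aboveI2[where M=c]) auto

lemma dsum_opnorm_nonneg:
  assumes "\<And>u. u \<in> H2_G \<times> H2_G \<Longrightarrow> dsum_norm bG u \<le> 1 \<Longrightarrow> dsum_norm bG (A u) \<le> c"
  shows "0 \<le> dsum_opnorm bG H2_G A"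
proof -
  have u: "(\<lambda>x. 0, \<lambda>x. 0) \<in> H2_G \<times> H2_G" "dsum_norm bG (\<lambda>x. 0, \<lambda>x. 0) \<le> 1"
    using zero_in_dsum_ball by auto
  show ?thesis
    using le_dsum_opnorm[where A=A, OF assms u] dsum_norm_nonneg order_trans by blast
qed

text \<open>The row of the n-th powers of \<open>Y\<close> and \<open>T_p\<close>:
  \<open>eta n D\<close> applies this row, then \<open>D\<close>, then its adjoint column.\<close>

definition row :: "nat \<Rightarrow> (complex \<times> complex \<Rightarrow> complex) \<times> (complex \<times> complex \<Rightarrow> complex) \<Rightarrow> complex \<times> complex \<Rightarrow> complex" where
  "row n u = (\<lambda>x. (Y ^^ n) (fst u) x + (T_p ^^ n) (snd u) x)"

lemma eta_row: "eta n D u = ((Y_adj ^^ n) (D (row n u)), (T_p_adj ^^ n) (D (row n u)))"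
  by (simp add: eta_def row_def Let_def)

lemma row_H: "u \<in> H2_G \<times> H2_G \<Longrightarrow> row n u \<in> H2_G"
  unfolding row_def by (intro HG.H_add Y_funpow_H T_p_funpow_H) auto

lemma row_norm_le:
  assumes "u \<in> H2_G \<times> H2_G" "dsum_norm bG u \<le> 1"
  shows "l2_norm bG (row n u) \<le> 2"
proof -
  have u: "fst u \<in> H2_G" "snd u \<in> H2_G"
    using assms(1) by auto
  have "l2_norm bG (row n u) \<le> l2_norm bG ((Y ^^ n) (fst u)) + l2_norm bG ((T_p ^^ n) (snd u))"
    unfolding row_def by (intro l2_norm_triangle HG.H_l2 Y_funpow_H T_p_funpow_H u)
  then show ?thesis
    using dsum_norm_le_1D[OF assms(2)] by (simp add: Y_funpow_norm T_p_funpow_norm u)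
qed

lemma eta_bounded:
  assumes D: "bounded_op bG H2_G D"
  obtains c where "\<And>n u. u \<in> H2_G \<times> H2_G \<Longrightarrow> dsum_norm bG u \<le> 1 \<Longrightarrow> dsum_norm bG (eta n D u) \<le> c"
proof -
  obtain C where C: "0 \<le> C" "\<And>f. f \<in> H2_G \<Longrightarrow> l2_norm bG (D f) \<le> C * l2_norm bG f"
    using HG.bdd_lin_bound[OF H2_G_bdd_lin[OF D]] by blast
  have "dsum_norm bG (eta n D u) \<le> 4 * C" if u: "u \<in> H2_G \<times> H2_G" "dsum_norm bG u \<le> 1" for n u
  proof -
    have DH: "D (row n u) \<in> H2_G"
      by (intro bounded_opD(1)[OF D] row_H u)
    have "l2_norm bG (D (row n u)) \<le> C * 2"
      using C(2)[OF row_H[OF u(1)], of n] mult_left_mono[OF row_norm_le[OF u, of n] C(1)] by linarith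
    then show ?thesis
      using dsum_norm_le[of bG "eta n D u"] Y_adj_funpow_norm_le[OF DH, of n] T_p_adj_funpow_norm_le[OF DH, of n]
      by (simp add: eta_row)
  qed
  then show thesis
    using that by blast
qed

text \<open>The argument of \<open>K\<close> varies with n, so strong convergence at a single vector
  would not do; the uniform estimate on the image of a ball applies to the bounded sequence
  \<open>h\<close>.\<close>

lemma compact_inner_T_p_tendsto:
  assumes K: "compact_op bG H2_G K" and h: "\<And>n. h n \<in> H2_G" "\<And>n. l2_norm bG (h n) \<le> C" and g: "g \<in> H2_G"
  shows "(\<lambda>n. l2_inner bG (K (h n)) ((T_p ^^ n) g)) \<longlonglongrightarrow> 0"
proof -
  have KH: "K (h n) \<in> H2_G" for n
    using K h(1) unfolding compact_op_def by (blast intro: bounded_opD(1))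
  have "(\<lambda>n. l2_norm bG ((T_p_adj ^^ n) (K (h n)))) \<longlonglongrightarrow> 0"
  proof (rule tendstoI)
    fix \<epsilon> :: real assume "\<epsilon> > 0"
    from HG.compact_op_shift_adjoint[OF K T_p_shift sig_p_leaves this, of C]
    show "\<forall>\<^sub>F n in sequentially. dist (l2_norm bG ((T_p_adj ^^ n) (K (h n)))) 0 < \<epsilon>"
      by eventually_elim (use h in \<open>auto simp: T_p_adj_def\<close>)
  qed
  then have lim: "(\<lambda>n. l2_norm bG ((T_p_adj ^^ n) (K (h n))) * l2_norm bG g) \<longlonglongrightarrow> 0"
    by (rule tendsto_mult_left_zero)
  show ?thesis
  proof (rule Lim_null_comparison[OF _ lim], intro always_eventually allI)
    fix n
    show "norm (l2_inner bG (K (h n)) ((T_p ^^ n) g)) \<le> l2_norm bG ((T_p_adj ^^ n) (K (h n))) * l2_norm bG g"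
      unfolding inner_T_p_adj_funpow[OF KH g, symmetric]
      by (intro l2_Cauchy_Schwarz HG.H_l2 T_p_adj_funpow(1) KH g)
  qed
qed

lemma compact_plus_toeplitz_imp_asymptotic:
  assumes T: "bounded_op bG H2_G T" and K: "compact_op bG H2_G K" and S: "is_toeplitz S"
    and TKS: "\<And>f. f \<in> H2_G \<Longrightarrow> AE x in bG. T f x = K f x + S f x"
  shows "asymptotic_toeplitz T"
proof -
  have bK: "bounded_op bG H2_G K" and bS: "bounded_op bG H2_G S"
    using K S by (auto simp: compact_op_def is_toeplitz_def)
  note H = bounded_opD(1)[OF T] bounded_opD(1)[OF bK] bounded_opD(1)[OF bS]
  have inner_T: "l2_inner bG (T f) g = l2_inner bG (K f) g + l2_inner bG (S f) g"
    if "f \<in> H2_G" "g \<in> H2_G" for f g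
  proof -
    have "l2_inner bG (T f) g = l2_inner bG (\<lambda>x. K f x + S f x) g"
      using TKS[OF that(1)] that by (intro l2_inner_cong_AE HG.H_l2 l2_add H) auto
    then show ?thesis
      using that by (simp add: l2_inner_add_left HG.H_l2 H)
  qed
  have S_inv: "l2_inner bG (S ((T_p ^^ n) f)) ((T_p ^^ n) g) = l2_inner bG (S f) g"
    if "f \<in> H2_G" "g \<in> H2_G" for f g n
    by (induction n) (simp_all add: is_toeplitz_relations(1)[OF S] T_p_funpow_H that)
  have weak: "weakly_tendsto bG H2_G (\<lambda>n f. (T_p_adj ^^ n) (T ((T_p ^^ n) f))) S"
    unfolding weakly_tendsto_def
  proof (intro ballI)
    fix f g assume f: "f \<in> H2_G" and g: "g \<in> H2_G"
    have "(\<lambda>n. l2_inner bG (K ((T_p ^^ n) f)) ((T_p ^^ n) g)) \<longlonglongrightarrow> 0"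
      by (rule compact_inner_T_p_tendsto[OF K _ _ g, where C="l2_norm bG f"])
        (simp_all add: T_p_funpow_H T_p_funpow_norm f)
    from tendsto_add[OF this tendsto_const[of "l2_inner bG (S f) g"]]
    show "(\<lambda>n. l2_inner bG ((T_p_adj ^^ n) (T ((T_p ^^ n) f))) g) \<longlonglongrightarrow> l2_inner bG (S f) g"
      by (simp add: inner_T_p_adj_funpow inner_T S_inv H T_p_funpow_H f g)
  qed
  have comm: "weakly_tendsto bG H2_G (\<lambda>n f. (T_p_adj ^^ n)
      (\<lambda>x. T (T_s ((T_p ^^ n) f)) x - T_s (T ((T_p ^^ n) f)) x)) (\<lambda>f x. 0)"
    unfolding weakly_tendsto_def
    using commutator_tendsto[OF T bS weak] is_toeplitz_relations(2)[OF S] by (simp add: l2_inner_zero_left)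
  define D where "D = (\<lambda>f x. T f x - S f x)"
  have bD: "bounded_op bG H2_G D"
    unfolding D_def by (rule bounded_op_diff[OF T bS])
  obtain c where c: "\<And>n u. u \<in> H2_G \<times> H2_G \<Longrightarrow> dsum_norm bG u \<le> 1 \<Longrightarrow> dsum_norm bG (eta n D u) \<le> c"
    using eta_bounded[OF bD] by blast
  have "(\<lambda>n. dsum_opnorm bG H2_G (eta n D)) \<longlonglongrightarrow> 0"
  proof (rule tendstoI)
    fix \<epsilon> :: real assume "\<epsilon> > 0"
    \<comment> \<open>Each of the two components of \<open>eta\<close> is made smaller than
      \<open>\<epsilon> / 4\<close>; the radius 2 in the uniform estimates is the bound of
      \<open>row_norm_le\<close>.\<close>
    then have "\<epsilon> / 4 > 0"
      by simp
    note * = HG.compact_op_shift_adjoint[OF K T_p_shift sig_p_leaves this, of 2]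
      HG.compact_op_shift_adjoint[OF K Y_shift sig_y_leaves this, of 2]
    from * show "\<forall>\<^sub>F n in sequentially. dist (dsum_opnorm bG H2_G (eta n D)) 0 < \<epsilon>"
    proof eventually_elim
      case (elim n)
      have "dsum_opnorm bG H2_G (eta n D) \<le> \<epsilon> / 4 + \<epsilon> / 4"
      proof (rule dsum_opnorm_le)
        fix u assume u: "u \<in> H2_G \<times> H2_G" "dsum_norm bG u \<le> 1"
        let ?r = "row n u"
        have r: "?r \<in> H2_G" "l2_norm bG ?r \<le> 2"
          using row_H[OF u(1)] row_norm_le[OF u] by auto
        have DK: "AE x in bG. D ?r x = K ?r x"
          using TKS[OF r(1)] by eventually_elim (simp add: D_def)
        have Dr: "D ?r \<in> H2_G" and Kr: "K ?r \<in> H2_G"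
          using r(1) bounded_opD(1)[OF bD] H by auto
        \<comment> \<open>The adjoints are choices of representatives, so their values at the a.e.
          equal functions \<open>D ?r\<close> and \<open>K ?r\<close> are compared through
          coefficients.\<close>
        have "l2_norm bG ((Y_adj ^^ n) (D ?r)) = l2_norm bG ((Y_adj ^^ n) (K ?r))"
          "l2_norm bG ((T_p_adj ^^ n) (D ?r)) = l2_norm bG ((T_p_adj ^^ n) (K ?r))"
          using HG.cf_cong_AE[OF HG.H_l2[OF Dr] HG.H_l2[OF Kr] DK]
          by (intro l2_norm_cong_AE HG.H_l2 HG.eq_AE_if_cf_eq Y_adj_funpow T_p_adj_funpow Dr Kr;
              simp add: split_paired_all Y_adj_funpow(2) T_p_adj_funpow(2) Dr Kr)+
        then show "dsum_norm bG (eta n D u) \<le> \<epsilon> / 4 + \<epsilon> / 4"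
          using dsum_norm_le[of bG "eta n D u"] elim r by (fastforce simp: eta_row Y_adj_def T_p_adj_def)
      qed
      then show ?case
        using dsum_opnorm_nonneg[of "eta n D" c, OF c] \<open>\<epsilon> > 0\<close> by (simp add: dist_real_def)
    qed
  qed
  then show ?thesis
    unfolding asymptotic_toeplitz_def D_def using T bS weak comm by blast
qed

section \<open>Compactness from the norm condition\<close>

context l2_basis
begin

lemma cf_bound:
  assumes "f \<in> l2 M"
  shows "cmod (cf f a) \<le> l2_norm M f"
proof -
  have "(l2_norm M (e a))\<^sup>2 = 1"
    using l2_inner_self[of M "e a"] by (simp add: e_orth flip: of_real_power)
  then have "l2_norm M (e a) = 1"
    by (simp add: power2_eq_1_iff l2_norm_def)
  then show ?thesis
    using l2_Cauchy_Schwarz[OF assms e_l2[of a]] by simp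
qed

text \<open>Approximating \<open>g\<close> by a finite sum leaves finitely many coefficients and an
  error controlled by \<open>C\<close>; this is weak convergence to zero in coordinates.\<close>

lemma inner_tendsto_0_if_cf_tendsto_0:
  assumes x: "\<And>k. x k \<in> H" "\<And>k::nat. l2_norm M (x k) \<le> C" and cf: "\<And>a. (\<lambda>k. cf (x k) a) \<longlonglongrightarrow> 0" and g: "g \<in> H"
  shows "(\<lambda>k. l2_inner M (x k) g) \<longlonglongrightarrow> 0"
proof (rule tendstoI)
  fix \<epsilon> :: real assume "\<epsilon> > 0"
  have C: "0 \<le> C"
    using x(2)[of 0] l2_norm_nonneg order_trans by blast
  obtain F where F: "\<And>n. finite (F n)" "(\<lambda>n::nat. l2_norm M (\<lambda>x. fsum (F n) (cf g) x - g x)) \<longlonglongrightarrow> 0"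
    using fsum_seq_tendsto[OF g] by blast
  have "\<epsilon> / (2 * (C + 1)) > 0"
    using \<open>\<epsilon> > 0\<close> C by simp
  from order_tendstoD(2)[OF F(2) this]
  obtain m where m: "l2_norm M (\<lambda>x. fsum (F m) (cf g) x - g x) < \<epsilon> / (2 * (C + 1))"
    by (auto simp: eventually_sequentially)
  let ?p = "fsum (F m) (cf g)"
  have "(\<lambda>k. l2_inner M (x k) ?p) \<longlonglongrightarrow> (\<Sum>i\<in>F m. cnj (cf g i) * 0)"
    unfolding inner_fsum_right[OF H_l2[OF x(1)]] by (intro tendsto_intros cf)
  then have "(\<lambda>k. l2_inner M (x k) ?p) \<longlonglongrightarrow> 0"
    by simp
  then have "\<forall>\<^sub>F k in sequentially. dist (l2_inner M (x k) ?p) 0 < \<epsilon> / 2"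
    by (rule tendstoD) (use \<open>\<epsilon> > 0\<close> in simp)
  then show "\<forall>\<^sub>F k in sequentially. dist (l2_inner M (x k) g) 0 < \<epsilon>"
  proof eventually_elim
    case (elim k)
    note l2 = H_l2[OF x(1)[of k]] fsum_l2[of "F m" "cf g"] H_l2[OF g]
    have "cmod (l2_inner M (x k) (\<lambda>x. ?p x - g x)) \<le> l2_norm M (x k) * l2_norm M (\<lambda>x. ?p x - g x)"
      by (intro l2_Cauchy_Schwarz l2_diff l2)
    also have "\<dots> \<le> C * (\<epsilon> / (2 * (C + 1)))"
      using m by (intro mult_mono x(2) C) auto
    also have "\<dots> \<le> \<epsilon> / 2"
      using C \<open>\<epsilon> > 0\<close> by (simp add: field_simps)
    finally have "cmod (l2_inner M (x k) (\<lambda>x. ?p x - g x)) \<le> \<epsilon> / 2" .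
    moreover have "l2_inner M (x k) g = l2_inner M (x k) ?p - l2_inner M (x k) (\<lambda>x. ?p x - g x)"
      by (simp add: l2_inner_diff_right l2)
    ultimately show ?case
      using elim norm_triangle_ineq4[of "l2_inner M (x k) ?p" "l2_inner M (x k) (\<lambda>x. ?p x - g x)"] by simp
  qed
qed

text \<open>Weak sequential compactness of balls: along a diagonal subsequence every coefficient
  converges, and Bessel's inequality in the limit makes the limits square summable.\<close>

lemma bounded_imp_cf_convergent_subsequence:
  assumes x: "\<And>k. x k \<in> H" "\<And>k::nat. l2_norm M (x k) \<le> C"
  obtains r g where "strict_mono r" "g \<in> H" "\<And>a. (\<lambda>k. cf (x (r k)) a) \<longlonglongrightarrow> cf g a"
proof -
  define P where "P n s \<longleftrightarrow> convergent (\<lambda>k. cf (x (s k)) (from_nat n))" for n s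
  interpret subseqs P
  proof
    fix n and s :: "nat \<Rightarrow> nat"
    have "bounded (range (\<lambda>k. cf (x (s k)) (from_nat n)))"
      using cf_bound[OF H_l2[OF x(1)]] x(2) by (intro boundedI[where B=C]) (auto intro: order_trans)
    then obtain l r where "strict_mono r" "((\<lambda>k. cf (x (s k)) (from_nat n)) \<circ> r) \<longlonglongrightarrow> l"
      using bounded_imp_convergent_subsequence by blast
    then show "\<exists>r'. strict_mono r' \<and> P n (s \<circ> r')"
      by (auto simp: P_def o_def convergent_def)
  qed
  have conv: "convergent (\<lambda>k. cf (x (diagseq k)) a)" for a
  proof -
    have "P (to_nat a) (diagseq \<circ> (+) (Suc (to_nat a)))"
    proof (rule diagseq_holds)
      fix r s n assume "strict_mono (r :: nat \<Rightarrow> nat)" "P n s"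
      then obtain l where "(\<lambda>k. cf (x (s k)) (from_nat n)) \<longlonglongrightarrow> l"
        by (auto simp: P_def convergent_def)
      from LIMSEQ_subseq_LIMSEQ[OF this \<open>strict_mono r\<close>] show "P n (s \<circ> r)"
        by (auto simp: P_def convergent_def o_def)
    qed
    then obtain l where "(\<lambda>k. cf (x (diagseq (Suc (to_nat a) + k))) a) \<longlonglongrightarrow> l"
      by (auto simp: P_def convergent_def o_def)
    then have "(\<lambda>k. cf (x (diagseq (k + Suc (to_nat a)))) a) \<longlonglongrightarrow> l"
      by (simp add: add.commute)
    then have "(\<lambda>k. cf (x (diagseq k)) a) \<longlonglongrightarrow> l"
      by (rule LIMSEQ_offset)
    then show ?thesis
      by (auto simp: convergent_def)
  qed
  define c where "c a = lim (\<lambda>k. cf (x (diagseq k)) a)" for a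
  have c: "(\<lambda>k. cf (x (diagseq k)) a) \<longlonglongrightarrow> c a" for a
    using conv unfolding c_def by (simp add: convergent_LIMSEQ_iff)
  have "(\<Sum>a\<in>F. (cmod (c a))\<^sup>2) \<le> C\<^sup>2" if "finite F" for F
  proof (rule LIMSEQ_le_const2)
    show "(\<lambda>k. \<Sum>a\<in>F. (cmod (cf (x (diagseq k)) a))\<^sup>2) \<longlonglongrightarrow> (\<Sum>a\<in>F. (cmod (c a))\<^sup>2)"
      by (intro tendsto_intros c)
    have "(\<Sum>a\<in>F. (cmod (cf (x k) a))\<^sup>2) \<le> C\<^sup>2" for k
      using Bessel[OF H_l2[OF x(1)] that, of k] power_mono[OF x(2)[of k] l2_norm_nonneg, of 2] by linarith
    then show "\<exists>N. \<forall>k\<ge>N. (\<Sum>a\<in>F. (cmod (cf (x (diagseq k)) a))\<^sup>2) \<le> C\<^sup>2"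
      by blast
  qed
  then have "(\<lambda>a. (cmod (c a))\<^sup>2) summable_on UNIV"
    by (intro nonneg_bdd_above_summable_on) (auto simp: bdd_above_def)
  then obtain g where "g \<in> H" "\<And>a. cf g a = c a"
    by (rule H_with_cf) (rule that)
  then show thesis
    using that[OF subseq_diagseq, of g] c by simp
qed

end

text \<open>\<open>corner n\<close> indexes the finite-dimensional orthogonal complement of the sum of the ranges
  of \<open>Y\<^sup>n\<close> and \<open>T\<^sub>p\<^sup>n\<close>.\<close>

definition corner :: "nat \<Rightarrow> (nat \<times> nat) set" where
  "corner n = {..<n} \<times> {..<n}"

lemma finite_corner [simp]: "finite (corner n)"
  by (simp add: corner_def)

text \<open>The ranges of \<open>Y ^^ n\<close> and \<open>T_p ^^ n\<close> share the indices with
  i, j \<ge> n. Taking the first entry from \<open>x\<close> and the second from what remains counts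
  them once, so the pair reproduces \<open>x\<close> outside the corner and is no longer than
  \<open>x\<close>. The other estimate of \<open>snd u\<close> is for outputs, where the two adjoint
  powers of \<open>x\<close> itself are what is controlled.\<close>

lemma row_decomposition:
  assumes x: "x \<in> H2_G"
  obtains u where "u \<in> H2_G \<times> H2_G" "fst u = (Y_adj ^^ n) x"
    "(l2_norm bG (fst u))\<^sup>2 + (l2_norm bG (snd u))\<^sup>2 \<le> (l2_norm bG x)\<^sup>2"
    "l2_norm bG (snd u) \<le> l2_norm bG ((T_p_adj ^^ n) x) + l2_norm bG (fst u)"
    "AE w in bG. row n u w = x w - HG.fsum (corner n) (l2_inner bG x \<circ> hbas) w"
proof -
  define y where "y = (Y_adj ^^ n) x"
  define d where "d = (\<lambda>w. x w - (Y ^^ n) y w)"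
  define v where "v = (T_p_adj ^^ n) d"
  have y: "y \<in> H2_G" "(Y ^^ n) y \<in> H2_G"
    unfolding y_def by (intro Y_funpow_H Y_adj_funpow x)+
  have d: "d \<in> H2_G"
    unfolding d_def by (intro HG.H_diff x y)
  have v: "v \<in> H2_G" "(T_p ^^ n) v \<in> H2_G"
    unfolding v_def by (intro T_p_funpow_H T_p_adj_funpow d)+
  have cfY: "l2_inner bG ((Y ^^ n) y) (hbas (i, j)) = (if n \<le> j then l2_inner bG x (hbas (i, j)) else 0)" for i j
  proof (cases "n \<le> j")
    case True
    then show ?thesis
      using HG.shiftD(3)[OF Y_funpow[of n] y(1), of "(i, j - n)"]
      by (simp add: sig_y_funpow y_def Y_adj_funpow(2)[OF x])
  next
    case False
    then show ?thesis
      using HG.shiftD(4)[OF Y_funpow[of n] y(1), of "(i, j)"] by (simp add: range_sig_y_funpow)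
  qed
  have cfd: "l2_inner bG d (hbas (i, j)) = (if n \<le> j then 0 else l2_inner bG x (hbas (i, j)))" for i j
    unfolding d_def HG.cf_diff[OF HG.H_l2[OF x] HG.H_l2[OF y(2)]] by (simp add: cfY)
  have cfT: "l2_inner bG ((T_p ^^ n) v) (hbas (i, j)) = (if n \<le> i then l2_inner bG d (hbas (i, j)) else 0)" for i j
  proof (cases "n \<le> i")
    case True
    then show ?thesis
      using HG.shiftD(3)[OF T_p_funpow[of n] v(1), of "(i - n, j)"]
      by (simp add: sig_p_funpow v_def T_p_adj_funpow(2)[OF d])
  next
    case False
    then show ?thesis
      using HG.shiftD(4)[OF T_p_funpow[of n] v(1), of "(i, j)"] by (simp add: range_sig_p_funpow)
  qed
  have row: "row n (y, v) = (\<lambda>w. (Y ^^ n) y w + (T_p ^^ n) v w)"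
    by (simp add: row_def)
  have "AE w in bG. row n (y, v) w = x w - HG.fsum (corner n) (l2_inner bG x \<circ> hbas) w"
    unfolding row
  proof (intro HG.eq_AE_if_cf_eq HG.H_add HG.H_diff y v x HG.fsum_H)
    fix a :: "nat \<times> nat"
    obtain i j where a: "a = (i, j)"
      by force
    show "l2_inner bG (\<lambda>w. (Y ^^ n) y w + (T_p ^^ n) v w) (hbas a)
        = l2_inner bG (\<lambda>w. x w - HG.fsum (corner n) (l2_inner bG x \<circ> hbas) w) (hbas a)"
      unfolding HG.cf_add[OF HG.H_l2[OF y(2)] HG.H_l2[OF v(2)]] HG.cf_diff[OF HG.H_l2[OF x] HG.fsum_l2]
        HG.cf_fsum[OF finite_corner]
      by (simp add: a cfY cfT cfd corner_def)
  qed
  moreover have "(l2_norm bG y)\<^sup>2 + (l2_norm bG v)\<^sup>2 \<le> (l2_norm bG x)\<^sup>2"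
  proof -
    have "l2_inner bG x ((Y ^^ n) y) = of_real ((l2_norm bG y)\<^sup>2)"
      unfolding inner_Y_adj_funpow[OF x y(1), symmetric] y_def[symmetric] by (rule l2_inner_self)
    then have "(l2_norm bG d)\<^sup>2 = (l2_norm bG x)\<^sup>2 - (l2_norm bG y)\<^sup>2"
      unfolding d_def l2_norm_diff_sq[OF HG.H_l2[OF x] HG.H_l2[OF y(2)]] Y_funpow_norm[OF y(1)]
      by (simp del: of_real_power)
    moreover have "(l2_norm bG v)\<^sup>2 \<le> (l2_norm bG d)\<^sup>2"
      unfolding v_def by (intro power_mono T_p_adj_funpow_norm_le d) simp
    ultimately show ?thesis
      by simp
  qed
  moreover have "l2_norm bG v \<le> l2_norm bG ((T_p_adj ^^ n) x) + l2_norm bG y"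
  proof -
    have "l2_norm bG v \<le> l2_norm bG ((T_p_adj ^^ n) x) + l2_norm bG (\<lambda>w. d w - x w)"
      unfolding v_def T_p_adj_def by (rule HG.shift_adjoint_diff_le[OF T_p_shift d x])
    also have "l2_norm bG (\<lambda>w. d w - x w) = l2_norm bG ((Y ^^ n) y)"
      by (simp add: d_def l2_norm_def)
    finally show ?thesis
      by (simp add: Y_funpow_norm[OF y(1)])
  qed
  ultimately show thesis
    using that[of "(y, v)"] y(1) v(1) by (simp add: y_def)
qed

text \<open>The powers of \<open>Y\<close> and \<open>T_p\<close> are isometric, so the tail is at
  most the norm of \<open>fst u\<close> plus that of \<open>snd u\<close>; the estimate of
  \<open>snd u\<close> contributes \<open>fst u\<close> once more, hence the factor 2.\<close>

lemma tail_norm_le: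
  assumes h: "h \<in> H2_G"
  shows "l2_norm bG (\<lambda>w. h w - HG.fsum (corner n) (l2_inner bG h \<circ> hbas) w)
    \<le> 2 * l2_norm bG ((Y_adj ^^ n) h) + l2_norm bG ((T_p_adj ^^ n) h)"
proof -
  obtain u where u: "u \<in> H2_G \<times> H2_G" "fst u = (Y_adj ^^ n) h"
    "l2_norm bG (snd u) \<le> l2_norm bG ((T_p_adj ^^ n) h) + l2_norm bG (fst u)"
    "AE w in bG. row n u w = h w - HG.fsum (corner n) (l2_inner bG h \<circ> hbas) w"
    by (rule row_decomposition[OF h, of n]) (rule that)
  have u': "fst u \<in> H2_G" "snd u \<in> H2_G"
    using u(1) by auto
  have "l2_norm bG (\<lambda>w. h w - HG.fsum (corner n) (l2_inner bG h \<circ> hbas) w) = l2_norm bG (row n u)"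
    using u(4) by (intro l2_norm_cong_AE HG.H_l2 HG.H_diff HG.fsum_H h row_H u(1)) auto
  also have "\<dots> \<le> l2_norm bG ((Y ^^ n) (fst u)) + l2_norm bG ((T_p ^^ n) (snd u))"
    unfolding row_def by (intro l2_norm_triangle HG.H_l2 Y_funpow_H T_p_funpow_H u')
  finally show ?thesis
    using u(2,3) by (simp add: Y_funpow_norm[OF Y_adj_funpow(1)[OF h]] T_p_funpow_norm u')
qed

text \<open>With P the projection onto the corner this bounds (1 - P) D (1 - P): the input is
  \<open>row n u\<close> with \<open>u\<close> in the unit ball, and the output tail costs 2 + 1
  components of \<open>eta n D u\<close>.\<close>

lemma corner_norm_le:
  fixes n :: nat
  assumes D: "bounded_op bG H2_G D" and x: "x \<in> H2_G" "l2_norm bG x \<le> 1"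
  defines "z \<equiv> (\<lambda>w. x w - HG.fsum (corner n) (l2_inner bG x \<circ> hbas) w)"
  shows "l2_norm bG (\<lambda>w. D z w - HG.fsum (corner n) (l2_inner bG (D z) \<circ> hbas) w)
    \<le> 3 * dsum_opnorm bG H2_G (eta n D)"
proof -
  obtain u where u: "u \<in> H2_G \<times> H2_G"
    "(l2_norm bG (fst u))\<^sup>2 + (l2_norm bG (snd u))\<^sup>2 \<le> (l2_norm bG x)\<^sup>2"
    "AE w in bG. row n u w = x w - HG.fsum (corner n) (l2_inner bG x \<circ> hbas) w"
    by (rule row_decomposition[OF x(1), of n]) (rule that)
  have z: "z \<in> H2_G"
    unfolding z_def by (intro HG.H_diff HG.fsum_H x)
  have r: "row n u \<in> H2_G"
    by (rule row_H[OF u(1)])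
  have Dz: "D z \<in> H2_G" and Dr: "D (row n u) \<in> H2_G"
    by (intro bounded_opD(1)[OF D] z r)+
  have AE: "AE w in bG. D z w = D (row n u) w"
    using u(3) by (intro bounded_opD(2)[OF D] z r) (auto simp: z_def)
  have eq: "l2_norm bG ((Y_adj ^^ n) (D z)) = l2_norm bG ((Y_adj ^^ n) (D (row n u)))"
    "l2_norm bG ((T_p_adj ^^ n) (D z)) = l2_norm bG ((T_p_adj ^^ n) (D (row n u)))"
    using HG.cf_cong_AE[OF HG.H_l2[OF Dz] HG.H_l2[OF Dr] AE]
    by (intro l2_norm_cong_AE HG.H_l2 HG.eq_AE_if_cf_eq Y_adj_funpow T_p_adj_funpow Dz Dr;
        simp add: split_paired_all Y_adj_funpow(2) T_p_adj_funpow(2) Dz Dr)+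
  have "(l2_norm bG x)\<^sup>2 \<le> 1"
    using x(2) by (simp add: power_le_one)
  then have u1: "dsum_norm bG u \<le> 1"
    using u(2) by (simp add: dsum_norm_def)
  obtain c where c: "\<And>n u. u \<in> H2_G \<times> H2_G \<Longrightarrow> dsum_norm bG u \<le> 1 \<Longrightarrow> dsum_norm bG (eta n D u) \<le> c"
    using eta_bounded[OF D] by blast
  have "dsum_norm bG (eta n D u) \<le> dsum_opnorm bG H2_G (eta n D)"
    using le_dsum_opnorm[of "eta n D" c, OF c u(1) u1] by blast
  moreover have "l2_norm bG (fst (eta n D u)) \<le> dsum_norm bG (eta n D u)"
    "l2_norm bG (snd (eta n D u)) \<le> dsum_norm bG (eta n D u)"
    unfolding dsum_norm_def by (intro real_le_rsqrt; simp)+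
  ultimately show ?thesis
    using tail_norm_le[OF Dz, of n] by (simp add: eq eta_row)
qed

text \<open>With P the corner projection, D = (1 - P) D (1 - P) + P D (1 - P) + D P. The first term
  is small by the norm condition; the other two have finite rank and send weakly null sequences to
  norm null ones.\<close>

lemma eta_tendsto_0_imp_null:
  assumes D: "bounded_op bG H2_G D" and eta: "(\<lambda>n. dsum_opnorm bG H2_G (eta n D)) \<longlonglongrightarrow> 0"
    and x: "\<And>k. x k \<in> H2_G" "\<And>k. l2_norm bG (x k) \<le> 1"
    and cf: "\<And>a. (\<lambda>k. l2_inner bG (x k) (hbas a)) \<longlonglongrightarrow> 0"
  shows "(\<lambda>k. l2_norm bG (D (x k))) \<longlonglongrightarrow> 0"
proof (rule tendstoI)
  fix \<epsilon> :: real assume "\<epsilon> > 0"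
  note bl = H2_G_bdd_lin[OF D]
  obtain C where C: "0 \<le> C" "\<And>f. f \<in> H2_G \<Longrightarrow> l2_norm bG (D f) \<le> C * l2_norm bG f"
    using HG.bdd_lin_bound[OF bl] by blast
  \<comment> \<open>The constant 3 of \<open>corner_norm_le\<close> turns this into
    \<open>\<epsilon> / 2\<close>.\<close>
  obtain n where n: "dsum_opnorm bG H2_G (eta n D) < \<epsilon> / 6"
    using order_tendstoD(2)[OF eta, of "\<epsilon> / 6"] \<open>\<epsilon> > 0\<close> by (auto simp: eventually_sequentially)
  define p where "p k = HG.fsum (corner n) (l2_inner bG (x k) \<circ> hbas)" for k
  define z where "z k = (\<lambda>w. x k w - p k w)" for k
  define q where "q k = HG.fsum (corner n) (l2_inner bG (D (z k)) \<circ> hbas)" for k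
  have p: "p k \<in> H2_G" and z: "z k \<in> H2_G" and q: "q k \<in> H2_G" for k
    unfolding p_def z_def q_def by (intro HG.H_diff HG.fsum_H x)+
  note DH = bounded_opD(1)[OF D]
  have fsum0: "(\<lambda>k. l2_norm bG (HG.fsum (corner n) (b k))) \<longlonglongrightarrow> 0" if b: "\<And>a. (\<lambda>k. b k a) \<longlonglongrightarrow> 0" for b :: "nat \<Rightarrow> nat \<times> nat \<Rightarrow> complex"
  proof -
    have "(\<lambda>k. sqrt (\<Sum>a\<in>corner n. (cmod (b k a))\<^sup>2)) \<longlonglongrightarrow> sqrt (\<Sum>a\<in>corner n. (cmod 0)\<^sup>2)"
      by (intro tendsto_intros b)
    then show ?thesis
      by (simp flip: HG.norm_fsum)
  qed
  have plim: "(\<lambda>k. l2_norm bG (p k)) \<longlonglongrightarrow> 0"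
    unfolding p_def by (rule fsum0) (simp add: cf)
  have znorm: "l2_norm bG (z k) \<le> 1" for k
  proof (rule power2_le_imp_le)
    have "(l2_norm bG (z k))\<^sup>2 \<le> (l2_norm bG (x k))\<^sup>2"
      using HG.Bessel_eq[OF HG.H_l2[OF x(1)[of k]] finite_corner, of n] sum_nonneg[of "corner n" "\<lambda>a. (cmod (l2_inner bG (x k) (hbas a)))\<^sup>2"]
      by (simp add: z_def p_def o_def)
    also have "\<dots> \<le> 1\<^sup>2"
      by (intro power_mono x) simp
    finally show "(l2_norm bG (z k))\<^sup>2 \<le> 1\<^sup>2" .
  qed simp
  have zcf: "(\<lambda>k. l2_inner bG (z k) (hbas a)) \<longlonglongrightarrow> 0" for a
  proof (cases "a \<in> corner n")
    case True
    then show ?thesis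
      by (simp add: z_def HG.cf_diff HG.H_l2 x p) (simp add: p_def HG.cf_fsum)
  next
    case False
    then show ?thesis
      using cf[of a] by (simp add: z_def HG.cf_diff HG.H_l2 x p) (simp add: p_def HG.cf_fsum)
  qed
  have qlim: "(\<lambda>k. l2_norm bG (q k)) \<longlonglongrightarrow> 0"
    unfolding q_def
  proof (rule fsum0)
    fix a
    \<comment> \<open>The adjoint turns a coefficient of \<open>D (z k)\<close> into an inner
      product of \<open>z k\<close> with a fixed vector.\<close>
    obtain h where h: "h \<in> H2_G" "\<And>f. f \<in> H2_G \<Longrightarrow> l2_inner bG f h = l2_inner bG (D f) (hbas a)"
      using HG.adjoint_exists[OF bl HG.e_l2] by blast
    have "(\<lambda>k. l2_inner bG (z k) h) \<longlonglongrightarrow> 0"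
      by (rule HG.inner_tendsto_0_if_cf_tendsto_0[OF z znorm zcf h(1)])
    then show "(\<lambda>k. (l2_inner bG (D (z k)) \<circ> hbas) a) \<longlonglongrightarrow> 0"
      by (simp add: h(2) z)
  qed
  have bound: "l2_norm bG (D (x k)) \<le> C * l2_norm bG (p k) + l2_norm bG (q k) + \<epsilon> / 2" for k
  proof -
    have "AE w in bG. D (z k) w = D (x k) w - D (p k) w"
      unfolding z_def by (rule HG.bdd_lin_diff[OF bl x(1) p])
    then have "l2_norm bG (\<lambda>w. D (x k) w - D (p k) w) = l2_norm bG (D (z k))"
      by (intro l2_norm_cong_AE HG.H_l2 HG.H_diff DH x p z) auto
    then have "l2_norm bG (D (x k)) \<le> l2_norm bG (D (z k)) + l2_norm bG (D (p k))"
      using l2_norm_le_diff[OF HG.H_l2[OF DH[OF x(1)]] HG.H_l2[OF DH[OF p]], of k k] by simp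
    moreover have "l2_norm bG (D (z k)) \<le> l2_norm bG (\<lambda>w. D (z k) w - q k w) + l2_norm bG (q k)"
      by (intro l2_norm_le_diff HG.H_l2 DH z q)
    moreover have "l2_norm bG (\<lambda>w. D (z k) w - q k w) \<le> 3 * dsum_opnorm bG H2_G (eta n D)"
      unfolding q_def z_def p_def by (rule corner_norm_le[OF D x])
    ultimately show ?thesis
      using C(2)[OF p[of k]] n by linarith
  qed
  have "(\<lambda>k. C * l2_norm bG (p k) + l2_norm bG (q k)) \<longlonglongrightarrow> C * 0 + 0"
    by (intro tendsto_intros plim qlim)
  then have "\<forall>\<^sub>F k in sequentially. C * l2_norm bG (p k) + l2_norm bG (q k) < \<epsilon> / 2"
    using \<open>\<epsilon> > 0\<close> by (intro order_tendstoD(2)[where y=0]) auto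
  then show "\<forall>\<^sub>F k in sequentially. dist (l2_norm bG (D (x k))) 0 < \<epsilon>"
  proof eventually_elim
    case (elim k)
    then show ?case
      using bound[of k] by simp
  qed
qed

text \<open>A bounded sequence has a weakly convergent subsequence; its difference from the limit is
  weakly null, and \<open>D\<close> makes it null in norm.\<close>

theorem eta_tendsto_0_imp_compact:
  assumes D: "bounded_op bG H2_G D" and eta: "(\<lambda>n. dsum_opnorm bG H2_G (eta n D)) \<longlonglongrightarrow> 0"
  shows "compact_op bG H2_G D"
  unfolding compact_op_def
proof (intro conjI allI impI D)
  fix f :: "nat \<Rightarrow> complex \<times> complex \<Rightarrow> complex"
  assume "(\<forall>n. f n \<in> H2_G) \<and> (\<exists>C. \<forall>n. l2_norm bG (f n) \<le> C)"
  then obtain C where f: "\<And>n. f n \<in> H2_G" "\<And>n. l2_norm bG (f n) \<le> C"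
    by blast
  obtain r g where r: "strict_mono r" "g \<in> H2_G"
      "\<And>a. (\<lambda>k. l2_inner bG (f (r k)) (hbas a)) \<longlonglongrightarrow> l2_inner bG g (hbas a)"
    by (rule HG.bounded_imp_cf_convergent_subsequence[OF f]) (rule that)
  \<comment> \<open>Rescales the differences \<open>f (r k) - g\<close> into the unit ball; the
    summand 1 makes \<open>c\<close> positive.\<close>
  define c where "c = C + l2_norm bG g + 1"
  have c: "c > 0"
    using f(2)[of 0] l2_norm_nonneg[of bG "f 0"] l2_norm_nonneg[of bG g] unfolding c_def by linarith
  define x where "x k = (\<lambda>w. of_real (1 / c) * (f (r k) w - g w))" for k
  have d: "(\<lambda>w. f (r k) w - g w) \<in> H2_G" for k
    by (intro HG.H_diff f r)
  have x: "x k \<in> H2_G" for k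
    unfolding x_def by (intro HG.H_scale d)
  have "l2_norm bG (x k) \<le> 1" for k
  proof -
    have "l2_norm bG (\<lambda>w. f (r k) w - g w) \<le> c"
      using l2_norm_triangle_diff[OF HG.H_l2[OF f(1)[of "r k"]] HG.H_l2[OF r(2)]] f(2)[of "r k"]
      unfolding c_def by linarith
    then show ?thesis
      unfolding x_def l2_norm_scale using c by (simp add: norm_divide)
  qed
  moreover have "(\<lambda>k. l2_inner bG (x k) (hbas a)) \<longlonglongrightarrow> 0" for a
  proof -
    have "(\<lambda>k. of_real (1 / c) * (l2_inner bG (f (r k)) (hbas a) - l2_inner bG g (hbas a)))
        \<longlonglongrightarrow> of_real (1 / c) * (l2_inner bG g (hbas a) - l2_inner bG g (hbas a))"
      by (intro tendsto_intros r)
    then show ?thesis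
      unfolding x_def l2_inner_scale_left by (simp add: HG.cf_diff HG.H_l2 f r)
  qed
  ultimately have "(\<lambda>k. l2_norm bG (D (x k))) \<longlonglongrightarrow> 0"
    by (intro eta_tendsto_0_imp_null[OF D eta x])
  then have "(\<lambda>k. c * l2_norm bG (D (x k))) \<longlonglongrightarrow> 0"
    by (rule tendsto_mult_right_zero)
  moreover have "c * l2_norm bG (D (x k)) = l2_norm bG (\<lambda>w. D (f (r k)) w - D g w)" for k
  proof -
    note DH = bounded_opD(1)[OF D]
    have "AE w in bG. D (x k) w = of_real (1 / c) * D (\<lambda>w. f (r k) w - g w) w"
      unfolding x_def by (rule bounded_opD(4)[OF D d])
    moreover have "AE w in bG. D (\<lambda>w. f (r k) w - g w) w = D (f (r k)) w - D g w"
      by (rule HG.bdd_lin_diff[OF H2_G_bdd_lin[OF D] f(1) r(2)])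
    ultimately have "AE w in bG. D (x k) w = of_real (1 / c) * (D (f (r k)) w - D g w)"
      by eventually_elim simp
    then have "l2_norm bG (D (x k)) = l2_norm bG (\<lambda>w. of_real (1 / c) * (D (f (r k)) w - D g w))"
      by (intro l2_norm_cong_AE HG.H_l2 HG.H_scale HG.H_diff DH x f r)
    then show ?thesis
      unfolding l2_norm_scale using c by (simp add: norm_divide)
  qed
  ultimately have "(\<lambda>k. l2_norm bG (\<lambda>w. D (f (r k)) w - D g w)) \<longlonglongrightarrow> 0"
    by simp
  then show "\<exists>r g. strict_mono r \<and> g \<in> H2_G \<and> (\<lambda>n. l2_norm bG (\<lambda>x. D (f (r n)) x - g x)) \<longlonglongrightarrow> 0"
    using r(1) bounded_opD(1)[OF D r(2)] by blast
qed

section \<open>Operators satisfying the Toeplitz relations\<close>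

lemma hbas_eq: "hbas (i, j) w = snd w ^ i * hsym (Suc j) w"
  by (simp add: hbas_def ebas_def)

text \<open>Keeps products of a merely square-integrable symbol with basis functions in L^2. The
  recurrence of \<open>hsym\<close> gives the bound because |s| \<le> 2 and |p| = 1.\<close>

lemma ebas_bounded: "\<exists>C. AE w in bG. cmod (ebas a w) \<le> C"
proof -
  have "\<exists>C. AE w in bG. cmod (hsym j w) \<le> C" for j
  proof (induction j rule: induct_nat_012)
    case (ge2 j)
    then obtain C C' where *: "AE w in bG. cmod (hsym j w) \<le> C" "AE w in bG. cmod (hsym (Suc j) w) \<le> C'"
      by blast
    from * AE_bG have "AE w in bG. cmod (hsym (Suc (Suc j)) w) \<le> 2 * C' + C"
    proof eventually_elim
      case (elim w)
      have "cmod (hsym (Suc (Suc j)) w) \<le> cmod (fst w) * cmod (hsym (Suc j) w) + cmod (snd w) * cmod (hsym j w)"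
        using norm_triangle_ineq4 by (simp flip: norm_mult)
      also have "\<dots> \<le> 2 * C' + 1 * C"
        using elim by (intro add_mono mult_mono) auto
      finally show ?case
        by simp
    qed
    then show ?case ..
  qed (auto intro!: exI[of _ 1])
  then obtain C where "AE w in bG. cmod (hsym (Suc (snd a)) w) \<le> C"
    by blast
  with AE_bG have "AE w in bG. cmod (ebas a w) \<le> C"
    by eventually_elim (simp add: ebas_def norm_mult norm_power_int)
  then show ?thesis ..
qed

lemma l2_mult_ebas:
  assumes "f \<in> l2 bG"
  shows "(\<lambda>w. f w * ebas a w) \<in> l2 bG"
proof -
  obtain C where "AE w in bG. cmod (ebas a w) \<le> C"
    using ebas_bounded by blast
  then have "(\<lambda>w. ebas a w * f w) \<in> l2 bG"
    by (intro l2_mult_bounded[OF assms]) (simp_all add: bG_measurable)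
  then show ?thesis
    by (simp add: mult.commute)
qed

lemma l2_mult_hbas: "f \<in> l2 bG \<Longrightarrow> (\<lambda>w. f w * hbas a w) \<in> l2 bG"
  unfolding hbas_def by (rule l2_mult_ebas)

lemma l2_mult_snd_power: "f \<in> l2 bG \<Longrightarrow> (\<lambda>w. snd w ^ n * f w) \<in> l2 bG"
  by (induction n) (simp_all add: mult.assoc l2_mult_snd)

lemma inner_snd_power:
  assumes "f \<in> l2 bG" "g \<in> l2 bG"
  shows "l2_inner bG (\<lambda>w. snd w ^ n * f w) (\<lambda>w. snd w ^ n * g w) = l2_inner bG f g"
  by (induction n) (simp_all add: mult.assoc inner_snd_snd l2_mult_snd_power assms)

lemma norm_snd_power: "f \<in> l2 bG \<Longrightarrow> l2_norm bG (\<lambda>w. snd w ^ n * f w) = l2_norm bG f"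
proof -
  assume f: "f \<in> l2 bG"
  have "complex_of_real ((l2_norm bG (\<lambda>w. snd w ^ n * f w))\<^sup>2) = of_real ((l2_norm bG f)\<^sup>2)"
    using inner_snd_power[OF f f, of n] by (simp only: l2_inner_self)
  then show ?thesis
    by (simp only: of_real_eq_iff) simp
qed

lemma ebas_shift_power: "AE w in bG. ebas (i + int n, j) w = snd w ^ n * ebas (i, j) w"
  using AE_bG
proof eventually_elim
  case (elim w)
  then have "snd w \<noteq> 0"
    by auto
  then show ?case
    by (simp add: ebas_def power_int_add)
qed

text \<open>Multiplication by p^m raises every first index by m, which turns a finite sum with
  negative indices into an analytic one.\<close>

lemma LG_fsum_lift:
  assumes "finite F" and nn: "\<And>a. a \<in> F \<Longrightarrow> 0 \<le> fst a + int m"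
  obtains F' c' where "finite F'" "AE w in bG. snd w ^ m * LG.fsum F c w = HG.fsum F' c' w"
proof
  define \<tau> where "\<tau> a = (nat (fst a + int m), snd a)" for a :: "int \<times> nat"
  define c' where "c' a = c (int (fst a) - int m, snd a)" for a :: "nat \<times> nat"
  have c': "c' (\<tau> a) = c a" if "a \<in> F" for a
    using nn[OF that] by (simp add: c'_def \<tau>_def)
  have inj: "inj_on \<tau> F"
  proof (rule inj_onI)
    fix a b assume ab: "a \<in> F" "b \<in> F" "\<tau> a = \<tau> b"
    then have "fst a + int m = fst b + int m"
      using nn[of a] nn[of b] unfolding \<tau>_def by (metis Pair_inject int_nat_eq)
    then show "a = b"
      using ab(3) by (simp add: \<tau>_def prod_eq_iff)
  qed
  show "finite (\<tau> ` F)"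
    using assms(1) by simp
  have "AE w in bG. \<forall>a\<in>F. ebas (fst a + int m, snd a) w = snd w ^ m * ebas a w"
    using assms(1) ebas_shift_power[of _ m] by (intro AE_finite_allI) auto
  then show "AE w in bG. snd w ^ m * LG.fsum F c w = HG.fsum (\<tau> ` F) c' w"
  proof eventually_elim
    case (elim w)
    have "HG.fsum (\<tau> ` F) c' w = (\<Sum>a\<in>F. c' (\<tau> a) * hbas (\<tau> a) w)"
      unfolding HG.fsum_def by (simp add: sum.reindex[OF inj])
    also have "\<dots> = (\<Sum>a\<in>F. snd w ^ m * (c a * ebas a w))"
    proof (rule sum.cong[OF refl])
      fix a assume a: "a \<in> F"
      then have "hbas (\<tau> a) w = ebas (fst a + int m, snd a) w"
        using nn[OF a] by (simp add: hbas_def \<tau>_def)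
      then show "c' (\<tau> a) * hbas (\<tau> a) w = snd w ^ m * (c a * ebas a w)"
        using elim a by (simp add: c')
    qed
    finally show ?case
      unfolding LG.fsum_def by (simp add: sum_distrib_left)
  qed
qed

section \<open>Recovering the symbol from the two relations\<close>

context
  fixes B :: "(complex \<times> complex \<Rightarrow> complex) \<Rightarrow> complex \<times> complex \<Rightarrow> complex"
  assumes B: "bounded_op bG H2_G B"
    and B_p: "\<And>f g. f \<in> H2_G \<Longrightarrow> g \<in> H2_G \<Longrightarrow> l2_inner bG (B (T_p f)) (T_p g) = l2_inner bG (B f) g"
    and B_s: "\<And>f g. f \<in> H2_G \<Longrightarrow> g \<in> H2_G \<Longrightarrow> l2_inner bG (B (T_s f)) g = l2_inner bG (B (T_p f)) (T_s g)"
begin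

lemma B_H: "f \<in> H2_G \<Longrightarrow> B f \<in> H2_G"
  by (rule bounded_opD(1)[OF B])

lemma B_l2: "f \<in> H2_G \<Longrightarrow> B f \<in> l2 bG"
  by (intro HG.H_l2 B_H)

lemma inner_B_cong:
  assumes "f \<in> H2_G" "f' \<in> H2_G" "g \<in> H2_G" "g' \<in> H2_G"
    and "AE w in bG. f w = f' w" "AE w in bG. g w = g' w"
  shows "l2_inner bG (B f) g = l2_inner bG (B f') g'"
  using assms by (intro l2_inner_cong_AE B_l2 bounded_opD(2)[OF B]) (auto intro: HG.H_l2)

lemma B_snd:
  assumes "f \<in> H2_G" "g \<in> H2_G"
  shows "l2_inner bG (B (\<lambda>w. snd w * f w)) (\<lambda>w. snd w * g w) = l2_inner bG (B f) g"
proof -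
  have "l2_inner bG (B (T_p f)) (T_p g) = l2_inner bG (B (\<lambda>w. snd w * f w)) (\<lambda>w. snd w * g w)"
    by (intro inner_B_cong T_p H2_G_mult_snd assms)
  then show ?thesis
    using B_p[OF assms] by simp
qed

lemma B_fst:
  assumes "f \<in> H2_G" "g \<in> H2_G"
  shows "l2_inner bG (B (\<lambda>w. fst w * f w)) g = l2_inner bG (B (\<lambda>w. snd w * f w)) (\<lambda>w. fst w * g w)"
proof -
  have "l2_inner bG (B (T_s f)) g = l2_inner bG (B (\<lambda>w. fst w * f w)) g"
    by (intro inner_B_cong T_s H2_G_mult_fst assms) simp
  moreover have "l2_inner bG (B (T_p f)) (T_s g) = l2_inner bG (B (\<lambda>w. snd w * f w)) (\<lambda>w. fst w * g w)"
    by (intro inner_B_cong T_p T_s H2_G_mult_fst H2_G_mult_snd assms)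
  ultimately show ?thesis
    using B_s[OF assms] by simp
qed

text \<open>The Fourier coefficients of the symbol \<open>lim p\<^sup>-\<^sup>m B p\<^sup>m\<close>; they are eventually constant in \<open>m\<close>.\<close>

definition symbol_coeff :: "nat \<Rightarrow> int \<times> nat \<Rightarrow> complex" where
  "symbol_coeff m a = l2_inner bG (B (hbas (m, 0))) (hbas (nat (fst a + int m), snd a))"

text \<open>Raising m by one multiplies both basis functions by p, which \<open>B_snd\<close>
  cancels. The lower bound on m keeps \<open>nat\<close> from truncating.\<close>

lemma symbol_coeff_eq:
  assumes "nat (- fst a) \<le> m"
  shows "symbol_coeff m a = symbol_coeff (nat (- fst a)) a"
  using assms
proof (induction m rule: nat_induct_at_least)
  case (Suc m)
  have S: "hbas (Suc i, j) = (\<lambda>w. snd w * hbas (i, j) w)" for i j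
    by (simp add: fun_eq_iff hbas_eq)
  have "nat (fst a + int (Suc m)) = Suc (nat (fst a + int m))"
    using Suc.hyps by simp
  then have "symbol_coeff (Suc m) a = symbol_coeff m a"
    unfolding symbol_coeff_def by (simp only: S B_snd HG.e_H)
  then show ?case
    using Suc.IH by simp
qed simp

text \<open>For large m, finitely many of the limiting coefficients are all coefficients of the
  single vector \<open>B\<close> of p^m, whose norm is at most that of \<open>B\<close>; so Bessel's
  inequality makes them square summable.\<close>

lemma symbol_exists:
  obtains \<phi> where "\<phi> \<in> l2 bG" "\<And>a m. nat (- fst a) \<le> m \<Longrightarrow> l2_inner bG \<phi> (ebas a) = symbol_coeff m a"
proof -
  obtain C where C: "0 \<le> C" "\<And>f. f \<in> H2_G \<Longrightarrow> l2_norm bG (B f) \<le> C * l2_norm bG f"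
    using HG.bdd_lin_bound[OF H2_G_bdd_lin[OF B]] by blast
  have hn: "(l2_norm bG (hbas a))\<^sup>2 = 1" for a
    using HG.norm_fsum[of "{a}" "\<lambda>_. 1"] by (simp add: HG.fsum_def)
  have "(\<Sum>a\<in>F. (cmod (symbol_coeff (nat (- fst a)) a))\<^sup>2) \<le> C\<^sup>2" if F: "finite F" for F
  proof -
    \<comment> \<open>The sum is a common upper bound for the finitely many shifts.\<close>
    define m where "m = (\<Sum>a\<in>F. nat (- fst a))"
    have m: "nat (- fst a) \<le> m" if "a \<in> F" for a
      unfolding m_def using that F by (intro member_le_sum) auto
    define \<tau> where "\<tau> a = (nat (fst a + int m), snd a)" for a :: "int \<times> nat"
    have inj: "inj_on \<tau> F"
    proof (rule inj_onI)
      fix a b assume ab: "a \<in> F" "b \<in> F" "\<tau> a = \<tau> b"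
      have "0 \<le> fst a + int m" "0 \<le> fst b + int m"
        using m[OF ab(1)] m[OF ab(2)] by linarith+
      moreover have "nat (fst a + int m) = nat (fst b + int m)"
        using ab(3) by (simp add: \<tau>_def)
      ultimately have "fst a = fst b"
        by (simp add: eq_nat_nat_iff)
      then show "a = b"
        using ab(3) by (simp add: \<tau>_def prod_eq_iff)
    qed
    have "(\<Sum>a\<in>F. (cmod (symbol_coeff (nat (- fst a)) a))\<^sup>2) = (\<Sum>a\<in>F. (cmod (symbol_coeff m a))\<^sup>2)"
      by (intro sum.cong refl) (simp add: symbol_coeff_eq[OF m])
    also have "\<dots> = (\<Sum>b\<in>\<tau> ` F. (cmod (l2_inner bG (B (hbas (m, 0))) (hbas b)))\<^sup>2)"
      unfolding sum.reindex[OF inj] by (simp add: symbol_coeff_def \<tau>_def)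
    also have "\<dots> \<le> (l2_norm bG (B (hbas (m, 0))))\<^sup>2"
      using F by (intro HG.Bessel B_l2 HG.e_H) simp
    also have "\<dots> \<le> (C * l2_norm bG (hbas (m, 0)))\<^sup>2"
      by (intro power_mono C HG.e_H) simp
    finally show ?thesis
      by (simp add: power_mult_distrib hn)
  qed
  then have "(\<lambda>a. (cmod (symbol_coeff (nat (- fst a)) a))\<^sup>2) summable_on UNIV"
    by (intro nonneg_bdd_above_summable_on) (auto simp: bdd_above_def)
  then obtain \<phi> where \<phi>: "\<phi> \<in> l2 bG" "\<And>a. l2_inner bG \<phi> (ebas a) = symbol_coeff (nat (- fst a)) a"
    by (rule LG.H_with_cf) (rule that)
  have "l2_inner bG \<phi> (ebas a) = symbol_coeff m a" if "nat (- fst a) \<le> m" for a m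
    using \<phi>(2)[of a] symbol_coeff_eq[OF that] by (rule trans[OF _ sym])
  with \<phi>(1) show thesis
    by (rule that)
qed

context
  fixes \<phi> :: "complex \<times> complex \<Rightarrow> complex"
  assumes \<phi>: "\<phi> \<in> l2 bG"
    and symbol: "\<And>a m. nat (- fst a) \<le> m \<Longrightarrow> l2_inner bG \<phi> (ebas a) = symbol_coeff m a"
begin

text \<open>\<open>hbas (i, 0)\<close> is p^i, so the coefficients on both sides are symbol
  coefficients with the first index lowered by i; on the right this uses |p| = 1.\<close>

lemma symbol_inner_snd_power:
  assumes g: "g \<in> H2_G"
  shows "l2_inner bG (B (hbas (i, 0))) g = l2_inner bG (\<lambda>w. \<phi> w * hbas (i, 0) w) g"
proof (rule HG.inner_eq_if_cf_eq[OF B_l2[OF HG.e_H] l2_mult_hbas[OF \<phi>] _ g])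
  fix a :: "nat \<times> nat"
  obtain k j where a: "a = (k, j)"
    by force
  let ?c = "(int k - int i, j)"
  have "AE w in bG. hbas a w = snd w ^ i * ebas ?c w"
    using ebas_shift_power[of "int k - int i" i j] by (simp add: a hbas_def)
  moreover have "(\<lambda>w. \<phi> w * hbas (i, 0) w) = (\<lambda>w. snd w ^ i * \<phi> w)"
    by (simp add: fun_eq_iff hbas_eq)
  ultimately have "l2_inner bG (\<lambda>w. \<phi> w * hbas (i, 0) w) (hbas a)
      = l2_inner bG (\<lambda>w. snd w ^ i * \<phi> w) (\<lambda>w. snd w ^ i * ebas ?c w)"
    by (simp only:) (intro l2_inner_cong_AE l2_mult_snd_power \<phi> ebas_l2 HG.e_l2; simp)
  also have "\<dots> = symbol_coeff i ?c"
    by (simp add: inner_snd_power \<phi> ebas_l2 symbol)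
  finally show "l2_inner bG (B (hbas (i, 0))) (hbas a) = l2_inner bG (\<lambda>w. \<phi> w * hbas (i, 0) w) (hbas a)"
    by (simp add: symbol_coeff_def a)
qed

text \<open>Induction on the second index by the recurrence of \<open>hsym\<close>.
  \<open>B_fst\<close> trades the factor s for a factor p and moves s to \<open>g\<close>, which is
  why the first index and \<open>g\<close> vary in the induction.\<close>

lemma symbol_inner_hbas:
  assumes "g \<in> H2_G"
  shows "l2_inner bG (B (hbas a)) g = l2_inner bG (\<lambda>w. \<phi> w * hbas a w) g"
proof -
  \<comment> \<open>Starting at \<open>hsym 0 = 0\<close> gives the two-step recurrence a trivial
    first base case.\<close>
  define hs where "hs i j = (\<lambda>w :: complex \<times> complex. snd w ^ i * hsym j w)" for i j
  have hs_Suc: "hs i (Suc j) = hbas (i, j)" for i j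
    by (simp add: fun_eq_iff hs_def hbas_eq)
  have hs_0: "hs i 0 = (\<lambda>w. 0)" for i
    by (simp add: hs_def)
  have hs_H: "hs i j \<in> H2_G" for i j
    by (cases j) (simp_all add: hs_0 hs_Suc HG.H_zero HG.e_H)
  have \<phi>hs: "(\<lambda>w. \<phi> w * hs i j w) \<in> l2 bG" for i j
    by (cases j) (simp_all add: hs_0 hs_Suc l2_zero l2_mult_hbas \<phi>)
  have "l2_inner bG (B (hs i j)) g = l2_inner bG (\<lambda>w. \<phi> w * hs i j w) g" if "g \<in> H2_G" for i j g
    using that
  proof (induction j arbitrary: i g rule: induct_nat_012)
    case 0
    have "AE w in bG. B (\<lambda>w. 0 * 0) w = 0 * B (\<lambda>w. 0) w"
      by (rule bounded_opD(4)[OF B HG.H_zero])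
    then have "l2_inner bG (B (\<lambda>w. 0)) g = 0"
      using 0 by (intro l2_inner_AE_0 B_l2 HG.H_zero HG.H_l2) auto
    then show ?case
      by (simp add: hs_0 l2_inner_zero_left)
  next
    case 1
    then show ?case
      by (simp add: hs_Suc symbol_inner_snd_power)
  next
    case (ge2 j)
    let ?F = "hs i (Suc j)"
    note g = \<open>g \<in> H2_G\<close>
    have sF: "(\<lambda>w. fst w * ?F w) \<in> H2_G"
      by (rule H2_G_mult_fst[OF hs_H])
    have rec: "hs i (Suc (Suc j)) = (\<lambda>w. fst w * ?F w - hs (Suc i) j w)"
      by (simp add: fun_eq_iff hs_def algebra_simps)
    have pF: "(\<lambda>w. snd w * ?F w) = hs (Suc i) (Suc j)"
      by (simp add: fun_eq_iff hs_def)
    have "l2_inner bG (B (\<lambda>w. fst w * ?F w)) g = l2_inner bG (B (hs (Suc i) (Suc j))) (\<lambda>w. fst w * g w)"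
      unfolding B_fst[OF hs_H g] pF ..
    also have "\<dots> = l2_inner bG (\<lambda>w. \<phi> w * hs (Suc i) (Suc j) w) (\<lambda>w. fst w * g w)"
      by (intro ge2.IH H2_G_mult_fst g)
    also have "\<dots> = l2_inner bG (\<lambda>w. snd w * (\<phi> w * ?F w)) (\<lambda>w. fst w * g w)"
      by (simp add: pF[symmetric] mult.left_commute)
    also have "\<dots> = l2_inner bG (\<lambda>w. fst w * (\<phi> w * ?F w)) g"
      by (intro inner_snd_fst \<phi>hs HG.H_l2 g)
    finally have s: "l2_inner bG (B (\<lambda>w. fst w * ?F w)) g = l2_inner bG (\<lambda>w. fst w * (\<phi> w * ?F w)) g" .
    have "AE w in bG. B (hs i (Suc (Suc j))) w = B (\<lambda>w. fst w * ?F w) w - B (hs (Suc i) j) w"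
      unfolding rec by (rule HG.bdd_lin_diff[OF H2_G_bdd_lin[OF B] sF hs_H])
    then have "l2_inner bG (B (hs i (Suc (Suc j)))) g
        = l2_inner bG (\<lambda>w. B (\<lambda>w. fst w * ?F w) w - B (hs (Suc i) j) w) g"
      by (intro l2_inner_cong_AE B_l2 l2_diff HG.H_l2 g sF hs_H) auto
    also have "\<dots> = l2_inner bG (\<lambda>w. fst w * (\<phi> w * ?F w)) g - l2_inner bG (\<lambda>w. \<phi> w * hs (Suc i) j w) g"
      by (simp add: l2_inner_diff_left B_l2 sF hs_H HG.H_l2 g s ge2.IH)
    also have "\<dots> = l2_inner bG (\<lambda>w. fst w * (\<phi> w * ?F w) - \<phi> w * hs (Suc i) j w) g"
      by (intro l2_inner_diff_left[symmetric] l2_mult_fst \<phi>hs HG.H_l2 g)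
    finally show ?case
      by (simp add: rec algebra_simps)
  qed
  from this[OF assms, of "fst a" "Suc (snd a)"] show ?thesis
    by (simp add: hs_Suc)
qed

lemma symbol_inner_fsum:
  assumes g: "g \<in> H2_G" and F: "finite F"
  shows "l2_inner bG (B (HG.fsum F c)) g = l2_inner bG (\<lambda>w. \<phi> w * HG.fsum F c w) g"
proof -
  have "l2_inner bG (B (HG.fsum F c)) g = l2_inner bG (\<lambda>w. \<Sum>a\<in>F. c a * B (hbas a) w) g"
    using HG.bdd_lin_sum[OF H2_G_bdd_lin[OF B] HG.e_H F, where c=c]
    by (intro l2_inner_cong_AE B_l2 HG.fsum_H l2_sum l2_scale HG.e_H HG.H_l2[OF g]) (auto simp: HG.fsum_def)
  also have "\<dots> = (\<Sum>a\<in>F. c a * l2_inner bG (\<lambda>w. \<phi> w * hbas a w) g)"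
    by (simp add: l2_inner_sum_left l2_scale B_l2 HG.e_H HG.H_l2 g l2_inner_scale_left symbol_inner_hbas)
  also have "\<dots> = l2_inner bG (\<lambda>w. \<Sum>a\<in>F. c a * (\<phi> w * hbas a w)) g"
    by (simp add: l2_inner_sum_left l2_scale l2_mult_hbas \<phi> HG.H_l2 g l2_inner_scale_left)
  also have "(\<lambda>w. \<Sum>a\<in>F. c a * (\<phi> w * hbas a w)) = (\<lambda>w. \<phi> w * HG.fsum F c w)"
    by (simp add: HG.fsum_def sum_distrib_left mult_ac)
  finally show ?thesis .
qed

lemma l2_mult_LG_fsum: "f \<in> l2 bG \<Longrightarrow> (\<lambda>w. f w * LG.fsum F c w) \<in> l2 bG"
proof -
  assume f: "f \<in> l2 bG"
  have "(\<lambda>w. \<Sum>a\<in>F. c a * (f w * ebas a w)) \<in> l2 bG"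
    by (intro l2_sum l2_scale l2_mult_ebas f)
  then show ?thesis
    by (simp add: LG.fsum_def sum_distrib_left mult_ac)
qed

lemma l2_mult_HG_fsum: "f \<in> l2 bG \<Longrightarrow> (\<lambda>w. f w * HG.fsum F c w) \<in> l2 bG"
proof -
  assume f: "f \<in> l2 bG"
  have "(\<lambda>w. \<Sum>a\<in>F. c a * (f w * hbas a w)) \<in> l2 bG"
    by (intro l2_sum l2_scale l2_mult_hbas f)
  then show ?thesis
    by (simp add: HG.fsum_def sum_distrib_left mult_ac)
qed

text \<open>Multiplying both sums by the same unimodular p^m changes neither norms nor inner
  products and brings them into the Hardy space, where the form is that of \<open>B\<close>.\<close>

lemma symbol_form_bound:
  assumes C: "0 \<le> C" "\<And>f. f \<in> H2_G \<Longrightarrow> l2_norm bG (B f) \<le> C * l2_norm bG f"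
    and F: "finite F" and F': "finite F'"
  shows "cmod (l2_inner bG (\<lambda>w. \<phi> w * LG.fsum F c w) (LG.fsum F' c'))
    \<le> C * l2_norm bG (LG.fsum F c) * l2_norm bG (LG.fsum F' c')"
proof -
  let ?q = "LG.fsum F c" and ?r = "LG.fsum F' c'"
  define m where "m = (\<Sum>a\<in>F \<union> F'. nat (- fst a))"
  have "nat (- fst a) \<le> m" if "a \<in> F \<union> F'" for a
    unfolding m_def using that F F' by (intro member_le_sum) auto
  then have nn: "0 \<le> fst a + int m" if "a \<in> F \<union> F'" for a
    using that by fastforce
  obtain F1 c1 where q1: "finite F1" "AE w in bG. snd w ^ m * ?q w = HG.fsum F1 c1 w"
    using LG_fsum_lift[OF F, of m c] nn by auto
  obtain F2 c2 where r1: "finite F2" "AE w in bG. snd w ^ m * ?r w = HG.fsum F2 c2 w"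
    using LG_fsum_lift[OF F', of m c'] nn by auto
  let ?q1 = "HG.fsum F1 c1" and ?r1 = "HG.fsum F2 c2"
  have norms: "l2_norm bG ?q1 = l2_norm bG ?q" "l2_norm bG ?r1 = l2_norm bG ?r"
    using q1(2) r1(2) by (subst norm_snd_power[OF LG.fsum_l2, symmetric, of _ _ m],
        intro l2_norm_cong_AE HG.fsum_l2 l2_mult_snd_power LG.fsum_l2, auto)+
  have "l2_inner bG (\<lambda>w. \<phi> w * ?q w) ?r = l2_inner bG (\<lambda>w. snd w ^ m * (\<phi> w * ?q w)) (\<lambda>w. snd w ^ m * ?r w)"
    by (intro inner_snd_power[symmetric] l2_mult_LG_fsum \<phi> LG.fsum_l2)
  also have "\<dots> = l2_inner bG (\<lambda>w. \<phi> w * ?q1 w) ?r1"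
  proof (rule l2_inner_cong_AE)
    show "AE w in bG. snd w ^ m * (\<phi> w * ?q w) = \<phi> w * ?q1 w"
      using q1(2) by eventually_elim (metis mult.left_commute)
  qed (intro l2_mult_snd_power l2_mult_LG_fsum l2_mult_HG_fsum \<phi> LG.fsum_l2 HG.fsum_l2 r1)+
  also have "\<dots> = l2_inner bG (B ?q1) ?r1"
    by (rule symbol_inner_fsum[OF HG.fsum_H q1(1), symmetric])
  also have "cmod \<dots> \<le> l2_norm bG (B ?q1) * l2_norm bG ?r1"
    by (intro l2_Cauchy_Schwarz B_l2 HG.fsum_H HG.fsum_l2)
  also have "\<dots> \<le> C * l2_norm bG ?q1 * l2_norm bG ?r1"
    by (intro mult_right_mono C HG.fsum_H) simp
  finally show ?thesis
    by (simp add: norms)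
qed

text \<open>Duality: the finite sums approximating the product itself are admissible test vectors in
  the form bound.\<close>

lemma symbol_mult_bound:
  assumes C: "0 \<le> C" "\<And>f. f \<in> H2_G \<Longrightarrow> l2_norm bG (B f) \<le> C * l2_norm bG f" and F: "finite F"
  shows "l2_norm bG (\<lambda>w. \<phi> w * LG.fsum F c w) \<le> C * l2_norm bG (LG.fsum F c)"
proof -
  define h where "h = (\<lambda>w. \<phi> w * LG.fsum F c w)"
  have h: "h \<in> l2 bG"
    unfolding h_def by (rule l2_mult_LG_fsum[OF \<phi>])
  let ?K = "C * l2_norm bG (LG.fsum F c)"
  obtain G where G: "\<And>n. finite (G n)" "(\<lambda>n::nat. l2_norm bG (\<lambda>x. LG.fsum (G n) (\<lambda>a. l2_inner bG h (ebas a)) x - h x)) \<longlonglongrightarrow> 0"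
    using LG.fsum_seq_tendsto[OF h] by blast
  let ?r = "\<lambda>n. LG.fsum (G n) (\<lambda>a. l2_inner bG h (ebas a))"
  have "(\<lambda>n. cmod (l2_inner bG (?r n) h)) \<longlonglongrightarrow> cmod (l2_inner bG h h)"
    by (intro tendsto_norm l2_inner_tendsto[OF LG.fsum_l2 h h G(2)])
  moreover have "(\<lambda>n. ?K * l2_norm bG (?r n)) \<longlonglongrightarrow> ?K * l2_norm bG h"
    by (intro tendsto_mult tendsto_const l2_norm_tendsto[OF LG.fsum_l2 h G(2)])
  moreover have "cmod (l2_inner bG (?r n) h) \<le> ?K * l2_norm bG (?r n)" for n
    using symbol_form_bound[OF C F G(1)[of n]]
    by (simp add: h_def l2_inner_commute[of bG "?r n"] l2_inner_commute[of bG "LG.fsum (G n) _"])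
  ultimately have "cmod (l2_inner bG h h) \<le> ?K * l2_norm bG h"
    by (intro LIMSEQ_le) auto
  moreover have "cmod (l2_inner bG h h) = l2_norm bG h * l2_norm bG h"
    by (simp add: l2_inner_self power2_eq_square norm_mult)
  moreover have "0 \<le> ?K"
    using C(1) by simp
  ultimately have "l2_norm bG h \<le> ?K"
    using l2_norm_nonneg[of bG h] by (cases "l2_norm bG h = 0") (auto dest: mult_right_le_imp_le)
  then show ?thesis
    by (simp add: h_def)
qed

text \<open>On the set \<open>A\<close> where |\<phi>| exceeds \<open>C\<close>, testing the
  multiplication bound with the indicator of \<open>A\<close> and the phase of \<phi> on
  \<open>A\<close> gives that the integral of |\<phi>| over \<open>A\<close> is at most
  \<open>C\<close> times the measure of \<open>A\<close>; hence \<open>A\<close> is null.\<close>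

lemma symbol_bounded:
  assumes C: "0 \<le> C" "\<And>f. f \<in> H2_G \<Longrightarrow> l2_norm bG (B f) \<le> C * l2_norm bG f"
  shows "AE w in bG. cmod (\<phi> w) \<le> C"
proof -
  have [measurable]: "\<phi> \<in> borel_measurable borel"
    by (rule l2_bG_measurable[OF \<phi>])
  define A where "A = {w. C < cmod (\<phi> w)}"
  have [measurable]: "A \<in> sets borel"
    unfolding A_def by measurable
  define q :: "complex \<times> complex \<Rightarrow> complex" where "q w = of_real (indicator A w)" for w
  define r where "r w = q w * (\<phi> w / of_real (cmod (\<phi> w)))" for w
  have [measurable]: "q \<in> borel_measurable borel" "r \<in> borel_measurable borel"
    unfolding q_def[abs_def] r_def[abs_def] by measurable
  have r1: "cmod (r w) \<le> 1" for w
    by (simp add: r_def q_def norm_mult norm_divide indicator_def)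
  have ql2: "q \<in> l2 bG" and rl2: "r \<in> l2 bG"
    using r1 by (auto intro!: bG.l2_bounded[where C=1] simp: bG_measurable q_def indicator_def)
  have cnj\<phi>: "(\<lambda>w. cnj (\<phi> w)) \<in> l2 bG"
    using l2D(2)[OF \<phi>] by (simp add: l2_def bG_measurable)
  \<comment> \<open>Attached to the bounded factor \<open>r\<close>, the symbol yields a fixed
    element of L^2, so the limit over finite sums approximating \<open>q\<close> can be
    taken.\<close>
  have \<phi>r: "(\<lambda>w. r w * cnj (\<phi> w)) \<in> l2 bG"
    using r1 by (intro l2_mult_bounded[OF cnj\<phi>, where C=1]) (simp_all add: bG_measurable)
  obtain F where F: "\<And>n. finite (F n)" "(\<lambda>n::nat. l2_norm bG (\<lambda>x. LG.fsum (F n) (\<lambda>a. l2_inner bG q (ebas a)) x - q x)) \<longlonglongrightarrow> 0"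
    using LG.fsum_seq_tendsto[OF ql2] by blast
  let ?q = "\<lambda>n. LG.fsum (F n) (\<lambda>a. l2_inner bG q (ebas a))"
  have "(\<lambda>n. cmod (l2_inner bG (?q n) (\<lambda>w. r w * cnj (\<phi> w)))) \<longlonglongrightarrow> cmod (l2_inner bG q (\<lambda>w. r w * cnj (\<phi> w)))"
    by (intro tendsto_norm l2_inner_tendsto[OF LG.fsum_l2 ql2 \<phi>r F(2)])
  moreover have "(\<lambda>n. C * l2_norm bG (?q n) * l2_norm bG r) \<longlonglongrightarrow> C * l2_norm bG q * l2_norm bG r"
    by (intro tendsto_mult tendsto_const l2_norm_tendsto[OF LG.fsum_l2 ql2 F(2)])
  moreover have "cmod (l2_inner bG (?q n) (\<lambda>w. r w * cnj (\<phi> w))) \<le> C * l2_norm bG (?q n) * l2_norm bG r" for n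
  proof -
    have "l2_inner bG (?q n) (\<lambda>w. r w * cnj (\<phi> w)) = l2_inner bG (\<lambda>w. \<phi> w * ?q n w) r"
      by (simp add: l2_inner_def mult_ac)
    also have "cmod \<dots> \<le> l2_norm bG (\<lambda>w. \<phi> w * ?q n w) * l2_norm bG r"
      by (intro l2_Cauchy_Schwarz l2_mult_LG_fsum \<phi> rl2)
    also have "\<dots> \<le> C * l2_norm bG (?q n) * l2_norm bG r"
      by (intro mult_right_mono symbol_mult_bound[OF C F(1)]) simp_all
    finally show ?thesis .
  qed
  ultimately have le: "cmod (l2_inner bG q (\<lambda>w. r w * cnj (\<phi> w))) \<le> C * l2_norm bG q * l2_norm bG r"
    by (intro LIMSEQ_le) auto
  have "(cmod (r w))\<^sup>2 = indicator A w" "(cmod (q w))\<^sup>2 = indicator A w" for w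
    using C(1) by (auto simp: r_def q_def norm_mult norm_divide indicator_def A_def)
  then have "C * l2_norm bG q * l2_norm bG r = C * (\<integral>w. indicator A w \<partial>bG)"
    unfolding l2_norm_def by simp
  also have "\<dots> = (\<integral>w. C * indicator A w \<partial>bG)"
    by simp
  finally have rhs: "C * l2_norm bG q * l2_norm bG r = (\<integral>w. C * indicator A w \<partial>bG)" .
  have "q w * cnj (r w * cnj (\<phi> w)) = of_real (indicator A w * cmod (\<phi> w))" for w
  proof (cases "w \<in> A")
    case True
    then have "cmod (\<phi> w) \<noteq> 0"
      using C(1) by (auto simp: A_def)
    then show ?thesis
      using True complex_norm_square[of "\<phi> w"] by (simp add: r_def q_def power2_eq_square field_simps)
  qed (simp add: q_def)
  then have "l2_inner bG q (\<lambda>w. r w * cnj (\<phi> w)) = of_real (\<integral>w. indicator A w * cmod (\<phi> w) \<partial>bG)"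
    unfolding l2_inner_def by (simp only: integral_complex_of_real)
  then have le': "(\<integral>w. indicator A w * cmod (\<phi> w) \<partial>bG) \<le> (\<integral>w. C * indicator A w \<partial>bG)"
    using le rhs by simp
  have i1: "integrable bG (\<lambda>w. indicator A w * cmod (\<phi> w))"
    using integrable_mult_indicator[OF _ integrable_norm[OF bG.l2_integrable[OF \<phi>]], of A] by simp
  have i2: "integrable bG (\<lambda>w. C * indicator A w)"
    by (intro integrable_mult_right) (simp add: bG.emeasure_finite less_top[symmetric])
  have nn: "0 \<le> indicator A w * cmod (\<phi> w) - C * indicator A w" for w
    by (auto simp: indicator_def A_def)
  have "(\<integral>w. indicator A w * cmod (\<phi> w) - C * indicator A w \<partial>bG) \<le> 0"
    using le' i1 i2 by simp
  moreover have "0 \<le> (\<integral>w. indicator A w * cmod (\<phi> w) - C * indicator A w \<partial>bG)"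
    by (intro integral_nonneg_AE AE_I2 nn)
  ultimately have "AE w in bG. indicator A w * cmod (\<phi> w) - C * indicator A w = 0"
    using i1 i2 nn by (subst integral_nonneg_eq_0_iff_AE[symmetric]) auto
  then show ?thesis
    by eventually_elim (auto simp: A_def indicator_def split: if_splits)
qed

text \<open>Once \<phi> is bounded, both sides are continuous in \<open>f\<close>, so agreement on
  finite sums extends to the whole Hardy space.\<close>

lemma B_eq_toeplitz: "\<phi> \<in> Linfty_bG" "f \<in> H2_G \<Longrightarrow> AE w in bG. B f w = toeplitz \<phi> f w"
proof -
  obtain C where C: "0 \<le> C" "\<And>f. f \<in> H2_G \<Longrightarrow> l2_norm bG (B f) \<le> C * l2_norm bG f"
    using HG.bdd_lin_bound[OF H2_G_bdd_lin[OF B]] by blast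
  note bnd = symbol_bounded[OF C]
  have [measurable]: "\<phi> \<in> borel_measurable borel"
    by (rule l2_bG_measurable[OF \<phi>])
  have "AE w in nu. cmod (\<phi> w) \<le> C"
    using bnd by (subst AE_nu_iff_bG) auto
  then show "\<phi> \<in> Linfty_bG"
    by (auto simp: Linfty_bG_def measurable_cong_sets[OF sets_nu refl])
  assume f: "f \<in> H2_G"
  have \<phi>f: "(\<lambda>w. \<phi> w * f w) \<in> l2 bG"
    using bnd by (intro l2_mult_bounded[OF HG.H_l2[OF f]]) (simp_all add: bG_measurable)
  show "AE w in bG. B f w = toeplitz \<phi> f w"
    unfolding toeplitz_def
  proof (intro HG.eq_AE_if_cf_eq B_H f HG.l2_proj(1) \<phi>f)
    fix a
    have cnj\<phi>: "(\<lambda>w. cnj (\<phi> w) * hbas a w) \<in> l2 bG"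
      using bnd by (intro l2_mult_bounded[OF HG.e_l2]) (simp_all add: bG_measurable)
    have mv: "l2_inner bG h (\<lambda>w. cnj (\<phi> w) * hbas a w) = l2_inner bG (\<lambda>w. \<phi> w * h w) (hbas a)" for h
      by (simp add: l2_inner_def mult_ac)
    obtain F where F: "\<And>n. finite (F n)" "(\<lambda>n::nat. l2_norm bG (\<lambda>x. HG.fsum (F n) (\<lambda>a. l2_inner bG f (hbas a)) x - f x)) \<longlonglongrightarrow> 0"
      using HG.fsum_seq_tendsto[OF f] by blast
    let ?f = "\<lambda>n. HG.fsum (F n) (\<lambda>a. l2_inner bG f (hbas a))"
    have "(\<lambda>n. l2_inner bG (B (?f n)) (hbas a)) \<longlonglongrightarrow> l2_inner bG (B f) (hbas a)"
      by (rule HG.bdd_lin_inner_tendsto[OF H2_G_bdd_lin[OF B] HG.fsum_H f HG.e_l2 F(2)])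
    moreover have "(\<lambda>n. l2_inner bG (?f n) (\<lambda>w. cnj (\<phi> w) * hbas a w)) \<longlonglongrightarrow> l2_inner bG f (\<lambda>w. cnj (\<phi> w) * hbas a w)"
      by (rule l2_inner_tendsto[OF HG.fsum_l2 HG.H_l2[OF f] cnj\<phi> F(2)])
    ultimately have "l2_inner bG (B f) (hbas a) = l2_inner bG (\<lambda>w. \<phi> w * f w) (hbas a)"
      unfolding mv using symbol_inner_fsum[OF HG.e_H F(1)] by (simp add: LIMSEQ_unique)
    then show "l2_inner bG (B f) (hbas a) = l2_inner bG (l2_proj bG H2_G (\<lambda>w. \<phi> w * f w)) (hbas a)"
      by (simp add: HG.l2_proj(2)[OF \<phi>f HG.e_H])
  qed
qed

end

theorem toeplitz_if_relations: "is_toeplitz B"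
proof -
  obtain \<phi> where \<phi>: "\<phi> \<in> l2 bG" "\<And>a m. nat (- fst a) \<le> m \<Longrightarrow> l2_inner bG \<phi> (ebas a) = symbol_coeff m a"
    using symbol_exists by blast
  show ?thesis
    unfolding is_toeplitz_def using B B_eq_toeplitz[OF \<phi>] by blast
qed

end

section \<open>Combination of the results\<close>

lemma asymptotic_imp_compact_plus_toeplitz:
  assumes "asymptotic_toeplitz T"
  obtains K S where "compact_op bG H2_G K" "is_toeplitz S"
    "\<And>f. f \<in> H2_G \<Longrightarrow> AE x in bG. T f x = K f x + S f x"
proof -
  obtain B where T: "bounded_op bG H2_G T" and B: "bounded_op bG H2_G B"
    and comm: "weakly_tendsto bG H2_G (\<lambda>n f. (T_p_adj ^^ n)
      (\<lambda>x. T (T_s ((T_p ^^ n) f)) x - T_s (T ((T_p ^^ n) f)) x)) (\<lambda>f x. 0)"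
    and weak: "weakly_tendsto bG H2_G (\<lambda>n f. (T_p_adj ^^ n) (T ((T_p ^^ n) f))) B"
    and eta: "(\<lambda>n. dsum_opnorm bG H2_G (eta n (\<lambda>f x. T f x - B f x))) \<longlonglongrightarrow> 0"
    using assms unfolding asymptotic_toeplitz_def by blast
  have lim: "(\<lambda>n. l2_inner bG (T ((T_p ^^ n) f)) ((T_p ^^ n) g)) \<longlonglongrightarrow> l2_inner bG (B f) g"
    if "f \<in> H2_G" "g \<in> H2_G" for f g
    using weak that unfolding weakly_tendsto_def
    by (simp add: inner_T_p_adj_funpow bounded_opD(1)[OF T] T_p_funpow_H)
  have "is_toeplitz B"
  proof (rule toeplitz_if_relations[OF B])
    fix f g assume f: "f \<in> H2_G" and g: "g \<in> H2_G"
    \<comment> \<open>Compressing \<open>f\<close> and \<open>g\<close> by n + 1 powers of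
      \<open>T_p\<close> is compressing \<open>T_p f\<close> and \<open>T_p g\<close> by n powers;
      uniqueness of the limit gives the first relation.\<close>
    have "(\<lambda>n. l2_inner bG (T ((T_p ^^ Suc n) f)) ((T_p ^^ Suc n) g)) \<longlonglongrightarrow> l2_inner bG (B (T_p f)) (T_p g)"
      using lim[OF T_p(1)[OF f] T_p(1)[OF g]] by (simp add: funpow_swap1)
    with LIMSEQ_Suc[OF lim[OF f g]] show "l2_inner bG (B (T_p f)) (T_p g) = l2_inner bG (B f) g"
      by (rule LIMSEQ_unique[rotated])
    \<comment> \<open>The hypothesis says that this limit is 0, while
      \<open>commutator_tendsto\<close> computes it in terms of \<open>B\<close>; equating the two
      gives the second relation.\<close>
    have "(\<lambda>n. l2_inner bG ((T_p_adj ^^ n) (\<lambda>x. T (T_s ((T_p ^^ n) f)) x - T_s (T ((T_p ^^ n) f)) x)) g)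
        \<longlonglongrightarrow> l2_inner bG (\<lambda>x. 0) g"
      using comm f g unfolding weakly_tendsto_def by blast
    from LIMSEQ_unique[OF commutator_tendsto[OF T B weak f g] this]
    show "l2_inner bG (B (T_s f)) g = l2_inner bG (B (T_p f)) (T_s g)"
      by (simp add: l2_inner_zero_left)
  qed
  moreover have "compact_op bG H2_G (\<lambda>f x. T f x - B f x)"
    by (rule eta_tendsto_0_imp_compact[OF bounded_op_diff[OF T B] eta])
  ultimately show thesis
    using that[of "\<lambda>f x. T f x - B f x" B] by simp
qed

theorem theorem4:
  fixes T :: "(complex \<times> complex \<Rightarrow> complex) \<Rightarrow> complex \<times> complex \<Rightarrow> complex"
  assumes "bounded_op bG H2_G T"
  shows "asymptotic_toeplitz T \<longleftrightarrow>
    (\<exists>K S. compact_op bG H2_G K \<and> is_toeplitz S \<and>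
       (\<forall>f\<in>H2_G. AE x in bG. T f x = K f x + S f x))"
proof
  assume "asymptotic_toeplitz T"
  then obtain K S where "compact_op bG H2_G K" "is_toeplitz S"
    "\<And>f. f \<in> H2_G \<Longrightarrow> AE x in bG. T f x = K f x + S f x"
    by (rule asymptotic_imp_compact_plus_toeplitz) (rule that)
  then show "\<exists>K S. compact_op bG H2_G K \<and> is_toeplitz S \<and> (\<forall>f\<in>H2_G. AE x in bG. T f x = K f x + S f x)"
    by blast
next
  assume "\<exists>K S. compact_op bG H2_G K \<and> is_toeplitz S \<and> (\<forall>f\<in>H2_G. AE x in bG. T f x = K f x + S f x)"
  then obtain K S where "compact_op bG H2_G K" "is_toeplitz S"
    "\<forall>f\<in>H2_G. AE x in bG. T f x = K f x + S f x"
    by blast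
  then show "asymptotic_toeplitz T"
    using compact_plus_toeplitz_imp_asymptotic[OF assms] by blast
qed

end
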